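(* Let $H$ be a real separable Hilbert space. The completion of $\mathscr G_{\mathrm{fin}}(H)$ for the coordinate quasi-gauge $$\|(x,A,Q)\|_{\mathrm{crit}}=\|x\|_H+\|A\|_{1,\infty}+\|Q\|_1$$ (applied to coordinatewise differences) is canonically $$\mathscr G_{\mathrm{crit}}(H)=H\times\mathcal S^0_{1,\infty}(H)_{\mathrm{skew}}\times\mathcal S_1(H)_{\mathrm{sa}}.$$ The product $(x,A,Q)\circ(y,B,R)=(x+y,\,A+B+\frac12x\wedge_{\mathrm{op}}y,\,Q+R)$ and the inverse $(x,A,Q)^{-1}=(-x,-A,-Q)$ extend continuously and make this space a separable complete topological group. More precisely, there are an exponent $0<\vartheta\le1$ and an equivalent quasi-norm $\|\cdot\|_{1,\infty,*}$ on $\mathcal S^0_{1,\infty}(H)$ such that $\|S+T\|_{1,\infty,*}^\vartheta\le\|S\|_{1,\infty,*}^\vartheta+\|T\|_{1,\infty,*}^\vartheta$, and consequently $$d_{\mathrm{crit}}(g,h)=\|x_g-x_h\|_H^\vartheta+\|A_g-A_h\|_{1,\infty,*}^\vartheta+\|Q_g-Q_h\|_1^\vartheta$$ is a compatible complete metric. In particular $\mathscr G_{\mathrm{crit}}(H)$ is Polish. The set $\mathscr G^+_{\mathrm{crit}}(H)=\{(x,A,Q)\in\mathscr G_{\mathrm{crit}}(H):Q\succeq0\}$ is a closed submonoid. For every bounded linear $L:H\to H'$ into a real separable Hilbert space, $L_\#(x,A,Q)=(Lx,LAL^*,LQL^* )$ is a continuous homomorphism $\mathscr G_{\mathrm{crit}}(H)\to\mathscr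 G_{\mathrm{crit}}(H')$, and the dilations $\delta_a(x,A,Q)=(ax,a^2A,a^2Q)$, $a\in\mathbb R$, are continuous.
   Context: Singular values $s_n(T)$ are listed nonincreasingly with multiplicity. $\|T\|_{1,\infty}=\sup_{n\ge1}n\,s_n(T)$; $\mathcal S_{1,\infty}(H)$ is the set of compact $T$ with $\|T\|_{1,\infty}<\infty$; $\mathcal S^0_{1,\infty}(H)=\{T\in\mathcal S_{1,\infty}(H):n s_n(T)\to0\}$; $\mathcal S_1$ is the trace class with norm $\|\cdot\|_1$. Subscripts skew and sa denote skew-adjoint and self-adjoint operators. For $x,y\in H$, $x\otimes y$ is the operator $w\mapsto\langle w,y\rangle x$ and $x\wedge_{\mathrm{op}}y=x\otimes y-y\otimes x$. For finite-dimensional $E\subset H$, $\mathscr G_{\mathrm{fin}}(E)=E\times\mathcal L(E)_{\mathrm{skew}}\times\mathcal L(E)_{\mathrm{sa}}$, and $\mathscr G_{\mathrm{fin}}(H)=\bigcup_{\dim E<\infty}\mathscr G_{\mathrm{fin}}(E)$, the union being directed by isometric inclusion (operators on $E$ extended by zero), with product $\circ$ as displayed. *)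

theory Defs
  imports "HOL-Analysis.Analysis" "HOL-Algebra.Group"
begin

section \<open>Singular values and operator ideals\<close>

definition compact_operator :: "('a::real_normed_vector \<Rightarrow>\<^sub>L 'b::real_normed_vector) \<Rightarrow> bool" where
  "compact_operator T \<longleftrightarrow> compact (closure (blinfun_apply T ` cball 0 1))"

definition adj :: "('a::real_inner \<Rightarrow>\<^sub>L 'b::real_inner) \<Rightarrow> 'b \<Rightarrow>\<^sub>L 'a" where
  "adj T = Blinfun (adjoint (blinfun_apply T))"

text \<open>
  A singular value of \<open>T\<close> is an eigenvalue of \<open>|T| = (T\<^sup>* T)\<^sup>1\<^sup>/\<^sup>2\<close>; its multiplicity is the
  dimension of the kernel of \<open>T\<^sup>* T - \<sigma>\<^sup>2\<close>. The sequence below lists the positive ones in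
  nonincreasing order with multiplicity and is padded by zeros if there are only finitely many.
  Finiteness of the level sets must be required explicitly, because \<^const>\<open>card\<close> is \<open>0\<close> on
  infinite sets. Indices start at \<open>0\<close>: \<open>singular_value T n\<close> is the usual \<open>s\<^bsub>n+1\<^esub>(T)\<close>.
  The description is meaningful (and unique) for compact \<open>T\<close>, the only case in which it is used.
\<close>

definition singular_sequence ::
    "('a::real_inner \<Rightarrow>\<^sub>L 'b::real_inner) \<Rightarrow> (nat \<Rightarrow> real) \<Rightarrow> bool" where
  "singular_sequence T s \<longleftrightarrow>
     decseq s \<and> (\<forall>n. 0 \<le> s n) \<and>
     (\<forall>\<sigma>>0. finite {n. s n = \<sigma>} \<and>
             card {n. s n = \<sigma>} = dim {x. adj T (T x) = \<sigma>\<^sup>2 *\<^sub>R x})"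

definition singular_value :: "('a::real_inner \<Rightarrow>\<^sub>L 'b::real_inner) \<Rightarrow> nat \<Rightarrow> real" where
  "singular_value T = (THE s. singular_sequence T s)"

definition weak_norm :: "('a::real_inner \<Rightarrow>\<^sub>L 'a) \<Rightarrow> real" where
  "weak_norm T = (SUP n. real (Suc n) * singular_value T n)"

definition weak_ideal :: "('a::real_inner \<Rightarrow>\<^sub>L 'a) set" where
  "weak_ideal = {T. compact_operator T \<and> bdd_above (range (\<lambda>n. real (Suc n) * singular_value T n))}"

definition weak_ideal0 :: "('a::real_inner \<Rightarrow>\<^sub>L 'a) set" where
  "weak_ideal0 = {T \<in> weak_ideal. (\<lambda>n. real (Suc n) * singular_value T n) \<longlonglongrightarrow> 0}"

definition trace_class :: "('a::real_inner \<Rightarrow>\<^sub>L 'a) set" where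
  "trace_class = {T. compact_operator T \<and> summable (singular_value T)}"

definition trace_norm :: "('a::real_inner \<Rightarrow>\<^sub>L 'a) \<Rightarrow> real" where
  "trace_norm T = (\<Sum>n. singular_value T n)"

definition skew :: "('a::real_inner \<Rightarrow>\<^sub>L 'a) set" where
  "skew = {A :: 'a \<Rightarrow>\<^sub>L 'a. \<forall>v w. A v \<bullet> w = - (v \<bullet> A w)}"

definition selfadj :: "('a::real_inner \<Rightarrow>\<^sub>L 'a) set" where
  "selfadj = {Q :: 'a \<Rightarrow>\<^sub>L 'a. \<forall>v w. Q v \<bullet> w = v \<bullet> Q w}"

definition psd :: "('a::real_inner \<Rightarrow>\<^sub>L 'a) set" where
  "psd = {Q \<in> selfadj. \<forall>v. 0 \<le> Q v \<bullet> v}"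

lift_definition tensor_op :: "'a::real_inner \<Rightarrow> 'a \<Rightarrow> 'a \<Rightarrow>\<^sub>L 'a" is "\<lambda>x y w. (w \<bullet> y) *\<^sub>R x"
  by (intro bounded_linear_scaleR_const bounded_linear_inner_left)

definition wedge_op :: "'a::real_inner \<Rightarrow> 'a \<Rightarrow> 'a \<Rightarrow>\<^sub>L 'a" where
  "wedge_op x y = tensor_op x y - tensor_op y x"


section \<open>Quasi-norms, quasi-gauges and completions\<close>

definition quasi_norm_on :: "'v::real_vector set \<Rightarrow> ('v \<Rightarrow> real) \<Rightarrow> bool" where
  "quasi_norm_on V N \<longleftrightarrow>
     subspace V \<and>
     (\<forall>v\<in>V. 0 \<le> N v \<and> (N v = 0 \<longleftrightarrow> v = 0)) \<and>
     (\<forall>c. \<forall>v\<in>V. N (c *\<^sub>R v) = \<bar>c\<bar> * N v) \<and>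
     (\<exists>K. \<forall>v\<in>V. \<forall>w\<in>V. N (v + w) \<le> K * (N v + N w))"

definition equivalent_on :: "'v set \<Rightarrow> ('v \<Rightarrow> real) \<Rightarrow> ('v \<Rightarrow> real) \<Rightarrow> bool" where
  "equivalent_on V N M \<longleftrightarrow> (\<exists>c>0. \<exists>C>0. \<forall>v\<in>V. c * M v \<le> N v \<and> N v \<le> C * M v)"

text \<open>A quasi-gauge \<open>\<rho>\<close> is always applied to differences \<open>g - h\<close> of points of \<open>X\<close>.\<close>

definition quasi_gauge_on :: "'g::group_add set \<Rightarrow> ('g \<Rightarrow> real) \<Rightarrow> bool" where
  "quasi_gauge_on X \<rho> \<longleftrightarrow>
     (\<forall>g\<in>X. \<forall>h\<in>X. 0 \<le> \<rho> (g - h) \<and> (\<rho> (g - h) = 0 \<longleftrightarrow> g = h) \<and> \<rho> (g - h) = \<rho> (h - g)) \<and>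
     (\<exists>K. \<forall>g\<in>X. \<forall>h\<in>X. \<forall>k\<in>X. \<rho> (g - k) \<le> K * (\<rho> (g - h) + \<rho> (h - k)))"

definition gauge_complete :: "'g::group_add set \<Rightarrow> ('g \<Rightarrow> real) \<Rightarrow> bool" where
  "gauge_complete X \<rho> \<longleftrightarrow>
     (\<forall>\<sigma>::nat \<Rightarrow> 'g. range \<sigma> \<subseteq> X \<and>
        (\<forall>e>0. \<exists>n0. \<forall>m\<ge>n0. \<forall>n\<ge>n0. \<rho> (\<sigma> m - \<sigma> n) < e) \<longrightarrow>
        (\<exists>l\<in>X. (\<lambda>n. \<rho> (\<sigma> n - l)) \<longlonglongrightarrow> 0))"

text \<open>\<open>X\<close>, with the inclusion of \<open>D\<close>, is the (Hausdorff) completion of \<open>D\<close> for \<open>\<rho>\<close>.\<close>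

definition is_completion :: "'g::group_add set \<Rightarrow> 'g set \<Rightarrow> ('g \<Rightarrow> real) \<Rightarrow> bool" where
  "is_completion D X \<rho> \<longleftrightarrow>
     D \<subseteq> X \<and> quasi_gauge_on X \<rho> \<and> gauge_complete X \<rho> \<and>
     (\<forall>g\<in>X. \<forall>e>0. \<exists>h\<in>D. \<rho> (h - g) < e)"

definition gauge_topology :: "'g::group_add set \<Rightarrow> ('g \<Rightarrow> real) \<Rightarrow> 'g topology" where
  "gauge_topology X \<rho> =
     topology (\<lambda>U. U \<subseteq> X \<and> (\<forall>g\<in>U. \<exists>e>0. \<forall>h\<in>X. \<rho> (h - g) < e \<longrightarrow> h \<in> U))"

lemma openin_gauge_topology:
  "openin (gauge_topology X \<rho>) U \<longleftrightarrow>
     U \<subseteq> X \<and> (\<forall>g\<in>U. \<exists>e>0. \<forall>h\<in>X. \<rho> (h - g) < e \<longrightarrow> h \<in> U)"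
proof -
  let ?P = "\<lambda>U. U \<subseteq> X \<and> (\<forall>g\<in>U. \<exists>e>0. \<forall>h\<in>X. \<rho> (h - g) < e \<longrightarrow> h \<in> U)"
  have "?P (S \<inter> T)" if S: "?P S" and T: "?P T" for S T
  proof (intro conjI ballI)
    show "S \<inter> T \<subseteq> X" using S by blast
    fix g assume g: "g \<in> S \<inter> T"
    obtain d where d: "d > 0" "\<forall>h\<in>X. \<rho> (h - g) < d \<longrightarrow> h \<in> S" using S g by blast
    obtain e where e: "e > 0" "\<forall>h\<in>X. \<rho> (h - g) < e \<longrightarrow> h \<in> T" using T g by blast
    show "\<exists>e>0. \<forall>h\<in>X. \<rho> (h - g) < e \<longrightarrow> h \<in> S \<inter> T"
      using d e by (intro exI[of _ "min d e"]) auto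
  qed
  moreover have "?P (\<Union>\<K>)" if "\<forall>K\<in>\<K>. ?P K" for \<K>
    using that by (meson UnionE UnionI Union_least)
  ultimately have "istopology ?P"
    unfolding istopology_def by blast
  then show ?thesis
    unfolding gauge_topology_def by (simp add: topology_inverse')
qed

lemma topspace_gauge_topology [simp]: "topspace (gauge_topology X \<rho>) = X"
proof -
  have "openin (gauge_topology X \<rho>) X"
    by (auto simp: openin_gauge_topology intro: exI[of _ "1::real"])
  then show ?thesis
    by (metis openin_gauge_topology openin_subset openin_topspace subset_antisym)
qed


section \<open>Topological groups\<close>

definition topological_group :: "('g, 'm) monoid_scheme \<Rightarrow> 'g topology \<Rightarrow> bool" where
  "topological_group G X \<longleftrightarrow>
     group G \<and> topspace X = carrier G \<and>
     continuous_map (prod_topology X X) X (\<lambda>(g, h). g \<otimes>\<^bsub>G\<^esub> h) \<and>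
     continuous_map X X (\<lambda>g. inv\<^bsub>G\<^esub> g)"

text \<open>Completeness with respect to the two-sided uniformity of the group.\<close>

definition complete_group :: "('g, 'm) monoid_scheme \<Rightarrow> 'g topology \<Rightarrow> bool" where
  "complete_group G X \<longleftrightarrow>
     (\<forall>F. F \<noteq> bot \<and> F \<le> principal (carrier G) \<and>
        (\<forall>U. openin X U \<and> \<one>\<^bsub>G\<^esub> \<in> U \<longrightarrow>
           (\<exists>S\<subseteq>carrier G. eventually (\<lambda>g. g \<in> S) F \<and>
              (\<forall>g\<in>S. \<forall>h\<in>S. inv\<^bsub>G\<^esub> g \<otimes>\<^bsub>G\<^esub> h \<in> U \<and> h \<otimes>\<^bsub>G\<^esub> inv\<^bsub>G\<^esub> g \<in> U))) \<longrightarrow>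
        (\<exists>l. limitin X (\<lambda>g. g) l F))"

definition polish_topology :: "'g topology \<Rightarrow> bool" where
  "polish_topology X \<longleftrightarrow> separable_space X \<and> completely_metrizable_space X"


section \<open>The critical group\<close>

type_synonym 'a triple = "'a \<times> ('a \<Rightarrow>\<^sub>L 'a) \<times> ('a \<Rightarrow>\<^sub>L 'a)"

text \<open>Operators on the subspace \<open>E\<close>, extended by zero on its orthogonal complement.\<close>

definition operators_on :: "'a::real_inner set \<Rightarrow> ('a \<Rightarrow>\<^sub>L 'a) set" where
  "operators_on E = {T :: 'a \<Rightarrow>\<^sub>L 'a. (\<forall>w. T w \<in> E) \<and> (\<forall>w. (\<forall>v\<in>E. w \<bullet> v = 0) \<longrightarrow> T w = 0)}"

definition G_fin_on :: "'a::real_inner set \<Rightarrow> 'a triple set" where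
  "G_fin_on E = E \<times> (operators_on E \<inter> skew) \<times> (operators_on E \<inter> selfadj)"

definition G_fin :: "'a::real_inner triple set" where
  "G_fin = (\<Union>E\<in>{E. \<exists>B. finite B \<and> E = span B}. G_fin_on E)"

definition G_crit :: "'a::real_inner triple set" where
  "G_crit = UNIV \<times> (weak_ideal0 \<inter> skew) \<times> (trace_class \<inter> selfadj)"

fun crit_gauge :: "'a::real_inner triple \<Rightarrow> real" where
  "crit_gauge (x, A, Q) = norm x + weak_norm A + trace_norm Q"

fun crit_mult :: "'a::real_inner triple \<Rightarrow> 'a triple \<Rightarrow> 'a triple" where
  "crit_mult (x, A, Q) (y, B, R) = (x + y, A + B + (1/2) *\<^sub>R wedge_op x y, Q + R)"

definition crit_group :: "'a::real_inner triple monoid" where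
  "crit_group = \<lparr>carrier = G_crit, mult = crit_mult, one = (0, 0, 0)\<rparr>"

definition crit_topology :: "'a::real_inner triple topology" where
  "crit_topology = gauge_topology G_crit crit_gauge"

definition G_crit_pos :: "'a::real_inner triple set" where
  "G_crit_pos = {(x, A, Q) \<in> G_crit. Q \<in> psd}"

text \<open>
  The locale \<^locale>\<open>Metric_space\<close> demands symmetry also off the carrier, where \<open>N\<close> is
  unconstrained; hence the value \<open>0\<close> there.
\<close>

definition crit_dist ::
    "real \<Rightarrow> (('a::real_inner \<Rightarrow>\<^sub>L 'a) \<Rightarrow> real) \<Rightarrow> 'a triple \<Rightarrow> 'a triple \<Rightarrow> real" where
  "crit_dist \<theta> N g h =
     (if g \<in> G_crit \<and> h \<in> G_crit
      then (case g of (x, A, Q) \<Rightarrow> case h of (y, B, R) \<Rightarrow>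
              norm (x - y) powr \<theta> + N (A - B) powr \<theta> + trace_norm (Q - R) powr \<theta>)
      else 0)"

text \<open>\<open>N\<close> is an equivalent quasi-norm on the separable part of the weak ideal, with subadditive
  \<open>\<theta>\<close>-th power.\<close>

definition power_subadditive_renorming :: "real \<Rightarrow> (('a::real_inner \<Rightarrow>\<^sub>L 'a) \<Rightarrow> real) \<Rightarrow> bool" where
  "power_subadditive_renorming \<theta> N \<longleftrightarrow>
     quasi_norm_on weak_ideal0 N \<and> equivalent_on weak_ideal0 N weak_norm \<and>
     (\<forall>S\<in>weak_ideal0. \<forall>T\<in>weak_ideal0. N (S + T) powr \<theta> \<le> N S powr \<theta> + N T powr \<theta>)"

fun pushforward :: "('a::real_inner \<Rightarrow>\<^sub>L 'b::real_inner) \<Rightarrow> 'a triple \<Rightarrow> 'b triple" where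
  "pushforward L (x, A, Q) = (L x, L o\<^sub>L A o\<^sub>L adj L, L o\<^sub>L Q o\<^sub>L adj L)"

fun dilation :: "real \<Rightarrow> 'a::real_inner triple \<Rightarrow> 'a triple" where
  "dilation a (x, A, Q) = (a *\<^sub>R x, a\<^sup>2 *\<^sub>R A, a\<^sup>2 *\<^sub>R Q)"

end

theory Submission
  imports Defs
begin

text \<open>Everything rests on the identity of singular values with approximation numbers
  \<open>a\<^sub>n T = inf {\<parallel>T - F\<parallel> | rank F \<le> n}\<close>, valid for compact \<open>T\<close>
  (\<open>singular_value_eq_approx_number\<close>). It is obtained from a Schmidt decomposition built by
  repeatedly splitting off a vector at which the norm is attained; the singular sequence itself is
  then unique because its level sets have prescribed finite sizes. For approximation numbers
  the inequalities \<open>a\<^sub>m\<^sub>+\<^sub>n (S + T) \<le> a\<^sub>m S + a\<^sub>n T\<close> and \<open>a\<^sub>n (L T L\<^sup>*) \<le> \<parallel>L\<parallel>\<^sup>2 a\<^sub>n T\<close> are immediate,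
  and a compact operator is one with \<open>a\<^sub>n \<rightarrow> 0\<close>. So both ideals become conditions on one
  sequence: \<open>n a\<^sub>n \<rightarrow> 0\<close> up to an index shift, and summability.

  Quasi-norm inequality, homogeneity and stability under push-forward follow. Completeness follows
  because \<open>a\<^sub>n\<close> is continuous in operator norm, so that Cauchy estimates pass to the operator norm
  limit; the separable part of the weak ideal is closed for the weak quasi-norm. The triangle inequality for the
  trace norm needs more than approximation numbers: it comes from the pairing of an operator with
  two orthonormal families (\<open>trace_norm_pairing\<close>). Truncating the Schmidt expansion shifts the
  approximation numbers, which gives density of finite rank operators in both ideals;
  antisymmetrising, respectively symmetrising, a finite rank approximation and moving its vectors
  into a countable dense set gives a countable dense subset of the finite-dimensional triples.

  The renorming has exponent \<open>1/2\<close>. Distributing an index budget over many summands yields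
  \<open>\<parallel>\<Sum>T\<^sub>i\<parallel>\<^sup>1\<^sup>/\<^sup>2 \<le> \<surd>2 \<Sum>\<parallel>T\<^sub>i\<parallel>\<^sup>1\<^sup>/\<^sup>2\<close> with a constant independent of the number of summands
  (\<open>weak_norm_sum_list\<close>), so the infimum of \<open>\<Sum>\<parallel>T\<^sub>i\<parallel>\<^sup>1\<^sup>/\<^sup>2\<close> over decompositions is subadditive and
  comparable to the square root of the weak quasi-norm. Any such renorming gives a metric that is uniformly equivalent to the gauge,
  hence has the same topology and is complete.

  The group statements reduce to the estimate \<open>\<parallel>x \<and> y\<parallel> \<le> 4 \<parallel>x\<parallel> \<parallel>y\<parallel>\<close> in the weak quasi-norm. For
  completeness of the group, \<open>x \<and> y = x \<and> (y - x)\<close> shows that closeness of \<open>g\<^sup>-\<^sup>1 h\<close> to the unit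
  is, on sets with bounded first coordinate, closeness of \<open>g\<close> and \<open>h\<close> for the gauge.\<close>

section \<open>Riesz representation and adjoints\<close>

text \<open>A minimising sequence is Cauchy, since midpoints cannot fall below the infimum \<open>m0\<close> and the
  parallelogram law then bounds \<open>\<parallel>x\<^sub>m - x\<^sub>n\<parallel>\<^sup>2\<close> by \<open>2 (J x\<^sub>m - m0) + 2 (J x\<^sub>n - m0)\<close>.\<close>

lemma Cauchy_of_parallelogram:
  fixes x :: "nat \<Rightarrow> 'a::{real_inner, complete_space}"
  assumes mid: "\<And>m n. m0 \<le> J ((1/2) *\<^sub>R (x m + x n))"
    and J: "\<And>m n. (norm (x m - x n))\<^sup>2 = 2 * J (x m) + 2 * J (x n) - 4 * J ((1/2) *\<^sub>R (x m + x n))"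
    and lim: "(\<lambda>n. J (x n)) \<longlonglongrightarrow> m0"
  shows "convergent x"
proof -
  have "Cauchy x"
  proof (rule metric_CauchyI)
    fix e :: real assume e: "0 < e"
    have "\<forall>\<^sub>F n in sequentially. J (x n) < m0 + e\<^sup>2/4"
      using e by (intro order_tendstoD(2)[OF lim]) simp
    then obtain n0 where n0: "\<And>n. n \<ge> n0 \<Longrightarrow> J (x n) < m0 + e\<^sup>2/4"
      by (auto simp: eventually_sequentially)
    show "\<exists>M. \<forall>m\<ge>M. \<forall>n\<ge>M. dist (x m) (x n) < e"
    proof (intro exI[of _ n0] allI impI)
      fix m n assume "n0 \<le> m" "n0 \<le> n"
      then have "(norm (x m - x n))\<^sup>2 < e\<^sup>2"
        using n0[of m] n0[of n] mid[of m n] unfolding J by linarith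
      then show "dist (x m) (x n) < e"
        using e by (simp add: dist_norm power2_less_imp_less)
    qed
  qed
  then show ?thesis by (simp add: Cauchy_convergent_iff)
qed

text \<open>The representing vector is the minimiser of \<open>J x = \<parallel>x\<parallel>\<^sup>2 - 2 f x\<close>: minimising sequences are
  Cauchy by the parallelogram law, and the first-order condition at the minimum is \<open>x \<bullet> y = f y\<close>.\<close>

lemma riesz_representation:
  fixes f :: "'a::{real_inner, complete_space} \<Rightarrow> real"
  assumes f: "bounded_linear f"
  shows "\<exists>x. \<forall>y. f y = x \<bullet> y"
proof -
  interpret bounded_linear f by fact
  define J where "J x = (norm x)\<^sup>2 - 2 * f x" for x
  obtain K where K: "\<And>x. norm (f x) \<le> norm x * K" using bounded by blast
  have low: "- K\<^sup>2 \<le> J x" for x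
  proof -
    have "0 \<le> (norm x - K)\<^sup>2" by simp
    then show ?thesis using K[of x] unfolding J_def power2_diff real_norm_def
      by (simp add: algebra_simps)
  qed
  define m0 where "m0 = (INF x. J x)"
  have bdd: "bdd_below (range J)" using low by (auto simp: bdd_below_def)
  have m0: "m0 \<le> J x" for x unfolding m0_def by (rule cINF_lower[OF bdd]) simp
  have "\<exists>x. J x < m0 + 1 / real (Suc n)" for n
  proof -
    have "(INF x. J x) < m0 + 1 / real (Suc n)" by (simp add: m0_def)
    then show ?thesis using cINF_less_iff[OF _ bdd] by auto
  qed
  then obtain x where x: "\<And>n. J (x n) < m0 + 1 / real (Suc n)" by metis
  have lim: "(\<lambda>n. J (x n)) \<longlonglongrightarrow> m0"
  proof (rule tendsto_sandwich[of "\<lambda>n. m0" _ _ "\<lambda>n. m0 + 1 / real (Suc n)"])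
    show "(\<lambda>n. m0 + 1 / real (Suc n)) \<longlonglongrightarrow> m0"
      using tendsto_add[OF tendsto_const LIMSEQ_inverse_real_of_nat, of m0]
      by (simp add: inverse_eq_divide)
  qed (use m0 x in \<open>auto intro!: always_eventually less_imp_le\<close>)
  have par: "(norm (x m - x n))\<^sup>2 = 2 * J (x m) + 2 * J (x n) - 4 * J ((1/2) *\<^sub>R (x m + x n))" for m n
    by (simp add: J_def add scaleR power2_norm_eq_inner power_mult_distrib inner_add_left inner_add_right
        inner_diff_left inner_diff_right inner_commute algebra_simps)
  obtain z where z: "x \<longlonglongrightarrow> z"
    using Cauchy_of_parallelogram[of m0 J x, OF m0 par lim] by (auto simp: convergent_def)
  have "(\<lambda>n. J (x n)) \<longlonglongrightarrow> J z"
    unfolding J_def by (intro tendsto_intros z tendsto)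
  then have Jz: "J z = m0" using lim LIMSEQ_unique by blast
  have "f y = z \<bullet> y" for y
  proof (cases "y = 0")
    case True then show ?thesis by (simp add: zero)
  next
    case False
    define b where "b = z \<bullet> y - f y"
    define t where "t = - b / (norm y)\<^sup>2"
    have "J z \<le> J (z + t *\<^sub>R y)" using m0 Jz by simp
    also have "J (z + t *\<^sub>R y) = J z + 2 * t * b + t * t * (norm y)\<^sup>2"
      by (simp add: J_def b_def add scaleR power2_norm_eq_inner inner_add_left inner_add_right
          inner_commute algebra_simps)
    also have "\<dots> = J z - b\<^sup>2 / (norm y)\<^sup>2"
      using False by (simp add: t_def field_simps power2_eq_square)
    finally have "b\<^sup>2 / (norm y)\<^sup>2 \<le> 0" by simp
    then have "b = 0" using False by (simp add: divide_le_0_iff)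
    then show ?thesis by (simp add: b_def)
  qed
  then show ?thesis by blast
qed

lemma ex_adjoint:
  fixes T :: "'a::{real_inner, complete_space} \<Rightarrow>\<^sub>L 'b::real_inner"
  shows "\<exists>S :: 'b \<Rightarrow>\<^sub>L 'a. \<forall>x y. T x \<bullet> y = x \<bullet> S y"
proof -
  have "\<exists>z. \<forall>x. T x \<bullet> y = z \<bullet> x" for y
    by (rule riesz_representation) (rule bounded_linear_compose[OF bounded_linear_inner_left blinfun.bounded_linear_right])
  then obtain g where g: "\<And>x y. T x \<bullet> y = g y \<bullet> x" by metis
  have "bounded_linear g"
  proof (rule bounded_linear_intro[of _ "norm T"])
    fix u v :: 'b and r :: real
    show "g (u + v) = g u + g v"
      by (rule vector_eq_rdot[THEN iffD1]) (auto simp: inner_add_left inner_add_right simp flip: g)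
    show "g (r *\<^sub>R u) = r *\<^sub>R g u"
      by (rule vector_eq_rdot[THEN iffD1]) (auto simp flip: g)
    have "norm (g u) * norm (g u) = T (g u) \<bullet> u" by (simp add: g norm_eq_sqrt_inner)
    also have "\<dots> \<le> norm (T (g u)) * norm u" by (rule norm_cauchy_schwarz)
    also have "\<dots> \<le> norm (g u) * (norm T * norm u)"
      using norm_blinfun[of T "g u"] by (metis mult.assoc mult.commute mult_right_mono norm_ge_zero)
    finally show "norm (g u) \<le> norm u * norm T"
      by (cases "g u = 0") (auto simp: mult.commute)
  qed
  then show ?thesis
    by (intro exI[of _ "Blinfun g"]) (simp add: bounded_linear_Blinfun_apply g, simp add: inner_commute)
qed

lemma adj_inner:
  fixes T :: "'a::{real_inner, complete_space} \<Rightarrow>\<^sub>L 'b::real_inner"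
  shows "x \<bullet> adj T y = T x \<bullet> y"
proof -
  obtain S :: "'b \<Rightarrow>\<^sub>L 'a" where S: "\<And>x y. T x \<bullet> y = x \<bullet> S y" using ex_adjoint by blast
  then have "adjoint (blinfun_apply T) = blinfun_apply S" by (intro adjoint_unique) auto
  then show ?thesis by (simp add: adj_def blinfun_apply_inverse S)
qed

lemma adj_inner': "adj T y \<bullet> x = y \<bullet> T x"
  for T :: "'a::{real_inner, complete_space} \<Rightarrow>\<^sub>L 'b::real_inner"
  by (metis adj_inner inner_commute)

lemma adj_eqI:
  fixes T :: "'a::{real_inner, complete_space} \<Rightarrow>\<^sub>L 'b::real_inner" and S :: "'b \<Rightarrow>\<^sub>L 'a"
  assumes "\<And>x y. T x \<bullet> y = x \<bullet> S y"
  shows "adj T = S"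
  by (rule blinfun_eqI, rule vector_eq_ldot[THEN iffD1]) (simp add: adj_inner flip: assms)

lemma norm_adj_le:
  fixes T :: "'a::{real_inner, complete_space} \<Rightarrow>\<^sub>L 'b::real_inner"
  shows "norm (adj T) \<le> norm T"
proof (rule norm_blinfun_bound)
  fix y
  let ?z = "adj T y"
  have "norm ?z * norm ?z = T ?z \<bullet> y" by (metis adj_inner power2_eq_square power2_norm_eq_inner)
  also have "\<dots> \<le> norm (T ?z) * norm y" by (rule norm_cauchy_schwarz)
  also have "\<dots> \<le> norm ?z * (norm T * norm y)"
    using norm_blinfun[of T ?z] by (metis mult.assoc mult.commute mult_right_mono norm_ge_zero)
  finally show "norm ?z \<le> norm T * norm y" by (cases "?z = 0") auto
qed simp

lemma adj_minus:
  fixes S T :: "'a::{real_inner, complete_space} \<Rightarrow>\<^sub>L 'b::real_inner"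
  shows "adj (S - T) = adj S - adj T"
  by (rule adj_eqI) (simp add: blinfun.diff_left inner_diff_left inner_diff_right adj_inner)

lemma adj_skew: "A \<in> skew \<Longrightarrow> adj A = - A"
  for A :: "'a::{real_inner, complete_space} \<Rightarrow>\<^sub>L 'a"
  by (rule adj_eqI) (simp add: skew_def blinfun.minus_left)

lemma adj_selfadj: "A \<in> selfadj \<Longrightarrow> adj A = A"
  for A :: "'a::{real_inner, complete_space} \<Rightarrow>\<^sub>L 'a"
  by (rule adj_eqI) (simp add: selfadj_def)

text \<open>The limit is taken pointwise; the Cauchy estimate is uniform on the unit ball, so it survives
  the limit and gives both boundedness and convergence in norm.\<close>

lemma blinfun_Cauchy_limit:
  fixes X :: "nat \<Rightarrow> 'a::real_normed_vector \<Rightarrow>\<^sub>L 'b::{real_normed_vector, complete_space}"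
  assumes X: "\<And>e. e > 0 \<Longrightarrow> \<exists>n0. \<forall>m\<ge>n0. \<forall>n\<ge>n0. norm (X m - X n) < e"
  shows "\<exists>T. (\<lambda>n. norm (X n - T)) \<longlonglongrightarrow> 0"
proof -
  have diff: "norm (X m x - X n x) \<le> norm (X m - X n) * norm x" for m n x
    by (metis blinfun.diff_left norm_blinfun)
  have "convergent (\<lambda>n. X n x)" for x
  proof -
    have "Cauchy (\<lambda>n. X n x)"
    proof (rule CauchyI)
      fix e :: real assume "0 < e"
      then obtain n0 where n0: "\<And>m n. m \<ge> n0 \<Longrightarrow> n \<ge> n0 \<Longrightarrow> norm (X m - X n) < e / (norm x + 1)"
        using X[of "e / (norm x + 1)"] by (auto simp: add_nonneg_pos)
      have "norm (X m x - X n x) < e" if "n0 \<le> m" "n0 \<le> n" for m n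
      proof -
        have "norm (X m - X n) * norm x \<le> norm (X m - X n) * (norm x + 1)"
          by (simp add: mult_left_mono)
        also have "\<dots> < e" using n0[OF that] by (simp add: pos_less_divide_eq add_nonneg_pos)
        finally show ?thesis using diff[of m x n] by simp
      qed
      then show "\<exists>M. \<forall>m\<ge>M. \<forall>n\<ge>M. norm (X m x - X n x) < e" by blast
    qed
    then show ?thesis by (simp add: Cauchy_convergent_iff)
  qed
  then obtain v where v: "\<And>x. (\<lambda>n. X n x) \<longlonglongrightarrow> v x" unfolding convergent_def by metis
  have close: "norm (X m x - v x) \<le> e * norm x"
    if close: "\<And>m n. m \<ge> n0 \<Longrightarrow> n \<ge> n0 \<Longrightarrow> norm (X m - X n) < e" and "n0 \<le> m" for e n0 m x
  proof (rule tendsto_upperbound)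
    show "(\<lambda>n. norm (X m x - X n x)) \<longlonglongrightarrow> norm (X m x - v x)" by (intro tendsto_intros v)
    have "norm (X m x - X n x) \<le> e * norm x" if n: "n0 \<le> n" for n
      using diff[of m x n] mult_right_mono[OF less_imp_le[OF close[OF \<open>n0 \<le> m\<close> n]] norm_ge_zero[of x]]
      by linarith
    then show "\<forall>\<^sub>F n in sequentially. norm (X m x - X n x) \<le> e * norm x"
      by (auto simp: eventually_sequentially)
  qed simp
  obtain n1 where n1: "\<And>m n. m \<ge> n1 \<Longrightarrow> n \<ge> n1 \<Longrightarrow> norm (X m - X n) < 1" using X[of 1] by auto
  have bl: "bounded_linear v"
  proof (rule bounded_linear_intro[of _ "norm (X n1) + 1"])
    fix x y r
    show "v (x + y) = v x + v y"
      using tendsto_add[OF v[of x] v[of y]] v[of "x + y"]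
      by (simp add: blinfun.add_right LIMSEQ_unique)
    show "v (r *\<^sub>R x) = r *\<^sub>R v x"
      using tendsto_scaleR[OF tendsto_const[of r] v[of x]] v[of "r *\<^sub>R x"]
      by (simp add: blinfun.scaleR_right LIMSEQ_unique)
    have "norm (v x) \<le> norm (X n1 x) + norm (X n1 x - v x)" by norm
    also have "\<dots> \<le> norm (X n1) * norm x + 1 * norm x"
      using close[where m = n1 and x = x, OF n1] by (intro add_mono norm_blinfun) auto
    finally show "norm (v x) \<le> norm x * (norm (X n1) + 1)" by (simp add: algebra_simps)
  qed
  have "(\<lambda>n. norm (X n - Blinfun v)) \<longlonglongrightarrow> 0"
  proof (rule LIMSEQ_I)
    fix e :: real assume e: "0 < e"
    obtain n0 where n0: "\<And>m n. m \<ge> n0 \<Longrightarrow> n \<ge> n0 \<Longrightarrow> norm (X m - X n) < e/2"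
      using X[of "e/2"] e by auto
    have "norm (X n - Blinfun v) \<le> e/2" if "n0 \<le> n" for n
      using close[OF n0 that] e
      by (intro norm_blinfun_bound) (auto simp: blinfun.diff_left bounded_linear_Blinfun_apply[OF bl])
    then show "\<exists>n0. \<forall>n\<ge>n0. norm (norm (X n - Blinfun v) - 0) < e"
      using e by (intro exI[of _ n0]) force
  qed
  then show ?thesis by blast
qed

section \<open>Approximation numbers\<close>

text \<open>Rank at most \<open>n\<close>, expressed by tensors: in this form stability under sums, adjoints and
  \<open>F \<mapsto> L F L\<^sup>*\<close> is a computation on the vectors.\<close>

definition rank_le :: "nat \<Rightarrow> ('a::real_inner \<Rightarrow>\<^sub>L 'a) set" where
  "rank_le n = {F. \<exists>u v. F = (\<Sum>i<n. tensor_op (u i) (v i))}"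

definition approx_number :: "('a::real_inner \<Rightarrow>\<^sub>L 'a) \<Rightarrow> nat \<Rightarrow> real" where
  "approx_number T n = (INF F\<in>rank_le n. norm (T - F))"

lemma tensor_op_apply [simp]: "tensor_op x y w = (w \<bullet> y) *\<^sub>R x"
  by transfer simp

lemma norm_tensor_op: "norm (tensor_op x y) \<le> norm x * norm y"
proof (rule norm_blinfun_bound)
  fix w
  have "norm (tensor_op x y w) = \<bar>w \<bullet> y\<bar> * norm x" by simp
  also have "\<dots> \<le> norm w * norm y * norm x" by (intro mult_right_mono Cauchy_Schwarz_ineq2) simp
  finally show "norm (tensor_op x y w) \<le> norm x * norm y * norm w" by (simp add: mult_ac)
qed simp

interpretation tensor_op: bounded_bilinear tensor_op
proof
  fix x x' y y' :: 'a and c :: real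
  show "tensor_op (x + x') y = tensor_op x y + tensor_op x' y"
    "tensor_op x (y + y') = tensor_op x y + tensor_op x y'"
    "tensor_op (c *\<^sub>R x) y = c *\<^sub>R tensor_op x y" "tensor_op x (c *\<^sub>R y) = c *\<^sub>R tensor_op x y"
    by (rule blinfun_eqI; simp add: blinfun.bilinear_simps scaleR_add_right scaleR_add_left inner_add_right)+
  show "\<exists>K. \<forall>x y :: 'a. norm (tensor_op x y) \<le> norm x * norm y * K"
    by (intro exI[of _ 1]) (simp add: norm_tensor_op)
qed

interpretation blinfun_compose: bounded_bilinear "(o\<^sub>L)"
  by (rule bounded_bilinear_blinfun_compose)

lemma pushforward_tensor_op:
  fixes L :: "'a::{real_inner, complete_space} \<Rightarrow>\<^sub>L 'b::real_inner"
  shows "L o\<^sub>L tensor_op x y o\<^sub>L adj L = tensor_op (L x) (L y)"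
  by (rule blinfun_eqI) (simp add: blinfun.scaleR_right adj_inner')

lemma adj_tensor_op: "adj (tensor_op x y) = tensor_op y (x::'a::{real_inner, complete_space})"
  by (rule adj_eqI) (simp add: inner_commute)

lemma adj_sum:
  fixes T :: "'i \<Rightarrow> 'a::{real_inner, complete_space} \<Rightarrow>\<^sub>L 'b::real_inner"
  shows "adj (\<Sum>i\<in>I. T i) = (\<Sum>i\<in>I. adj (T i))"
  by (rule adj_eqI) (simp add: blinfun.sum_left inner_sum_left inner_sum_right adj_inner)

lemma rank_leI: "(\<Sum>i<n. tensor_op (u i) (v i)) \<in> rank_le n"
  by (auto simp: rank_le_def)

lemma rank_leE:
  assumes "F \<in> rank_le n" obtains u v where "F = (\<Sum>i<n. tensor_op (u i) (v i))"
  using assms by (auto simp: rank_le_def)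

text \<open>The two families of vectors are concatenated.\<close>

lemma rank_le_add: "F \<in> rank_le m \<Longrightarrow> G \<in> rank_le n \<Longrightarrow> F + G \<in> rank_le (m + n)"
proof -
  assume "F \<in> rank_le m" "G \<in> rank_le n"
  then obtain u v u' v' where F: "F = (\<Sum>i<m. tensor_op (u i) (v i))"
    and G: "G = (\<Sum>i<n. tensor_op (u' i) (v' i))" by (auto simp: rank_le_def)
  define p where "p i = (if i < m then u i else u' (i - m))" for i
  define q where "q i = (if i < m then v i else v' (i - m))" for i
  have "(\<Sum>i<m+n. tensor_op (p i) (q i))
    = (\<Sum>i<m. tensor_op (p i) (q i)) + (\<Sum>i<n. tensor_op (p (m + i)) (q (m + i)))"
    by (induction n) (auto simp: add.assoc)
  also have "\<dots> = F + G" by (simp add: F G p_def q_def)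
  finally show ?thesis by (metis rank_leI)
qed

lemma zero_rank_le [simp]: "0 \<in> rank_le n"
  using rank_leI[of "\<lambda>_. 0" "\<lambda>_. 0" n] by (simp add: tensor_op.zero_left)

lemma rank_le_mono: "F \<in> rank_le m \<Longrightarrow> m \<le> n \<Longrightarrow> F \<in> rank_le n"
  using rank_le_add[of F m 0 "n - m"] by simp

lemma rank_le_scaleR: "F \<in> rank_le n \<Longrightarrow> c *\<^sub>R F \<in> rank_le n"
  by (elim rank_leE) (auto simp: scaleR_sum_right intro: rank_leI simp flip: tensor_op.scaleR_left)

lemma rank_le_adj: "F \<in> rank_le n \<Longrightarrow> adj F \<in> rank_le n"
  for F :: "'a::{real_inner, complete_space} \<Rightarrow>\<^sub>L 'a"
  by (elim rank_leE) (auto simp: adj_sum adj_tensor_op intro: rank_leI)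

lemma rank_le_pushforward:
  fixes L :: "'a::{real_inner, complete_space} \<Rightarrow>\<^sub>L 'b::real_inner"
  shows "F \<in> rank_le n \<Longrightarrow> L o\<^sub>L F o\<^sub>L adj L \<in> rank_le n"
  by (elim rank_leE)
    (auto simp: blinfun_compose.sum_left blinfun_compose.sum_right pushforward_tensor_op intro: rank_leI)

lemma bdd_below_approx: "bdd_below ((\<lambda>F. norm (T - F)) ` A)"
  by (auto simp: bdd_below_def intro: exI[of _ 0])

lemma approx_number_le: "F \<in> rank_le n \<Longrightarrow> approx_number T n \<le> norm (T - F)"
  unfolding approx_number_def by (rule cINF_lower[OF bdd_below_approx])

lemma approx_number_greatest:
  assumes "\<And>F. F \<in> rank_le n \<Longrightarrow> c \<le> norm (T - F)" shows "c \<le> approx_number T n"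
  unfolding approx_number_def using assms zero_rank_le by (intro cINF_greatest) blast+

lemma approx_number_approx:
  assumes "0 < e" obtains F where "F \<in> rank_le n" "norm (T - F) < approx_number T n + e"
proof -
  have "(INF F\<in>rank_le n. norm (T - F)) < approx_number T n + e"
    using assms by (simp add: approx_number_def)
  moreover have "rank_le n \<noteq> ({} :: ('a \<Rightarrow>\<^sub>L 'a) set)" using zero_rank_le by blast
  ultimately show ?thesis using cINF_less_iff[OF _ bdd_below_approx] that by metis
qed

lemma approx_number_nonneg: "0 \<le> approx_number T n"
  by (rule approx_number_greatest) simp

lemma approx_number_le_norm: "approx_number T n \<le> norm T"
  using approx_number_le[OF zero_rank_le, of T] by simp

lemma approx_number_0: "approx_number T 0 = norm T"
  by (simp add: approx_number_def rank_le_def)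

lemma approx_number_antimono: "m \<le> n \<Longrightarrow> approx_number T n \<le> approx_number T m"
  by (rule approx_number_greatest, rule approx_number_le, rule rank_le_mono)

text \<open>A rank \<open>m\<close> approximation of \<open>S\<close> plus a rank \<open>n\<close> approximation of \<open>T\<close> has rank at most \<open>m + n\<close>.\<close>

lemma approx_number_add: "approx_number (S + T) (m + n) \<le> approx_number S m + approx_number T n"
proof (rule field_le_epsilon)
  fix e :: real assume "0 < e"
  then have e: "0 < e/2" by simp
  obtain F where F: "F \<in> rank_le m" "norm (S - F) < approx_number S m + e/2"
    by (rule approx_number_approx[OF e])
  obtain G where G: "G \<in> rank_le n" "norm (T - G) < approx_number T n + e/2"
    by (rule approx_number_approx[OF e])
  have "approx_number (S + T) (m + n) \<le> norm (S + T - (F + G))"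
    by (rule approx_number_le[OF rank_le_add[OF F(1) G(1)]])
  also have "\<dots> = norm ((S - F) + (T - G))" by (simp add: algebra_simps)
  also have "\<dots> \<le> norm (S - F) + norm (T - G)" by (rule norm_triangle_ineq)
  finally show "approx_number (S + T) (m + n) \<le> approx_number S m + approx_number T n + e"
    using F G by simp
qed

lemma approx_number_add_norm: "approx_number (S + T) n \<le> approx_number S n + norm T"
  using approx_number_add[of S T n 0] by (simp add: approx_number_0)

text \<open>Applying the inequality with \<open>c\<close> to \<open>v\<close> and with \<open>inverse c\<close> to \<open>c v\<close> turns it into an
  equality.\<close>

lemma homogeneous_if_le:
  fixes p :: "'v::real_vector \<Rightarrow> real"
  assumes le: "\<And>c v. v \<in> V \<Longrightarrow> c \<noteq> 0 \<Longrightarrow> p (c *\<^sub>R v) \<le> q c * p v"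
    and scale: "\<And>c v. v \<in> V \<Longrightarrow> c *\<^sub>R v \<in> V"
    and q: "\<And>c. c \<noteq> 0 \<Longrightarrow> 0 < q c" "\<And>c. q (inverse c) = inverse (q c)" and v: "v \<in> V"
    and zero: "c = 0 \<Longrightarrow> p 0 = q 0 * p v"
  shows "p (c *\<^sub>R v) = q c * p v"
proof (cases "c = 0")
  case False
  have "p (inverse c *\<^sub>R c *\<^sub>R v) \<le> q (inverse c) * p (c *\<^sub>R v)"
    using False by (intro le scale v) simp
  then have "p v \<le> p (c *\<^sub>R v) / q c" using False by (simp add: q(2) divide_inverse mult.commute)
  then have "q c * p v \<le> p (c *\<^sub>R v)" using q(1)[OF False] by (simp add: pos_le_divide_eq mult.commute)
  then show ?thesis using le[OF v False] by simp
qed (simp add: zero)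

lemma approx_number_scaleR: "approx_number (c *\<^sub>R T) n = \<bar>c\<bar> * approx_number T n"
proof (rule homogeneous_if_le[where p = "\<lambda>T. approx_number T n" and q = abs and V = UNIV])
  fix c :: real and T :: "'a \<Rightarrow>\<^sub>L 'a" assume c: "c \<noteq> 0"
  have "approx_number (c *\<^sub>R T) n / \<bar>c\<bar> \<le> approx_number T n"
  proof (rule approx_number_greatest)
    fix F :: "'a \<Rightarrow>\<^sub>L 'a" assume "F \<in> rank_le n"
    then have "approx_number (c *\<^sub>R T) n \<le> norm (c *\<^sub>R T - c *\<^sub>R F)"
      by (intro approx_number_le rank_le_scaleR)
    also have "\<dots> = \<bar>c\<bar> * norm (T - F)" by (simp flip: scaleR_diff_right)
    finally show "approx_number (c *\<^sub>R T) n / \<bar>c\<bar> \<le> norm (T - F)" using c by (simp add: field_simps)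
  qed
  then show "approx_number (c *\<^sub>R T) n \<le> \<bar>c\<bar> * approx_number T n" using c by (simp add: field_simps)
next
  show "approx_number (0 :: 'a \<Rightarrow>\<^sub>L 'a) n = \<bar>0\<bar> * approx_number T n"
    using approx_number_le_norm[of "0 :: 'a \<Rightarrow>\<^sub>L 'a" n] approx_number_nonneg[of "0 :: 'a \<Rightarrow>\<^sub>L 'a" n]
    by (simp add: antisym)
qed auto

lemma approx_number_minus: "approx_number (- T) n = approx_number T n"
  using approx_number_scaleR[of "-1" T n] by simp

lemma approx_number_adj_le: "approx_number (adj T) n \<le> approx_number T n"
  for T :: "'a::{real_inner, complete_space} \<Rightarrow>\<^sub>L 'a"
proof (rule approx_number_greatest)
  fix F :: "'a \<Rightarrow>\<^sub>L 'a" assume "F \<in> rank_le n"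
  then have "approx_number (adj T) n \<le> norm (adj T - adj F)"
    by (intro approx_number_le rank_le_adj)
  also have "\<dots> \<le> norm (T - F)" using norm_adj_le[of "T - F"] by (simp add: adj_minus)
  finally show "approx_number (adj T) n \<le> norm (T - F)" .
qed

lemma approx_number_pushforward:
  fixes L :: "'a::{real_inner, complete_space} \<Rightarrow>\<^sub>L 'b::real_inner"
  shows "approx_number (L o\<^sub>L T o\<^sub>L adj L) n \<le> (norm L)\<^sup>2 * approx_number T n"
proof (rule field_le_epsilon)
  fix e :: real assume "0 < e"
  then have e: "0 < e / ((norm L)\<^sup>2 + 1)" by (simp add: add_nonneg_pos)
  obtain F where F: "F \<in> rank_le n" "norm (T - F) < approx_number T n + e / ((norm L)\<^sup>2 + 1)"
    by (rule approx_number_approx[OF e])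
  have "approx_number (L o\<^sub>L T o\<^sub>L adj L) n \<le> norm ((L o\<^sub>L T o\<^sub>L adj L) - (L o\<^sub>L F o\<^sub>L adj L))"
    by (rule approx_number_le[OF rank_le_pushforward[OF F(1)]])
  also have "\<dots> = norm (L o\<^sub>L (T - F) o\<^sub>L adj L)"
    by (simp add: blinfun_compose.diff_left blinfun_compose.diff_right)
  also have "\<dots> \<le> norm L * norm (T - F) * norm (adj L)"
    by (rule order_trans[OF norm_blinfun_compose]) (intro mult_right_mono norm_blinfun_compose norm_ge_zero)
  also have "\<dots> \<le> norm L * norm (T - F) * norm L" by (intro mult_left_mono norm_adj_le) simp
  also have "\<dots> = (norm L)\<^sup>2 * norm (T - F)" by (simp add: power2_eq_square)
  also have "\<dots> \<le> (norm L)\<^sup>2 * (approx_number T n + e / ((norm L)\<^sup>2 + 1))"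
    using F(2) by (intro mult_left_mono) auto
  also have "\<dots> = (norm L)\<^sup>2 * approx_number T n + (norm L)\<^sup>2 / ((norm L)\<^sup>2 + 1) * e"
    by (simp add: algebra_simps)
  also have "(norm L)\<^sup>2 / ((norm L)\<^sup>2 + 1) * e \<le> 1 * e"
    using \<open>0 < e\<close> by (intro mult_right_mono) (auto simp: divide_le_eq add_nonneg_pos)
  finally show "approx_number (L o\<^sub>L T o\<^sub>L adj L) n \<le> (norm L)\<^sup>2 * approx_number T n + e" by simp
qed

lemma approx_number_rank_le: "F \<in> rank_le m \<Longrightarrow> m \<le> n \<Longrightarrow> approx_number F n = 0"
  using approx_number_le[OF rank_le_mono, of F m n F] approx_number_nonneg[of F n] by simp

section \<open>Compact operators\<close>

lemma compact_operator_iff_covered: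
  "compact_operator T \<longleftrightarrow> (\<exists>K. compact K \<and> blinfun_apply T ` cball 0 1 \<subseteq> K)"
proof
  assume "compact_operator T"
  then show "\<exists>K. compact K \<and> blinfun_apply T ` cball 0 1 \<subseteq> K"
    unfolding compact_operator_def
    by (intro exI[of _ "closure (blinfun_apply T ` cball 0 1)"]) (simp add: closure_subset)
next
  assume "\<exists>K. compact K \<and> blinfun_apply T ` cball 0 1 \<subseteq> K"
  then obtain K where K: "compact K" "blinfun_apply T ` cball 0 1 \<subseteq> K" by blast
  then have "closure (blinfun_apply T ` cball 0 1) \<subseteq> K"
    by (intro closure_minimal compact_imp_closed)
  then have "K \<inter> closure (blinfun_apply T ` cball 0 1) = closure (blinfun_apply T ` cball 0 1)"
    by (rule Int_absorb1)
  then show "compact_operator T"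
    unfolding compact_operator_def using compact_Int_closed[OF K(1) closed_closure] by metis
qed

text \<open>The unit ball is mapped into a sum of \<open>n\<close> compact segments.\<close>

lemma compact_operator_rank_le: "F \<in> rank_le n \<Longrightarrow> compact_operator F"
proof -
  assume "F \<in> rank_le n"
  then obtain u v where F: "F = (\<Sum>i<n. tensor_op (u i) (v i))" by (auto simp: rank_le_def)
  have "\<exists>K. compact K \<and> blinfun_apply (\<Sum>i<n. tensor_op (u i) (v i)) ` cball 0 1 \<subseteq> K"
  proof (induction n)
    case 0
    then show ?case by (intro exI[of _ "{0}"]) auto
  next
    case (Suc n)
    then obtain K where K: "compact K" "blinfun_apply (\<Sum>i<n. tensor_op (u i) (v i)) ` cball 0 1 \<subseteq> K" by blast
    define K' where "K' = (\<lambda>c. c *\<^sub>R u n) ` {- norm (v n)..norm (v n)}"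
    have K': "compact K'" unfolding K'_def
      by (intro compact_continuous_image continuous_intros) simp
    have "blinfun_apply (\<Sum>i<Suc n. tensor_op (u i) (v i)) w \<in> {x + y |x y. x \<in> K \<and> y \<in> K'}"
      if w: "w \<in> cball 0 1" for w
    proof -
      have "\<bar>w \<bullet> v n\<bar> \<le> norm w * norm (v n)" by (rule Cauchy_Schwarz_ineq2)
      also have "\<dots> \<le> 1 * norm (v n)" using w by (intro mult_right_mono) auto
      finally have "(w \<bullet> v n) *\<^sub>R u n \<in> K'" unfolding K'_def by (intro imageI) auto
      moreover have "blinfun_apply (\<Sum>i<n. tensor_op (u i) (v i)) w \<in> K" using K(2) w by blast
      ultimately show ?thesis by (auto simp: blinfun.add_left)
    qed
    then show ?case using compact_sums[OF K(1) K'] by blast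
  qed
  then show ?thesis by (simp add: F compact_operator_iff_covered)
qed

text \<open>A finite net for the image of the unit ball under a nearby compact operator is a net, with a
  slightly larger radius, for the image under \<open>T\<close>.\<close>

lemma compact_operator_limit:
  fixes T :: "'a::real_normed_vector \<Rightarrow>\<^sub>L 'b::{real_normed_vector, complete_space}"
  assumes "\<And>e. 0 < e \<Longrightarrow> \<exists>F. compact_operator F \<and> norm (T - F) < e"
  shows "compact_operator T"
  unfolding compact_operator_def compact_eq_totally_bounded
proof (intro conjI allI impI)
  show "complete (closure (blinfun_apply T ` cball 0 1))"
    by (simp add: complete_eq_closed)
  fix e :: real assume e: "0 < e"
  then obtain F where F: "compact_operator F" "norm (T - F) < e/3" using assms[of "e/3"] by auto
  obtain k where k: "finite k" "closure (blinfun_apply F ` cball 0 1) \<subseteq> (\<Union>x\<in>k. ball x (e/3))"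
    using F(1) e unfolding compact_operator_def compact_eq_totally_bounded
    by (meson divide_pos_pos zero_less_numeral)
  have sub: "blinfun_apply T ` cball 0 1 \<subseteq> (\<Union>x\<in>k. cball x (2*e/3))"
  proof clarify
    fix w :: 'a assume w: "w \<in> cball 0 1"
    then have "F w \<in> (\<Union>x\<in>k. ball x (e/3))"
      using k(2) closure_subset[of "blinfun_apply F ` cball 0 1"] by blast
    then obtain x where x: "x \<in> k" "dist x (F w) < e/3" by auto
    have "dist (F w) (T w) = norm ((T - F) w)" by (simp add: dist_norm norm_minus_commute blinfun.diff_left)
    also have "\<dots> \<le> norm (T - F) * norm w" by (rule norm_blinfun)
    also have "\<dots> \<le> norm (T - F) * 1" using w by (intro mult_left_mono) auto
    finally have "dist x (T w) \<le> 2*e/3" using x F(2) dist_triangle[of x "T w" "F w"] by linarith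
    then show "T w \<in> (\<Union>x\<in>k. cball x (2*e/3))" using x by auto
  qed
  have "closure (blinfun_apply T ` cball 0 1) \<subseteq> (\<Union>x\<in>k. cball x (2*e/3))"
    by (rule closure_minimal[OF sub]) (intro closed_UN ballI closed_cball k(1))
  also have "\<dots> \<subseteq> (\<Union>x\<in>k. ball x e)" using e by fastforce
  finally show "\<exists>k. finite k \<and> closure (blinfun_apply T ` cball 0 1) \<subseteq> (\<Union>x\<in>k. ball x e)"
    using k by blast
qed

lemma compact_operator_if_approx_numbers_tendsto_0:
  fixes T :: "'a::{real_inner, complete_space} \<Rightarrow>\<^sub>L 'a"
  assumes "approx_number T \<longlonglongrightarrow> 0"
  shows "compact_operator T"
proof (rule compact_operator_limit)
  fix e :: real assume e: "0 < e"
  then have "\<forall>\<^sub>F n in sequentially. approx_number T n < e/2"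
    by (intro order_tendstoD(2)[OF assms]) simp
  then obtain n where n: "approx_number T n < e/2" by (auto simp: eventually_sequentially)
  have "0 < e/2" using e by simp
  then obtain F where "F \<in> rank_le n" "norm (T - F) < approx_number T n + e/2"
    by (rule approx_number_approx)
  then show "\<exists>F. compact_operator F \<and> norm (T - F) < e"
    using n by (intro exI[of _ F]) (auto intro: compact_operator_rank_le)
qed

lemma compact_operator_compose:
  assumes "compact_operator T"
  shows "compact_operator (T o\<^sub>L S)"
proof -
  obtain K where K: "compact K" "blinfun_apply T ` cball 0 1 \<subseteq> K"
    using assms by (auto simp: compact_operator_iff_covered)
  define c where "c = norm S + 1"
  have c: "c > 0" by (simp add: c_def add_nonneg_pos)
  have "T (S w) \<in> (\<lambda>x. c *\<^sub>R x) ` K" if w: "norm w \<le> 1" for w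
  proof -
    have "norm (S w) \<le> norm S * norm w" by (rule norm_blinfun)
    also have "\<dots> \<le> c * 1" using w c by (intro mult_mono) (auto simp: c_def)
    finally have "norm (inverse c *\<^sub>R S w) \<le> 1" using c by (simp add: field_simps)
    then have "T (inverse c *\<^sub>R S w) \<in> K" using K(2) by auto
    moreover have "T (S w) = c *\<^sub>R T (inverse c *\<^sub>R S w)" using c by (simp add: blinfun.scaleR_right)
    ultimately show ?thesis by blast
  qed
  moreover have "compact ((\<lambda>x. c *\<^sub>R x) ` K)" by (rule compact_scaling[OF K(1)])
  ultimately show ?thesis unfolding compact_operator_iff_covered
    by (intro exI[of _ "(\<lambda>x. c *\<^sub>R x) ` K"]) auto
qed

lemma compact_operator_subsequence:
  assumes "compact_operator T" "\<And>n::nat. norm (x n) \<le> 1"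
  obtains r y where "strict_mono r" "(\<lambda>n. T (x (r n))) \<longlonglongrightarrow> y"
proof -
  have "seq_compact (closure (blinfun_apply T ` cball 0 1))"
    using assms by (simp add: compact_operator_def compact_imp_seq_compact)
  moreover have "\<forall>n. T (x n) \<in> closure (blinfun_apply T ` cball 0 1)"
    using assms(2) closure_subset by fastforce
  ultimately obtain l r where "strict_mono (r::nat\<Rightarrow>nat)" "((\<lambda>n. T (x n)) \<circ> r) \<longlonglongrightarrow> l"
    by (rule seq_compactE) 
  then show ?thesis using that by (simp add: o_def)
qed

section \<open>Schmidt decomposition of a compact operator\<close>

lemma norm_blinfun_approx:
  fixes T :: "'a::real_normed_vector \<Rightarrow>\<^sub>L 'b::real_normed_vector"
  assumes "T \<noteq> 0" "c < norm T"
  obtains x where "norm x = 1" "c < norm (T x)"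
proof (rule ccontr)
  assume "\<not> thesis"
  then have le: "\<And>x. norm x = 1 \<Longrightarrow> norm (T x) \<le> c" using that not_less by blast
  obtain y where "T y \<noteq> 0" using assms(1) by (metis blinfun_eqI zero_blinfun.rep_eq)
  then have "y \<noteq> 0" by auto
  then have "norm (T (inverse (norm y) *\<^sub>R y)) \<le> c" by (intro le) simp
  then have c: "0 \<le> c" by (meson norm_ge_zero order_trans)
  have "norm T \<le> c"
  proof (rule norm_blinfun_bound[OF c])
    fix x
    show "norm (T x) \<le> c * norm x"
    proof (cases "x = 0")
      case False
      then have "norm (T (inverse (norm x) *\<^sub>R x)) \<le> c" by (intro le) simp
      then show ?thesis using False by (simp add: blinfun.scaleR_right field_simps)
    qed simp
  qed
  then show False using assms(2) by simp
qed

lemma norm_diff_scaleR_squared: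
  "(norm (a - c *\<^sub>R b))\<^sup>2 = (norm a)\<^sup>2 + c * c * (norm b)\<^sup>2 - 2 * c * (a \<bullet> b)"
  by (simp add: power2_norm_eq_inner inner_diff_left inner_diff_right inner_commute algebra_simps)

text \<open>If \<open>\<parallel>x\<^sub>n\<parallel> = 1\<close> and \<open>\<parallel>T x\<^sub>n\<parallel> \<rightarrow> \<sigma> = \<parallel>T\<parallel>\<close>, then \<open>T\<^sup>*T x\<^sub>n - \<sigma>\<^sup>2 x\<^sub>n \<rightarrow> 0\<close>, and by compactness
  \<open>T\<^sup>*T x\<^sub>n\<close> converges along a subsequence; so \<open>x\<^sub>n\<close> does, and the limit is an eigenvector.\<close>

lemma compact_norm_attained:
  fixes T :: "'a::{real_inner, complete_space} \<Rightarrow>\<^sub>L 'a"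
  assumes T: "compact_operator T" and nz: "T \<noteq> 0"
  shows "\<exists>e. norm e = 1 \<and> (\<forall>x. T e \<bullet> T x = (norm T)\<^sup>2 * (e \<bullet> x))"
proof -
  define s where "s = norm T"
  have s: "s > 0" using nz by (simp add: s_def)
  have "\<exists>x. norm x = 1 \<and> s - 1 / real (Suc n) < norm (T x)" for n
    using norm_blinfun_approx[OF nz, of "s - 1 / real (Suc n)"] by (auto simp: s_def)
  then obtain x where x1: "\<And>n. norm (x n) = 1" and xs: "\<And>n. s - 1 / real (Suc n) < norm (T (x n))" by metis
  have xle: "norm (T (x n)) \<le> s" for n using norm_blinfun[of T "x n"] by (simp add: x1 s_def)
  have lim: "(\<lambda>n. norm (T (x n))) \<longlonglongrightarrow> s"
  proof (rule tendsto_sandwich[of "\<lambda>n. s - 1 / real (Suc n)" _ _ "\<lambda>n. s"])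
    show "(\<lambda>n. s - 1 / real (Suc n)) \<longlonglongrightarrow> s"
      using tendsto_diff[OF tendsto_const LIMSEQ_inverse_real_of_nat, of s]
      by (simp add: inverse_eq_divide)
  qed (use xle xs in \<open>auto intro!: always_eventually less_imp_le\<close>)
  obtain r y where r: "strict_mono (r :: nat \<Rightarrow> nat)" and y: "(\<lambda>n. T (x (r n))) \<longlonglongrightarrow> y"
    by (rule compact_operator_subsequence[OF T, of x]) (use x1 in auto)
  have limr: "(\<lambda>n. norm (T (x (r n)))) \<longlonglongrightarrow> s"
    using LIMSEQ_subseq_LIMSEQ[OF lim r] by (simp add: o_def)
  define z where "z n = adj T (T (x (r n)))" for n
  have z: "z \<longlonglongrightarrow> adj T y" unfolding z_def[abs_def] by (intro blinfun.tendsto tendsto_const y)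
  have zn: "norm (z n) \<le> s\<^sup>2" for n
  proof -
    have "norm (z n) \<le> norm (adj T) * norm (T (x (r n)))" unfolding z_def by (rule norm_blinfun)
    also have "\<dots> \<le> s * s" using norm_adj_le[of T] xle s by (intro mult_mono) (auto simp: s_def)
    finally show ?thesis by (simp add: power2_eq_square)
  qed
  have "(\<lambda>n. norm (z n - s\<^sup>2 *\<^sub>R x (r n))) \<longlonglongrightarrow> 0"
  proof -
    have bound: "(norm (z n - s\<^sup>2 *\<^sub>R x (r n)))\<^sup>2 \<le> 2 * s^4 - 2 * s\<^sup>2 * (norm (T (x (r n))))\<^sup>2" for n
    proof -
      have "(norm (z n - s\<^sup>2 *\<^sub>R x (r n)))\<^sup>2
          = (norm (z n))\<^sup>2 + s^4 - 2 * s\<^sup>2 * (z n \<bullet> x (r n))"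
        unfolding norm_diff_scaleR_squared x1
        by (simp add: power4_eq_xxxx power2_eq_square[of s] mult.assoc)
      also have "z n \<bullet> x (r n) = (norm (T (x (r n))))\<^sup>2"
        by (simp add: z_def adj_inner' power2_norm_eq_inner)
      also have "(norm (z n))\<^sup>2 \<le> (s\<^sup>2)\<^sup>2" using zn by (intro power_mono) auto
      finally show ?thesis by simp
    qed
    have "(\<lambda>n. 2 * s^4 - 2 * s\<^sup>2 * (norm (T (x (r n))))\<^sup>2) \<longlonglongrightarrow> 2 * s^4 - 2 * s\<^sup>2 * s\<^sup>2"
      by (intro tendsto_intros limr)
    then have "(\<lambda>n. 2 * s^4 - 2 * s\<^sup>2 * (norm (T (x (r n))))\<^sup>2) \<longlonglongrightarrow> 0"
      by (simp add: power4_eq_xxxx power2_eq_square)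
    then have "(\<lambda>n. (norm (z n - s\<^sup>2 *\<^sub>R x (r n)))\<^sup>2) \<longlonglongrightarrow> 0"
      by (rule Lim_null_comparison[rotated]) (use bound in simp)
    then have "(\<lambda>n. sqrt ((norm (z n - s\<^sup>2 *\<^sub>R x (r n)))\<^sup>2)) \<longlonglongrightarrow> sqrt 0" by (intro tendsto_intros)
    then show ?thesis by simp
  qed
  then have "(\<lambda>n. z n - s\<^sup>2 *\<^sub>R x (r n)) \<longlonglongrightarrow> 0" by (rule tendsto_norm_zero_cancel)
  from tendsto_diff[OF z this] have "(\<lambda>n. s\<^sup>2 *\<^sub>R x (r n)) \<longlonglongrightarrow> adj T y" by simp
  from tendsto_scaleR[OF tendsto_const this, of "inverse (s\<^sup>2)"]
  have e: "(\<lambda>n. x (r n)) \<longlonglongrightarrow> inverse (s\<^sup>2) *\<^sub>R adj T y" (is "_ \<longlonglongrightarrow> ?e") using s by simp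
  have "(\<lambda>n. T (x (r n))) \<longlonglongrightarrow> T ?e" by (intro blinfun.tendsto tendsto_const e)
  then have Te: "T ?e = y" using y LIMSEQ_unique by blast
  have "(\<lambda>n. norm (x (r n))) \<longlonglongrightarrow> norm ?e" by (intro tendsto_intros e)
  then have "norm ?e = 1" by (simp add: x1 LIMSEQ_const_iff)
  moreover have "T ?e \<bullet> T w = (norm T)\<^sup>2 * (?e \<bullet> w)" for w
    unfolding Te using s by (simp add: adj_inner' s_def)
  ultimately show ?thesis by blast
qed

text \<open>For \<open>T = 0\<close> the choice of \<open>0\<close> lets the construction below continue harmlessly once the rank of
  the operator is exhausted.\<close>

definition top_vector :: "('a::real_inner \<Rightarrow>\<^sub>L 'a) \<Rightarrow> 'a" where
  "top_vector T = (if T = 0 then 0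
     else SOME e. norm e = 1 \<and> (\<forall>x. T e \<bullet> T x = (norm T)\<^sup>2 * (e \<bullet> x)))"

text \<open>\<open>deflation T n\<close> is \<open>T\<close> composed with the projection onto the orthogonal complement of the first
  \<open>n\<close> right singular vectors.\<close>

primrec deflation :: "('a::real_inner \<Rightarrow>\<^sub>L 'a) \<Rightarrow> nat \<Rightarrow> 'a \<Rightarrow>\<^sub>L 'a" where
  "deflation T 0 = T"
| "deflation T (Suc n) =
     deflation T n - tensor_op (deflation T n (top_vector (deflation T n))) (top_vector (deflation T n))"

lemma top_vector_norm:
  fixes T :: "'a::{real_inner, complete_space} \<Rightarrow>\<^sub>L 'a"
  assumes "compact_operator T" "T \<noteq> 0" shows "norm (top_vector T) = 1"
  using someI_ex[OF compact_norm_attained[OF assms]] assms(2) by (simp add: top_vector_def)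

lemma top_vector_eigen:
  fixes T :: "'a::{real_inner, complete_space} \<Rightarrow>\<^sub>L 'a"
  assumes "compact_operator T"
  shows "T (top_vector T) \<bullet> T x = (norm T)\<^sup>2 * (top_vector T \<bullet> x)"
  using someI_ex[OF compact_norm_attained[OF assms]] by (auto simp: top_vector_def)

lemma top_vector_0 [simp]: "top_vector 0 = 0"
  by (simp add: top_vector_def)

locale compact_op =
  fixes T :: "'a::{real_inner, complete_space} \<Rightarrow>\<^sub>L 'a"
  assumes compact: "compact_operator T"
begin

abbreviation "D \<equiv> deflation T"
abbreviation "e n \<equiv> top_vector (D n)"
abbreviation "s n \<equiv> norm (D n)"

lemma deflation_compose: "D (Suc n) = D n o\<^sub>L (id_blinfun - tensor_op (e n) (e n))"
  by (rule blinfun_eqI) (simp add: blinfun.diff_left blinfun.diff_right blinfun.scaleR_right)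

lemma deflation_compact: "compact_operator (D n)"
  by (induction n) (auto simp: compact deflation_compose simp del: deflation.simps(2) intro: compact_operator_compose)

lemma e_norm: "s n \<noteq> 0 \<Longrightarrow> e n \<bullet> e n = 1"
  using top_vector_norm[OF deflation_compact] by (simp add: norm_eq_1)

lemma e_zero: "s n = 0 \<Longrightarrow> e n = 0" by simp

lemma e_inner_cases: "e n \<bullet> e n = 0 \<or> e n \<bullet> e n = 1"
  using e_norm[of n] e_zero[of n] by fastforce

lemma D_eigen: "D n (e n) \<bullet> D n x = (s n)\<^sup>2 * (e n \<bullet> x)"
  by (rule top_vector_eigen[OF deflation_compact])

text \<open>The eigenvector equation at stage \<open>n\<close>, tested against an earlier vector \<open>e j\<close>, gives
  \<open>s\<^sub>n\<^sup>2 (e n \<bullet> e j) = D n (e n) \<bullet> D n (e j) = 0\<close>; so the vectors are orthogonal and later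
  deflations keep vanishing on \<open>e j\<close>.\<close>

lemma D_vanishes: "j < n \<Longrightarrow> D n (e j) = 0"
proof (induction n)
  case (Suc n)
  show ?case
  proof (cases "j = n")
    case True
    have "D n (e n) = (e n \<bullet> e n) *\<^sub>R D n (e n)" using e_inner_cases[of n] by (auto simp: inner_eq_zero_iff)
    then show ?thesis using True by (simp add: blinfun.diff_left)
  next
    case False
    then have 0: "D n (e j) = 0" using Suc by simp
    have "(s n)\<^sup>2 * (e n \<bullet> e j) = 0" using D_eigen[of n "e j"] by (simp add: 0)
    then have "e n \<bullet> e j = 0" by (auto simp: e_zero)
    then show ?thesis by (simp add: 0 blinfun.diff_left inner_commute)
  qed
qed simp

lemma e_orthogonal: "j \<noteq> n \<Longrightarrow> e j \<bullet> e n = 0"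
proof -
  have *: "e j \<bullet> e n = 0" if "j < n" for j n
  proof -
    have "(s n)\<^sup>2 * (e n \<bullet> e j) = 0" using D_eigen[of n "e j"] by (simp add: D_vanishes[OF that])
    then show ?thesis by (auto simp: e_zero inner_commute)
  qed
  show "j \<noteq> n \<Longrightarrow> e j \<bullet> e n = 0" using *[of j n] *[of n j] by (metis inner_commute linorder_neqE_nat)
qed

lemma D_eq: "D n = T - (\<Sum>k<n. tensor_op (D k (e k)) (e k))"
  by (induction n) auto

lemma D_e: "D n (e n) = T (e n)"
  by (subst D_eq) (simp add: blinfun.diff_left blinfun.sum_left e_orthogonal)

lemma T_expand: "T x = D n x + (\<Sum>k<n. (x \<bullet> e k) *\<^sub>R T (e k))"
  using arg_cong[OF D_eq[of n], of "\<lambda>S. S x"] by (simp add: blinfun.diff_left blinfun.sum_left D_e)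

text \<open>\<open>T\<close> and \<open>D n\<close> differ by the terms \<open>T (e k)\<close> with \<open>k < n\<close>, which are orthogonal to \<open>T (e n)\<close> by
  induction.\<close>

lemma T_eigen: "T (e n) \<bullet> T x = (s n)\<^sup>2 * (e n \<bullet> x)"
proof (induction n arbitrary: x rule: less_induct)
  case (less n)
  have "T (e n) \<bullet> T (e k) = 0" if "k < n" for k
    using less[OF that, of "e n"] that by (simp add: e_orthogonal inner_commute)
  moreover have "T (e n) \<bullet> T x = T (e n) \<bullet> (D n x + (\<Sum>k<n. (x \<bullet> e k) *\<^sub>R T (e k)))"
    by (rule arg_cong[OF T_expand])
  ultimately have "T (e n) \<bullet> T x = D n (e n) \<bullet> D n x"
    by (simp add: D_e inner_add_right inner_sum_right)
  then show ?case by (simp add: D_eigen)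
qed

lemma norm_T_e: "norm (T (e n)) = s n"
proof (cases "s n = 0")
  case False
  have "(norm (T (e n)))\<^sup>2 = (s n)\<^sup>2" using T_eigen[of n "e n"] e_norm[OF False] by (simp add: power2_norm_eq_inner)
  then show ?thesis by simp
qed simp

lemma bessel_single: "norm (x - (x \<bullet> e n) *\<^sub>R e n) \<le> norm x"
proof -
  have "(norm (x - (x \<bullet> e n) *\<^sub>R e n))\<^sup>2
      = (norm x)\<^sup>2 - (x \<bullet> e n)\<^sup>2 * (2 - e n \<bullet> e n)"
    unfolding norm_diff_scaleR_squared power2_norm_eq_inner[of "e n"]
    by (simp add: power2_eq_square algebra_simps)
  also have "\<dots> \<le> (norm x)\<^sup>2" using e_inner_cases[of n] by fastforce
  finally show ?thesis by (rule power2_le_imp_le) simp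
qed

lemma s_Suc: "s (Suc n) \<le> s n"
proof (rule norm_blinfun_bound)
  fix x
  have "D (Suc n) x = D n (x - (x \<bullet> e n) *\<^sub>R e n)"
    by (simp add: blinfun.diff_left blinfun.diff_right blinfun.scaleR_right)
  also have "norm \<dots> \<le> s n * norm (x - (x \<bullet> e n) *\<^sub>R e n)" by (rule norm_blinfun)
  also have "\<dots> \<le> s n * norm x" by (intro mult_left_mono bessel_single) simp
  finally show "norm (D (Suc n) x) \<le> s n * norm x" .
qed simp

lemma s_decseq: "decseq s" by (rule decseq_SucI) (rule s_Suc)

text \<open>If \<open>s\<^sub>n \<ge> c > 0\<close> for all \<open>n\<close>, the vectors \<open>T e\<^sub>n\<close> would be pairwise at distance at least \<open>c\<close>.\<close>

lemma s_tendsto_0: "s \<longlonglongrightarrow> 0"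
proof -
  obtain c where c: "s \<longlonglongrightarrow> c" "\<And>n. c \<le> s n"
    using decseq_convergent[OF s_decseq, of 0] by (metis norm_ge_zero)
  have "c = 0"
  proof (rule ccontr)
    assume "c \<noteq> 0"
    moreover have "0 \<le> c" by (rule LIMSEQ_le_const[OF c(1)]) simp
    ultimately have cpos: "c > 0" by simp
    have "norm (e n) \<le> 1" for n using e_inner_cases[of n] by (auto simp: norm_eq_sqrt_inner)
    then obtain r y where r: "strict_mono (r :: nat \<Rightarrow> nat)" and y: "(\<lambda>n. T (e (r n))) \<longlonglongrightarrow> y"
      by (rule compact_operator_subsequence[OF compact])
    from y have "Cauchy (\<lambda>n. T (e (r n)))" by (rule LIMSEQ_imp_Cauchy)
    then obtain M where M: "\<forall>m\<ge>M. \<forall>n\<ge>M. norm (T (e (r m)) - T (e (r n))) < c"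
      using CauchyD[OF _ cpos] by blast
    have ne: "r M \<noteq> r (Suc M)" using strict_monoD[OF r, of M "Suc M"] by simp
    have "(norm (T (e (r M)) - T (e (r (Suc M)))))\<^sup>2 = (s (r M))\<^sup>2 + (s (r (Suc M)))\<^sup>2"
      using T_eigen[of "r M" "e (r (Suc M))"] e_orthogonal[OF ne]
      by (simp add: power2_norm_eq_inner[of "_ - _"] inner_diff_left inner_diff_right inner_commute)
        (simp add: norm_T_e flip: power2_norm_eq_inner)
    moreover have "c\<^sup>2 \<le> (s (r M))\<^sup>2" using c cpos by (intro power_mono) auto
    moreover have "(norm (T (e (r M)) - T (e (r (Suc M)))))\<^sup>2 < c\<^sup>2"
      using M by (intro power_strict_mono) auto
    ultimately show False by (smt (verit) zero_le_power2)
  qed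
  then show ?thesis using c by simp
qed

lemma finite_level: "0 < c \<Longrightarrow> finite {n. c \<le> s n}"
proof -
  assume "0 < c"
  then have "\<forall>\<^sub>F n in sequentially. s n < c" by (rule order_tendstoD(2)[OF s_tendsto_0])
  then obtain N where "\<And>n. n \<ge> N \<Longrightarrow> s n < c" by (auto simp: eventually_sequentially)
  then have "{n. c \<le> s n} \<subseteq> {..<N}" by (force simp: not_le[symmetric])
  then show ?thesis using finite_subset by blast
qed

lemma independent_e:
  assumes "\<And>n. n \<in> A \<Longrightarrow> s n \<noteq> 0"
  shows "independent (e ` A)" "inj_on e A"
proof -
  have "pairwise orthogonal (e ` A)" 
    unfolding pairwise_def orthogonal_def by (clarsimp, rule e_orthogonal) auto
  moreover have "0 \<notin> e ` A"
  proof
    assume "0 \<in> e ` A"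
    then obtain n where n: "n \<in> A" "e n = 0" by (metis imageE)
    then show False using e_norm[OF assms[OF n(1)]] by simp
  qed
  ultimately show "independent (e ` A)" by (rule pairwise_orthogonal_independent)
  show "inj_on e A"
  proof (rule inj_onI)
    fix m n assume "m \<in> A" "e m = e n"
    then show "m = n" using e_norm[OF assms, of m] e_orthogonal[of m n] by fastforce
  qed
qed

text \<open>Subtracting from an eigenvector its components along the \<open>e n\<close> with \<open>s n = \<sigma>\<close> leaves an
  eigenvector orthogonal to every \<open>e n\<close>, since eigenvectors for different eigenvalues are
  orthogonal. On such a vector \<open>T\<close> agrees with all \<open>D n\<close>, whose norms tend to \<open>0\<close>.\<close>

lemma eigenspace_eq_span:
  assumes "0 < \<sigma>"
  shows "{x. adj T (T x) = \<sigma>\<^sup>2 *\<^sub>R x} = span (e ` {n. s n = \<sigma>})"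
proof (intro equalityI subsetI)
  let ?V = "{x. adj T (T x) = \<sigma>\<^sup>2 *\<^sub>R x}"
  have sub: "subspace ?V"
    by (auto simp: subspace_def blinfun.add_right scaleR_add_right blinfun.scaleR_right)
  have e_in: "e n \<in> ?V" if "s n = \<sigma>" for n
  proof -
    have "adj T (T (e n)) = \<sigma>\<^sup>2 *\<^sub>R e n"
      by (rule vector_eq_rdot[THEN iffD1]) (simp only: adj_inner' inner_scaleR_left T_eigen that simp_thms)
    then show ?thesis by simp
  qed
  fix x
  { assume "x \<in> span (e ` {n. s n = \<sigma>})"
    moreover have "span (e ` {n. s n = \<sigma>}) \<subseteq> ?V" by (rule span_minimal[OF _ sub]) (use e_in in blast)
    ultimately show "x \<in> ?V" by (rule rev_subsetD) }
  assume x: "x \<in> ?V"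
  define A where "A = {n. s n = \<sigma>}"
  have A: "finite A" by (rule finite_subset[OF _ finite_level[OF assms]]) (auto simp: A_def)
  define p where "p = (\<Sum>n\<in>A. (x \<bullet> e n) *\<^sub>R e n)"
  have p: "p \<in> span (e ` A)" unfolding p_def by (intro span_sum span_scale span_base) auto
  have "p \<in> ?V" unfolding p_def using e_in by (intro subspace_sum[OF sub] subspace_scale[OF sub]) (auto simp: A_def)
  then have y: "x - p \<in> ?V" using subspace_diff[OF sub] x by blast
  have orth: "(x - p) \<bullet> e n = 0" for n
  proof (cases "n \<in> A")
    case True
    then have "p \<bullet> e n = (\<Sum>k\<in>A. if k = n then x \<bullet> e n else 0)"
      unfolding p_def inner_sum_left using e_norm[of n] assms
      by (intro sum.cong) (auto simp: A_def e_orthogonal)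
    then show ?thesis using A True by (simp add: inner_diff_left)
  next
    case False
    have "\<sigma>\<^sup>2 * ((x - p) \<bullet> e n) = adj T (T (x - p)) \<bullet> e n" using y by simp
    also have "\<dots> = (s n)\<^sup>2 * ((x - p) \<bullet> e n)"
      by (simp only: adj_inner' inner_commute[of "T (x - p)"] T_eigen inner_commute[of "e n"])
    finally have "(\<sigma>\<^sup>2 - (s n)\<^sup>2) * ((x - p) \<bullet> e n) = 0" by (simp add: algebra_simps)
    moreover have "\<sigma>\<^sup>2 \<noteq> (s n)\<^sup>2" using False assms by (auto simp: A_def)
    ultimately show ?thesis by simp
  qed
  have "norm (T (x - p)) \<le> s n * norm (x - p)" for n
    using T_expand[of "x - p" n] norm_blinfun[of "D n" "x - p"] by (simp add: orth)
  moreover have "(\<lambda>n. s n * norm (x - p)) \<longlonglongrightarrow> 0 * norm (x - p)"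
    by (intro tendsto_intros s_tendsto_0)
  ultimately have "norm (T (x - p)) \<le> 0 * norm (x - p)" by (intro LIMSEQ_le_const) auto
  then have "\<sigma>\<^sup>2 *\<^sub>R (x - p) = 0" using y by simp
  then have "x = p" using assms by simp
  then show "x \<in> span (e ` {n. s n = \<sigma>})" using p by (simp add: A_def)
qed

lemma singular_sequence_s: "singular_sequence T s"
  unfolding singular_sequence_def
proof (intro conjI allI impI s_decseq norm_ge_zero)
  fix \<sigma> :: real assume \<sigma>: "0 < \<sigma>"
  show "finite {n. s n = \<sigma>}" by (rule finite_subset[OF _ finite_level[OF \<sigma>]]) auto
  have ind: "independent (e ` {n. s n = \<sigma>})" "inj_on e {n. s n = \<sigma>}"
    using \<sigma> by (auto intro!: independent_e simp del: norm_eq_zero)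
  show "card {n. s n = \<sigma>} = dim {x. adj T (T x) = \<sigma>\<^sup>2 *\<^sub>R x}"
    unfolding eigenspace_eq_span[OF \<sigma>] dim_span_eq_card_independent[OF ind(1)]
    by (rule card_image[OF ind(2), symmetric])
qed

end

text \<open>Superlevel sets of a nonincreasing sequence are initial segments of the index set.\<close>

lemma decseq_ge_iff_card:
  fixes s :: "nat \<Rightarrow> real"
  assumes "decseq s" "finite {n. c \<le> s n}"
  shows "c \<le> s n \<longleftrightarrow> n < card {n. c \<le> s n}"
proof -
  have down: "c \<le> s m \<Longrightarrow> k \<le> m \<Longrightarrow> c \<le> s k" for k m using decseqD[OF assms(1)] order_trans by blast
  show ?thesis
  proof
    assume "c \<le> s n"
    then have "{..n} \<subseteq> {n. c \<le> s n}" using down by auto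
    from card_mono[OF assms(2) this] show "n < card {n. c \<le> s n}" by simp
  next
    assume *: "n < card {n. c \<le> s n}"
    show "c \<le> s n"
    proof (rule ccontr)
      assume n: "\<not> c \<le> s n"
      have "{n. c \<le> s n} \<subseteq> {..<n}"
      proof
        fix m assume "m \<in> {n. c \<le> s n}"
        then show "m \<in> {..<n}" using n down[of m n] by (auto simp: not_le[symmetric])
      qed
      from card_mono[OF _ this] show False using * by simp
    qed
  qed
qed

text \<open>A superlevel set is a finite union of level sets, so its size, and with it the sequence, is
  determined by the sizes of the positive level sets.\<close>

lemma decseq_eqI_level_sets:
  fixes s t :: "nat \<Rightarrow> real"
  assumes s: "decseq s" "\<And>n. 0 \<le> s n" and t: "decseq t" "\<And>n. 0 \<le> t n"
    and fin: "\<And>c. 0 < c \<Longrightarrow> finite {n. c \<le> s n}" "\<And>c. 0 < c \<Longrightarrow> finite {n. t n = c}"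
    and card: "\<And>c. 0 < c \<Longrightarrow> card {n. s n = c} = card {n. t n = c}"
  shows "s = t"
proof -
  have count: "finite {n. c \<le> t n} \<and> card {n. c \<le> t n} = card {n. c \<le> s n}" if c: "0 < c" for c
  proof -
    have fs: "finite {n. s n = d}" if "0 < d" for d
      by (rule finite_subset[OF _ fin(1)[OF that]]) auto
    define V where "V = s ` {n. c \<le> s n}"
    have V: "finite V" unfolding V_def using fin(1)[OF c] by simp
    have Vpos: "0 < v" if "v \<in> V" for v using that c by (auto simp: V_def)
    have S: "{n. c \<le> s n} = (\<Union>v\<in>V. {n. s n = v})" by (auto simp: V_def)
    have "t n \<in> V" if n: "c \<le> t n" for n
    proof -
      have "card {m. t m = t n} > 0" using fin(2)[of "t n"] c n by (auto simp: card_gt_0_iff)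
      then have "{m. s m = t n} \<noteq> {}" using card[of "t n"] c n by (metis card.empty less_numeral_extra(3) order_less_le_trans)
      then obtain m where "s m = t n" by blast
      then show ?thesis using n unfolding V_def by (metis imageI mem_Collect_eq)
    qed
    then have T: "{n. c \<le> t n} = (\<Union>v\<in>V. {n. t n = v})" by (auto simp: V_def)
    have "card {n. c \<le> t n} = (\<Sum>v\<in>V. card {n. t n = v})"
      unfolding T using V Vpos fin(2) by (intro card_UN_disjoint) auto
    also have "\<dots> = (\<Sum>v\<in>V. card {n. s n = v})" using card Vpos by (intro sum.cong) auto
    also have "\<dots> = card {n. c \<le> s n}"
      unfolding S using V Vpos fs by (intro card_UN_disjoint[symmetric]) auto
    finally show ?thesis unfolding T using V Vpos fin(2) by auto
  qed
  have iff: "c \<le> s n \<longleftrightarrow> c \<le> t n" if "0 < c" for c n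
    using decseq_ge_iff_card[OF s(1) fin(1)[OF that], of n]
      decseq_ge_iff_card[OF t(1) conjunct1[OF count[OF that]], of n] count[OF that] by argo
  show "s = t"
  proof
    fix n show "s n = t n"
      using iff[of "s n" n] iff[of "t n" n] s(2)[of n] t(2)[of n] by linarith
  qed
qed

context compact_op
begin

lemma singular_value_eq_s: "singular_value T = s"
  unfolding singular_value_def
proof (rule the_equality)
  show "singular_sequence T s" by (rule singular_sequence_s)
next
  fix t assume t: "singular_sequence T t"
  note s' = singular_sequence_s
  show "t = s"
    by (rule decseq_eqI_level_sets[symmetric])
      (use s' t finite_level in \<open>auto simp: singular_sequence_def\<close>)
qed

text \<open>\<open>T\<close> is bounded below by \<open>s n\<close> on the span of \<open>e 0, \<dots>, e n\<close>, a space of dimension \<open>n + 1\<close> on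
  which an operator of rank \<open>n\<close> has a kernel.\<close>

lemma approx_number_eq_s: "approx_number T n = s n"
proof (rule antisym)
  have "(\<Sum>k<n. tensor_op (D k (e k)) (e k)) \<in> rank_le n" by (rule rank_leI)
  from approx_number_le[OF this, of T] show "approx_number T n \<le> s n" by (simp flip: D_eq)
next
  show "s n \<le> approx_number T n"
  proof (cases "s n = 0")
    case True
    then show ?thesis by (metis approx_number_nonneg)
  next
    case False
    have pos: "s k \<noteq> 0" if "k \<le> n" for k using decseqD[OF s_decseq that] False by auto
    show ?thesis
    proof (rule approx_number_greatest)
      fix F :: "'a \<Rightarrow>\<^sub>L 'a" assume "F \<in> rank_le n"
      then obtain u v where F: "F = (\<Sum>i<n. tensor_op (u i) (v i))" by (rule rank_leE)
      let ?B = "e ` {..n}"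
      have ind: "independent ?B" "inj_on e {..n}" using independent_e[of "{..n}"] pos by auto
      have cB: "card ?B = Suc n" using card_image[OF ind(2)] by simp
      have Fr: "F x \<in> span (u ` {..<n})" for x
        unfolding F blinfun.sum_left tensor_op_apply
        by (intro span_sum span_scale, rule span_base) auto
      have "\<not> inj_on F (span ?B)"
      proof
        assume inj: "inj_on F (span ?B)"
        have lin: "linear F" by (simp add: blinfun.bounded_linear_right bounded_linear.linear)
        have "independent (F ` ?B)" by (rule linear_independent_injective_image[OF lin ind(1) inj])
        then have "card (F ` ?B) \<le> card (u ` {..<n})"
          using independent_span_bound[of "u ` {..<n}" "F ` ?B"] Fr by auto
        moreover have "card (F ` ?B) = Suc n"
          using cB card_image[OF inj_on_subset[OF inj span_superset]] by simp
        moreover have "card (u ` {..<n}) \<le> n" using card_image_le[of "{..<n}" u] by simp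
        ultimately show False by simp
      qed
      then obtain a b where ab: "a \<in> span ?B" "b \<in> span ?B" "F a = F b" "a \<noteq> b" by (auto simp: inj_on_def)
      define x where "x = a - b"
      have x: "x \<in> span ?B" "F x = 0" "x \<noteq> 0" using ab by (auto simp: x_def span_diff blinfun.diff_right)
      obtain c where c: "x = (\<Sum>k\<le>n. c k *\<^sub>R e k)"
      proof -
        have "x \<in> range (\<lambda>c. \<Sum>w\<in>?B. c w *\<^sub>R w)" using x(1) span_finite[of ?B] by simp
        then obtain c where "x = (\<Sum>w\<in>?B. c w *\<^sub>R w)" by blast
        then have "x = (\<Sum>k\<le>n. c (e k) *\<^sub>R e k)" by (simp add: sum.reindex[OF ind(2)])
        then show ?thesis using that[of "\<lambda>k. c (e k)"] by simp
      qed
      have xe: "x \<bullet> e k = c k" if "k \<le> n" for k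
      proof -
        have "x \<bullet> e k = (\<Sum>j\<le>n. if j = k then c k else 0)"
          unfolding c inner_sum_left using e_norm[OF pos[OF that]] by (intro sum.cong) (auto simp: e_orthogonal)
        then show ?thesis using that by simp
      qed
      have nx: "(norm x)\<^sup>2 = (\<Sum>k\<le>n. (c k)\<^sup>2)"
        unfolding power2_norm_eq_inner by (subst (2) c) (simp add: inner_sum_right xe power2_eq_square)
      have Tx: "(norm (T x))\<^sup>2 = (\<Sum>k\<le>n. (s k)\<^sup>2 * (c k)\<^sup>2)"
      proof -
        have "(norm (T x))\<^sup>2 = T x \<bullet> T (\<Sum>k\<le>n. c k *\<^sub>R e k)" by (simp add: power2_norm_eq_inner flip: c)
        also have "\<dots> = (\<Sum>k\<le>n. c k * (T (e k) \<bullet> T x))"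
          by (simp add: blinfun.sum_right blinfun.scaleR_right inner_sum_right inner_commute)
        also have "\<dots> = (\<Sum>k\<le>n. (s k)\<^sup>2 * (c k)\<^sup>2)"
          by (intro sum.cong) (auto simp: T_eigen inner_commute[of "e _"] xe power2_eq_square)
        finally show ?thesis .
      qed
      have "(s n * norm x)\<^sup>2 \<le> (norm (T x))\<^sup>2"
        unfolding power_mult_distrib nx Tx sum_distrib_left
        using decseqD[OF s_decseq] by (intro sum_mono mult_right_mono power_mono) auto
      then have "s n * norm x \<le> norm (T x)" by (rule power2_le_imp_le) simp
      also have "\<dots> = norm ((T - F) x)" by (simp add: x(2) blinfun.diff_left)
      also have "\<dots> \<le> norm (T - F) * norm x" by (rule norm_blinfun)
      finally show "s n \<le> norm (T - F)" using x(3) by simp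
    qed
  qed
qed

end

proposition singular_value_eq_approx_number:
  fixes T :: "'a::{real_inner, complete_space} \<Rightarrow>\<^sub>L 'a"
  assumes "compact_operator T"
  shows "singular_value T = approx_number T"
proof -
  interpret compact_op T by standard fact
  show ?thesis using singular_value_eq_s approx_number_eq_s by auto
qed

proposition compact_operator_iff_approx_numbers_tendsto_0:
  fixes T :: "'a::{real_inner, complete_space} \<Rightarrow>\<^sub>L 'a"
  shows "compact_operator T \<longleftrightarrow> approx_number T \<longlonglongrightarrow> 0"
proof
  assume "compact_operator T"
  then interpret compact_op T by (rule compact_op.intro)
  show "approx_number T \<longlonglongrightarrow> 0" using s_tendsto_0 approx_number_eq_s by presburger
qed (rule compact_operator_if_approx_numbers_tendsto_0)

section \<open>The two ideals in terms of approximation numbers\<close>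

lemma div_2_at_top: "filterlim (\<lambda>n::nat. n div 2) sequentially sequentially"
  unfolding filterlim_at_top eventually_sequentially
  by (metis div_le_mono nonzero_mult_div_cancel_left zero_neq_numeral)

lemma approx_number_add_half:
  "approx_number (S + T) n \<le> approx_number S (n div 2) + approx_number T (n div 2)"
proof -
  have "n div 2 + n div 2 \<le> n" by simp
  from approx_number_antimono[OF this, of "S + T"] approx_number_add[of S T "n div 2" "n div 2"]
  show ?thesis by linarith
qed

text \<open>Halving the index costs a factor \<open>2\<close> in the weight; this is the source of the constant \<open>2\<close>
  in the quasi-triangle inequality.\<close>

lemma weighted_approx_number_add:
  "real (Suc n) * approx_number (S + T) n
    \<le> 2 * (real (Suc (n div 2)) * approx_number S (n div 2) + real (Suc (n div 2)) * approx_number T (n div 2))"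
proof -
  have "real (Suc n) * approx_number (S + T) n
      \<le> (2 * real (Suc (n div 2))) * (approx_number S (n div 2) + approx_number T (n div 2))"
    by (intro mult_mono approx_number_add_half approx_number_nonneg) auto
  then show ?thesis by (simp add: algebra_simps)
qed

lemma compact_operator_add:
  fixes S T :: "'a::{real_inner, complete_space} \<Rightarrow>\<^sub>L 'a"
  assumes "compact_operator S" "compact_operator T"
  shows "compact_operator (S + T)"
  unfolding compact_operator_iff_approx_numbers_tendsto_0
proof (rule Lim_null_comparison)
  show "\<forall>\<^sub>F n in sequentially. norm (approx_number (S + T) n)
      \<le> approx_number S (n div 2) + approx_number T (n div 2)"
    using approx_number_add_half[of S T] approx_number_nonneg[of "S + T"] by simp
  have "((\<lambda>n. approx_number S n + approx_number T n) \<longlongrightarrow> 0 + 0) sequentially"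
    using assms unfolding compact_operator_iff_approx_numbers_tendsto_0 by (rule tendsto_add)
  from filterlim_compose[OF this div_2_at_top]
  show "(\<lambda>n. approx_number S (n div 2) + approx_number T (n div 2)) \<longlonglongrightarrow> 0" by simp
qed

lemma weak_ideal0_iff:
  fixes T :: "'a::{real_inner, complete_space} \<Rightarrow>\<^sub>L 'a"
  shows "T \<in> weak_ideal0 \<longleftrightarrow> (\<lambda>n. real (Suc n) * approx_number T n) \<longlonglongrightarrow> 0"
proof
  assume "T \<in> weak_ideal0"
  then show "(\<lambda>n. real (Suc n) * approx_number T n) \<longlonglongrightarrow> 0"
    using singular_value_eq_approx_number[of T] by (auto simp: weak_ideal0_def weak_ideal_def)
next
  assume lim: "(\<lambda>n. real (Suc n) * approx_number T n) \<longlonglongrightarrow> 0"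
  have "approx_number T \<longlonglongrightarrow> 0"
  proof (rule Lim_null_comparison[OF _ lim])
    have "1 * approx_number T n \<le> real (Suc n) * approx_number T n" for n
      by (intro mult_right_mono approx_number_nonneg) simp
    then show "\<forall>\<^sub>F n in sequentially. norm (approx_number T n) \<le> real (Suc n) * approx_number T n"
      using approx_number_nonneg[of T] by simp
  qed
  then have c: "compact_operator T" by (simp add: compact_operator_iff_approx_numbers_tendsto_0)
  have "bdd_above (range (\<lambda>n. real (Suc n) * approx_number T n))"
    by (intro bounded_imp_bdd_above convergent_imp_bounded[OF lim])
  then show "T \<in> weak_ideal0"
    using c lim singular_value_eq_approx_number[OF c] by (simp add: weak_ideal0_def weak_ideal_def)
qed

lemma weak_ideal0_compact: "T \<in> weak_ideal0 \<Longrightarrow> compact_operator T"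
  by (simp add: weak_ideal0_def weak_ideal_def)

lemma weak_norm_upper:
  fixes T :: "'a::{real_inner, complete_space} \<Rightarrow>\<^sub>L 'a"
  assumes "T \<in> weak_ideal0"
  shows "real (Suc n) * approx_number T n \<le> weak_norm T"
  using assms unfolding weak_norm_def singular_value_eq_approx_number[OF weak_ideal0_compact[OF assms]]
  by (intro cSUP_upper)
    (auto simp: weak_ideal0_def weak_ideal_def singular_value_eq_approx_number)

lemma weak_norm_least:
  fixes T :: "'a::{real_inner, complete_space} \<Rightarrow>\<^sub>L 'a"
  assumes "T \<in> weak_ideal0" "\<And>n. real (Suc n) * approx_number T n \<le> c"
  shows "weak_norm T \<le> c"
  using assms(2) unfolding weak_norm_def singular_value_eq_approx_number[OF weak_ideal0_compact[OF assms(1)]]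
  by (intro cSUP_least) auto

lemma norm_le_weak_norm: "T \<in> weak_ideal0 \<Longrightarrow> norm T \<le> weak_norm T"
  for T :: "'a::{real_inner, complete_space} \<Rightarrow>\<^sub>L 'a"
  using weak_norm_upper[of T 0] by (simp add: approx_number_0)

lemma weak_norm_nonneg: "T \<in> weak_ideal0 \<Longrightarrow> 0 \<le> weak_norm T"
  for T :: "'a::{real_inner, complete_space} \<Rightarrow>\<^sub>L 'a"
  using norm_le_weak_norm[of T] norm_ge_zero[of T] by linarith

lemma rank_le_weak_ideal0:
  fixes F :: "'a::{real_inner, complete_space} \<Rightarrow>\<^sub>L 'a"
  assumes "F \<in> rank_le m"
  shows "F \<in> weak_ideal0"
  unfolding weak_ideal0_iff
  by (rule tendsto_eventually)
    (use approx_number_rank_le[OF assms] in \<open>auto simp: eventually_sequentially\<close>)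

lemma rank_le_weak_norm:
  fixes F :: "'a::{real_inner, complete_space} \<Rightarrow>\<^sub>L 'a"
  assumes F: "F \<in> rank_le m"
  shows "weak_norm F \<le> real m * norm F"
proof (rule weak_norm_least[OF rank_le_weak_ideal0[OF F]])
  fix n
  show "real (Suc n) * approx_number F n \<le> real m * norm F"
    using approx_number_rank_le[OF F, of n]
    by (cases "n < m") (auto intro!: mult_mono approx_number_le_norm approx_number_nonneg)
qed

lemma weak_ideal0_0 [simp]: "(0 :: 'a::{real_inner, complete_space} \<Rightarrow>\<^sub>L 'a) \<in> weak_ideal0"
  by (rule rank_le_weak_ideal0[OF zero_rank_le[of 0]])

lemma weak_ideal0_scaleR: "T \<in> weak_ideal0 \<Longrightarrow> c *\<^sub>R T \<in> weak_ideal0"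
  for T :: "'a::{real_inner, complete_space} \<Rightarrow>\<^sub>L 'a"
  unfolding weak_ideal0_iff
  by (drule tendsto_mult_left[of _ _ _ "\<bar>c\<bar>"]) (simp add: approx_number_scaleR mult_ac)

lemma weak_ideal0_minus: "T \<in> weak_ideal0 \<Longrightarrow> - T \<in> weak_ideal0"
  for T :: "'a::{real_inner, complete_space} \<Rightarrow>\<^sub>L 'a"
  using weak_ideal0_scaleR[of T "-1"] by simp

lemma weak_ideal0_add:
  fixes S T :: "'a::{real_inner, complete_space} \<Rightarrow>\<^sub>L 'a"
  assumes "S \<in> weak_ideal0" "T \<in> weak_ideal0"
  shows "S + T \<in> weak_ideal0"
  unfolding weak_ideal0_iff
proof (rule Lim_null_comparison)
  let ?f = "\<lambda>n. 2 * (real (Suc n) * approx_number S n + real (Suc n) * approx_number T n)"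
  show "\<forall>\<^sub>F n in sequentially. norm (real (Suc n) * approx_number (S + T) n) \<le> ?f (n div 2)"
    using weighted_approx_number_add[of _ S T] approx_number_nonneg[of "S + T"] by (simp add: abs_mult)
  have "?f \<longlonglongrightarrow> 2 * (0 + 0)" using assms unfolding weak_ideal0_iff by (intro tendsto_intros)
  from filterlim_compose[OF this div_2_at_top] show "(\<lambda>n. ?f (n div 2)) \<longlonglongrightarrow> 0" by simp
qed

lemma weak_ideal0_diff:
  "S \<in> weak_ideal0 \<Longrightarrow> T \<in> weak_ideal0 \<Longrightarrow> S - T \<in> weak_ideal0"
  for S T :: "'a::{real_inner, complete_space} \<Rightarrow>\<^sub>L 'a"
  using weak_ideal0_add[OF _ weak_ideal0_minus] by fastforce

lemma weak_norm_add:
  fixes S T :: "'a::{real_inner, complete_space} \<Rightarrow>\<^sub>L 'a"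
  assumes "S \<in> weak_ideal0" "T \<in> weak_ideal0"
  shows "weak_norm (S + T) \<le> 2 * (weak_norm S + weak_norm T)"
proof (rule weak_norm_least[OF weak_ideal0_add[OF assms]])
  fix n
  show "real (Suc n) * approx_number (S + T) n \<le> 2 * (weak_norm S + weak_norm T)"
    by (rule order_trans[OF weighted_approx_number_add])
      (intro mult_left_mono add_mono weak_norm_upper assms, simp)
qed

lemma weak_norm_scaleR:
  fixes T :: "'a::{real_inner, complete_space} \<Rightarrow>\<^sub>L 'a"
  assumes "T \<in> weak_ideal0"
  shows "weak_norm (c *\<^sub>R T) = \<bar>c\<bar> * weak_norm T"
proof (rule homogeneous_if_le[where q = abs and V = weak_ideal0])
  fix c and T :: "'a \<Rightarrow>\<^sub>L 'a" assume T: "T \<in> weak_ideal0"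
  show "weak_norm (c *\<^sub>R T) \<le> \<bar>c\<bar> * weak_norm T"
  proof (rule weak_norm_least[OF weak_ideal0_scaleR[OF T]])
    fix n
    have "\<bar>c\<bar> * (real (Suc n) * approx_number T n) \<le> \<bar>c\<bar> * weak_norm T"
      by (intro mult_left_mono weak_norm_upper T) simp
    then show "real (Suc n) * approx_number (c *\<^sub>R T) n \<le> \<bar>c\<bar> * weak_norm T"
      by (simp add: approx_number_scaleR mult_ac)
  qed
next
  show "weak_norm (0 :: 'a \<Rightarrow>\<^sub>L 'a) = \<bar>0\<bar> * weak_norm T"
    using rank_le_weak_norm[of "0 :: 'a \<Rightarrow>\<^sub>L 'a" 0] weak_norm_nonneg[of "0 :: 'a \<Rightarrow>\<^sub>L 'a"] by simp
qed (auto intro: assms weak_ideal0_scaleR)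

lemma weak_norm_minus: "T \<in> weak_ideal0 \<Longrightarrow> weak_norm (- T) = weak_norm T"
  for T :: "'a::{real_inner, complete_space} \<Rightarrow>\<^sub>L 'a"
  using weak_norm_scaleR[of T "-1"] by simp

lemma weak_norm_0 [simp]: "weak_norm (0 :: 'a::{real_inner, complete_space} \<Rightarrow>\<^sub>L 'a) = 0"
  using weak_norm_scaleR[of "0 :: 'a \<Rightarrow>\<^sub>L 'a" 0] by simp

lemma weak_norm_eq_0: "T \<in> weak_ideal0 \<Longrightarrow> weak_norm T = 0 \<longleftrightarrow> T = 0"
  for T :: "'a::{real_inner, complete_space} \<Rightarrow>\<^sub>L 'a"
  using norm_le_weak_norm[of T] by auto

lemma weak_ideal0_adj:
  fixes T :: "'a::{real_inner, complete_space} \<Rightarrow>\<^sub>L 'a"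
  assumes T: "T \<in> weak_ideal0"
  shows "adj T \<in> weak_ideal0" "weak_norm (adj T) \<le> weak_norm T"
proof -
  have le: "real (Suc n) * approx_number (adj T) n \<le> real (Suc n) * approx_number T n" for n
    by (intro mult_left_mono approx_number_adj_le) simp
  show *: "adj T \<in> weak_ideal0" unfolding weak_ideal0_iff
    by (rule Lim_null_comparison[OF _ T[unfolded weak_ideal0_iff]])
      (use le approx_number_nonneg[of "adj T"] in \<open>simp add: abs_mult\<close>)
  show "weak_norm (adj T) \<le> weak_norm T"
    using le weak_norm_upper[OF T] order_trans by (intro weak_norm_least[OF *]) blast
qed

lemma weak_ideal0_pushforward:
  fixes L :: "'a::{real_inner, complete_space} \<Rightarrow>\<^sub>L 'b::{real_inner, complete_space}"
  assumes T: "T \<in> weak_ideal0"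
  shows "L o\<^sub>L T o\<^sub>L adj L \<in> weak_ideal0"
    "weak_norm (L o\<^sub>L T o\<^sub>L adj L) \<le> (norm L)\<^sup>2 * weak_norm T"
proof -
  have le: "real (Suc n) * approx_number (L o\<^sub>L T o\<^sub>L adj L) n
      \<le> (norm L)\<^sup>2 * (real (Suc n) * approx_number T n)" for n
    using mult_left_mono[OF approx_number_pushforward[of L T n], of "real (Suc n)"] by (simp add: mult_ac)
  have lim: "(\<lambda>n. (norm L)\<^sup>2 * (real (Suc n) * approx_number T n)) \<longlonglongrightarrow> (norm L)\<^sup>2 * 0"
    using T unfolding weak_ideal0_iff by (rule tendsto_mult_left)
  show *: "L o\<^sub>L T o\<^sub>L adj L \<in> weak_ideal0" unfolding weak_ideal0_iff
    by (rule Lim_null_comparison[OF _ lim[unfolded mult_zero_right]])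
      (use le approx_number_nonneg[of "L o\<^sub>L T o\<^sub>L adj L"] in \<open>simp add: abs_mult\<close>)
  show "weak_norm (L o\<^sub>L T o\<^sub>L adj L) \<le> (norm L)\<^sup>2 * weak_norm T"
  proof (rule weak_norm_least[OF *])
    fix n
    have "(norm L)\<^sup>2 * (real (Suc n) * approx_number T n) \<le> (norm L)\<^sup>2 * weak_norm T"
      by (intro mult_left_mono weak_norm_upper T) simp
    then show "real (Suc n) * approx_number (L o\<^sub>L T o\<^sub>L adj L) n \<le> (norm L)\<^sup>2 * weak_norm T"
      using le[of n] by linarith
  qed
qed

text \<open>A uniform bound \<open>e\<close> on the weighted approximation numbers of \<open>T - S\<close> bounds the limit superior of
  those of \<open>T\<close> by \<open>2 e\<close>, because those of \<open>S\<close> tend to \<open>0\<close>.\<close>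

lemma weak_ideal0_closed:
  fixes T :: "'a::{real_inner, complete_space} \<Rightarrow>\<^sub>L 'a"
  assumes "\<And>e. 0 < e \<Longrightarrow> \<exists>S\<in>weak_ideal0. \<forall>n. real (Suc n) * approx_number (T - S) n \<le> e"
  shows "T \<in> weak_ideal0"
  unfolding weak_ideal0_iff
proof (rule LIMSEQ_I)
  fix e :: real assume e: "0 < e"
  then obtain S where S: "S \<in> weak_ideal0" and le: "\<And>n. real (Suc n) * approx_number (T - S) n \<le> e/8"
    using assms[of "e/8"] by auto
  have "(\<lambda>n. real (Suc (n div 2)) * approx_number S (n div 2)) \<longlonglongrightarrow> 0"
    using filterlim_compose[OF S[unfolded weak_ideal0_iff] div_2_at_top] by simp
  from LIMSEQ_D[OF this, of "e/4"] e obtain n0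
    where n0: "\<And>n. n \<ge> n0 \<Longrightarrow> real (Suc (n div 2)) * approx_number S (n div 2) < e/4"
    by (auto simp: abs_mult approx_number_nonneg)
  have "real (Suc n) * approx_number T n < e" if "n \<ge> n0" for n
  proof -
    have "real (Suc n) * approx_number T n = real (Suc n) * approx_number ((T - S) + S) n" by simp
    also note weighted_approx_number_add[of n "T - S" S]
    also have "2 * (real (Suc (n div 2)) * approx_number (T - S) (n div 2)
        + real (Suc (n div 2)) * approx_number S (n div 2)) < e"
    proof -
      have "2 * (a + b) < e" if "a \<le> e/8" "b < e/4" for a b using that e by simp
      then show ?thesis by this (rule le, rule n0[OF that])
    qed
    finally show ?thesis .
  qed
  then show "\<exists>no. \<forall>n\<ge>no. norm (real (Suc n) * approx_number T n - 0) < e"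
    using approx_number_nonneg[of T] by (auto simp: abs_mult)
qed

text \<open>Both the weak and the trace norm are suprema of functionals \<open>\<phi> k\<close> that are Lipschitz for the
  operator norm. A Cauchy sequence for such a supremum converges in operator norm, and for each \<open>k\<close>
  the Cauchy estimate passes to that limit, uniformly in \<open>k\<close>.\<close>

lemma Cauchy_limit_functionals:
  fixes X :: "nat \<Rightarrow> 'a::{real_inner, complete_space} \<Rightarrow>\<^sub>L 'a"
  assumes Cauchy: "\<And>e. 0 < e \<Longrightarrow> \<exists>n0. \<forall>m\<ge>n0. \<forall>n\<ge>n0. p (X m - X n) < e"
    and norm_le: "\<And>m n. norm (X m - X n) \<le> p (X m - X n)"
    and le: "\<And>k m n. \<phi> k (X m - X n) \<le> p (X m - X n)"
    and lipschitz: "\<And>k S T. \<phi> k (S + T) \<le> \<phi> k S + c k * norm T"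
  shows "\<exists>T. \<forall>e>0. \<exists>n0. \<forall>n\<ge>n0. \<forall>k. \<phi> k (X n - T) \<le> e"
proof -
  have "\<exists>n0. \<forall>m\<ge>n0. \<forall>n\<ge>n0. norm (X m - X n) < e" if "0 < e" for e
    using Cauchy[OF that] norm_le by (meson le_less_trans)
  then obtain T where T: "(\<lambda>n. norm (X n - T)) \<longlonglongrightarrow> 0" using blinfun_Cauchy_limit[of X] by blast
  have "\<phi> k (X m - T) \<le> e"
    if n0: "\<forall>m\<ge>n0. \<forall>n\<ge>n0. p (X m - X n) < e" and m: "m \<ge> n0" for e n0 m k
  proof (rule tendsto_lowerbound)
    show "(\<lambda>n. e + c k * norm (X n - T)) \<longlonglongrightarrow> e"
      using tendsto_add[OF tendsto_const tendsto_mult_left[OF T, of "c k"], of e] by simp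
    have "\<phi> k (X m - T) \<le> e + c k * norm (X n - T)" if n: "n \<ge> n0" for n
    proof -
      have "\<phi> k (X m - T) \<le> \<phi> k (X m - X n) + c k * norm (X n - T)"
        using lipschitz[of k "X m - X n" "X n - T"] by simp
      moreover have "\<phi> k (X m - X n) \<le> e" using le[of k m n] n0 m n by fastforce
      ultimately show ?thesis by simp
    qed
    then show "\<forall>\<^sub>F n in sequentially. \<phi> k (X m - T) \<le> e + c k * norm (X n - T)"
      by (auto simp: eventually_sequentially)
  qed simp
  then show ?thesis using Cauchy by meson
qed

lemma LIMSEQ_0_le:
  fixes f :: "nat \<Rightarrow> real"
  assumes "\<And>e. 0 < e \<Longrightarrow> \<exists>n0. \<forall>n\<ge>n0. f n \<le> e" and "\<And>n. 0 \<le> f n"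
  shows "f \<longlonglongrightarrow> 0"
proof (rule LIMSEQ_I)
  fix e :: real assume e: "0 < e"
  then obtain n0 where "\<forall>n\<ge>n0. f n \<le> e/2" using assms(1)[of "e/2"] by auto
  then show "\<exists>n0. \<forall>n\<ge>n0. norm (f n - 0) < e" using e assms(2) by (intro exI[of _ n0]) force
qed

proposition weak_ideal0_complete:
  fixes X :: "nat \<Rightarrow> 'a::{real_inner, complete_space} \<Rightarrow>\<^sub>L 'a"
  assumes X: "\<And>n. X n \<in> weak_ideal0"
    and Cauchy: "\<And>e. 0 < e \<Longrightarrow> \<exists>n0. \<forall>m\<ge>n0. \<forall>n\<ge>n0. weak_norm (X m - X n) < e"
  shows "\<exists>T\<in>weak_ideal0. (\<lambda>n. weak_norm (X n - T)) \<longlonglongrightarrow> 0"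
proof -
  note XX = weak_ideal0_diff[OF X X]
  have "real (Suc k) * approx_number (S + T) k \<le> real (Suc k) * approx_number S k + real (Suc k) * norm T"
    for k and S T :: "'a \<Rightarrow>\<^sub>L 'a"
    using mult_left_mono[OF approx_number_add_norm[of S T k], of "real (Suc k)"] by (simp add: distrib_left)
  then obtain T where T: "\<And>e. 0 < e \<Longrightarrow> \<exists>n0. \<forall>n\<ge>n0. \<forall>k. real (Suc k) * approx_number (X n - T) k \<le> e"
    using Cauchy_limit_functionals[where X = X and p = weak_norm and c = "\<lambda>k. real (Suc k)"
        and \<phi> = "\<lambda>k T. real (Suc k) * approx_number T k",
        OF Cauchy norm_le_weak_norm[OF XX] weak_norm_upper[OF XX]] by blast
  have TI: "T \<in> weak_ideal0"
  proof (rule weak_ideal0_closed)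
    fix e :: real assume "0 < e"
    then obtain n where "\<forall>k. real (Suc k) * approx_number (X n - T) k \<le> e" using T by blast
    then show "\<exists>S\<in>weak_ideal0. \<forall>k. real (Suc k) * approx_number (T - S) k \<le> e"
      using approx_number_minus[of "X n - T"] X by (intro bexI[of _ "X n"]) auto
  qed
  note XT = weak_ideal0_diff[OF X TI]
  have "(\<lambda>n. weak_norm (X n - T)) \<longlonglongrightarrow> 0"
    using T weak_norm_least[OF XT] by (intro LIMSEQ_0_le weak_norm_nonneg[OF XT]) meson
  then show ?thesis using TI by blast
qed

section \<open>The trace class\<close>

lemma trace_class_iff:
  fixes T :: "'a::{real_inner, complete_space} \<Rightarrow>\<^sub>L 'a"
  shows "T \<in> trace_class \<longleftrightarrow> summable (approx_number T)"
  using summable_LIMSEQ_zero[of "approx_number T"] singular_value_eq_approx_number[of T]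
  unfolding trace_class_def by (auto simp: compact_operator_iff_approx_numbers_tendsto_0)

lemma trace_class_compact: "T \<in> trace_class \<Longrightarrow> compact_operator T"
  by (simp add: trace_class_def)

lemma trace_norm_eq:
  "T \<in> trace_class \<Longrightarrow> trace_norm T = (\<Sum>n. approx_number T n)"
  for T :: "'a::{real_inner, complete_space} \<Rightarrow>\<^sub>L 'a"
  by (simp add: trace_norm_def singular_value_eq_approx_number trace_class_compact)

lemma trace_norm_partial_sum:
  "T \<in> trace_class \<Longrightarrow> (\<Sum>n<N. approx_number T n) \<le> trace_norm T"
  for T :: "'a::{real_inner, complete_space} \<Rightarrow>\<^sub>L 'a"
  by (simp add: trace_norm_eq sum_le_suminf trace_class_iff approx_number_nonneg)

lemma trace_classI_bounded:
  fixes T :: "'a::{real_inner, complete_space} \<Rightarrow>\<^sub>L 'a"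
  assumes "\<And>N. (\<Sum>n<N. approx_number T n) \<le> c"
  shows "T \<in> trace_class" "trace_norm T \<le> c"
proof -
  have s: "summable (approx_number T)"
    by (rule summableI_nonneg_bounded) (use assms approx_number_nonneg in auto)
  then show *: "T \<in> trace_class" by (simp add: trace_class_iff)
  show "trace_norm T \<le> c" unfolding trace_norm_eq[OF *] using assms by (intro suminf_le_const s) auto
qed

lemma norm_le_trace_norm: "T \<in> trace_class \<Longrightarrow> norm T \<le> trace_norm T"
  for T :: "'a::{real_inner, complete_space} \<Rightarrow>\<^sub>L 'a"
  using trace_norm_partial_sum[of T 1] by (simp add: approx_number_0)

lemma trace_norm_nonneg: "T \<in> trace_class \<Longrightarrow> 0 \<le> trace_norm T"
  for T :: "'a::{real_inner, complete_space} \<Rightarrow>\<^sub>L 'a"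
  using norm_le_trace_norm[of T] norm_ge_zero[of T] by linarith

lemma bessel_inequality:
  fixes x :: "nat \<Rightarrow> 'a::real_inner"
  assumes orth: "\<And>i j. i \<noteq> j \<Longrightarrow> x i \<bullet> x j = 0" and nrm: "\<And>i. x i \<bullet> x i \<le> 1"
  shows "(\<Sum>i<N. (w \<bullet> x i)\<^sup>2) \<le> w \<bullet> w"
proof -
  define p where "p = (\<Sum>i<N. (w \<bullet> x i) *\<^sub>R x i)"
  have wp: "w \<bullet> p = (\<Sum>i<N. (w \<bullet> x i)\<^sup>2)" by (simp add: p_def inner_sum_right power2_eq_square)
  have px: "x i \<bullet> p = (w \<bullet> x i) * (x i \<bullet> x i)" if "i < N" for i
  proof -
    have "x i \<bullet> p = (\<Sum>j<N. if j = i then (w \<bullet> x i) * (x i \<bullet> x i) else 0)"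
      unfolding p_def inner_sum_right by (intro sum.cong) (auto simp: orth)
    then show ?thesis using that by simp
  qed
  have "p \<bullet> p = (\<Sum>i<N. (w \<bullet> x i) * (x i \<bullet> p))" by (subst (1) p_def) (simp add: inner_sum_left)
  also have "\<dots> = (\<Sum>i<N. (w \<bullet> x i)\<^sup>2 * (x i \<bullet> x i))"
    by (intro sum.cong) (auto simp: px power2_eq_square)
  also have "\<dots> \<le> (\<Sum>i<N. (w \<bullet> x i)\<^sup>2 * 1)" using nrm by (intro sum_mono mult_left_mono) auto
  finally have "p \<bullet> p \<le> w \<bullet> p" by (simp add: wp)
  moreover have "(w - p) \<bullet> (w - p) = w \<bullet> w - 2 * (w \<bullet> p) + p \<bullet> p"
    by (simp add: inner_diff_left inner_diff_right inner_commute)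
  moreover have "0 \<le> (w - p) \<bullet> (w - p)" by simp
  ultimately show ?thesis unfolding wp[symmetric] by linarith
qed

text \<open>Zero vectors are admitted, so that the singular vectors of a finite rank operator form such a
  family as well.\<close>

definition sub_orthonormal :: "(nat \<Rightarrow> 'a::real_inner) \<Rightarrow> bool" where
  "sub_orthonormal x \<longleftrightarrow> (\<forall>i j. i \<noteq> j \<longrightarrow> x i \<bullet> x j = 0) \<and> (\<forall>i. x i \<bullet> x i \<le> 1)"

lemma sub_orthonormal_norm: "sub_orthonormal x \<Longrightarrow> norm (x i) \<le> 1"
  by (simp add: sub_orthonormal_def norm_eq_sqrt_inner)

text \<open>Termwise arithmetic-geometric mean, then Bessel for both families.\<close>

lemma sub_orthonormal_pairing:
  assumes x: "sub_orthonormal x" and y: "sub_orthonormal y" and a: "norm a \<le> 1" and b: "norm b \<le> 1"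
  shows "(\<Sum>i<N::nat. (x i \<bullet> a) * (b \<bullet> y i)) \<le> 1"
proof -
  have bess: "(\<Sum>i<N. (w \<bullet> z i)\<^sup>2) \<le> 1" if z: "sub_orthonormal z" and w: "norm w \<le> 1"
    for z and w :: "'c::real_inner"
  proof -
    have "w \<bullet> w \<le> 1" using w by (simp add: norm_eq_sqrt_inner)
    then show ?thesis using bessel_inequality[of z w N] z by (simp add: sub_orthonormal_def)
  qed
  have "2 * (c * d) \<le> c\<^sup>2 + d\<^sup>2" for c d :: real using sum_squares_bound[of c d] by simp
  then have "2 * (\<Sum>i<N. (x i \<bullet> a) * (b \<bullet> y i)) \<le> (\<Sum>i<N. (x i \<bullet> a)\<^sup>2 + (b \<bullet> y i)\<^sup>2)"
    unfolding sum_distrib_left by (intro sum_mono)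
  also have "\<dots> = (\<Sum>i<N. (a \<bullet> x i)\<^sup>2) + (\<Sum>i<N. (b \<bullet> y i)\<^sup>2)"
    by (simp add: sum.distrib inner_commute)
  also have "\<dots> \<le> 1 + 1" by (intro add_mono bess x y a b)
  finally show ?thesis by simp
qed

context compact_op
begin

definition "f n = inverse (s n) *\<^sub>R T (e n)"

lemma T_e_f: "T (e n) = s n *\<^sub>R f n"
  using norm_T_e[of n] by (cases "s n = 0") (auto simp: f_def)

lemma sub_orthonormal_e: "sub_orthonormal e"
  unfolding sub_orthonormal_def
proof (intro conjI allI impI)
  fix i show "e i \<bullet> e i \<le> 1" using e_inner_cases[of i] by linarith
qed (rule e_orthogonal)

lemma sub_orthonormal_f: "sub_orthonormal f"
  unfolding sub_orthonormal_def
proof (intro conjI allI impI)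
  fix i j :: nat assume "i \<noteq> j"
  then show "f i \<bullet> f j = 0" by (simp add: f_def T_eigen e_orthogonal)
next
  fix i show "f i \<bullet> f i \<le> 1"
    using norm_T_e[of i] by (cases "s i = 0") (auto simp: f_def field_simps power2_eq_square simp flip: power2_norm_eq_inner)
qed

lemma T_e_inner_f: "T (e n) \<bullet> f n = s n"
  using norm_T_e[of n] by (cases "s n = 0") (auto simp: f_def power2_eq_square simp flip: power2_norm_eq_inner)

end

text \<open>Pair the \<open>M\<close>-th
  Schmidt expansion: by Bessel each term \<open>s\<^sub>k\<close> enters with weight at most one, and the remainder
  has operator norm \<open>s\<^sub>M \<rightarrow> 0\<close>.\<close>

lemma trace_norm_pairing:
  fixes T :: "'a::{real_inner, complete_space} \<Rightarrow>\<^sub>L 'a"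
  assumes T: "T \<in> trace_class" and x: "sub_orthonormal x" and y: "sub_orthonormal y"
  shows "(\<Sum>i<N. T (x i) \<bullet> y i) \<le> trace_norm T"
proof -
  interpret compact_op T by (rule compact_op.intro[OF trace_class_compact[OF T]])
  have bound: "(\<Sum>i<N. T (x i) \<bullet> y i) \<le> real N * s M + trace_norm T" for M
  proof -
    have "(\<Sum>i<N. T (x i) \<bullet> y i)
        = (\<Sum>i<N. D M (x i) \<bullet> y i + (\<Sum>k<M. s k * ((x i \<bullet> e k) * (f k \<bullet> y i))))"
    proof (intro sum.cong refl)
      fix i
      have "T (x i) \<bullet> y i = (D M (x i) + (\<Sum>k<M. (x i \<bullet> e k) *\<^sub>R T (e k))) \<bullet> y i"
        by (rule arg_cong[OF T_expand])
      then show "T (x i) \<bullet> y i = D M (x i) \<bullet> y i + (\<Sum>k<M. s k * ((x i \<bullet> e k) * (f k \<bullet> y i)))"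
        by (simp add: inner_add_left inner_sum_left T_e_f mult_ac)
    qed
    also have "\<dots> = (\<Sum>i<N. D M (x i) \<bullet> y i) + (\<Sum>k<M. s k * (\<Sum>i<N. (x i \<bullet> e k) * (f k \<bullet> y i)))"
      unfolding sum.distrib sum_distrib_left by (subst (2) sum.swap) simp
    also have "(\<Sum>k<M. s k * (\<Sum>i<N. (x i \<bullet> e k) * (f k \<bullet> y i))) \<le> (\<Sum>k<M. s k * 1)"
      by (intro sum_mono mult_left_mono sub_orthonormal_pairing x y
          sub_orthonormal_norm[OF sub_orthonormal_e] sub_orthonormal_norm[OF sub_orthonormal_f]) simp
    also have "(\<Sum>k<M. s k * 1) \<le> trace_norm T"
      using trace_norm_partial_sum[OF T, of M] by (simp add: approx_number_eq_s)
    also have "(\<Sum>i<N. D M (x i) \<bullet> y i) \<le> (\<Sum>i<N. s M)"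
    proof (rule sum_mono)
      fix i
      have "D M (x i) \<bullet> y i \<le> norm (D M (x i)) * norm (y i)" by (rule norm_cauchy_schwarz)
      also have "\<dots> \<le> (s M * norm (x i)) * norm (y i)" by (intro mult_right_mono norm_blinfun) simp
      also have "\<dots> \<le> (s M * 1) * 1"
        using x y by (intro mult_mono sub_orthonormal_norm) auto
      finally show "D M (x i) \<bullet> y i \<le> s M" by simp
    qed
    finally show ?thesis by simp
  qed
  have "(\<lambda>M. real N * s M + trace_norm T) \<longlonglongrightarrow> real N * 0 + trace_norm T"
    by (intro tendsto_intros s_tendsto_0)
  then have "(\<Sum>i<N. T (x i) \<bullet> y i) \<le> real N * 0 + trace_norm T"
    by (rule LIMSEQ_le_const) (use bound in blast)
  then show ?thesis by simp
qed

text \<open>The partial sums of the singular values of \<open>S + T\<close> are pairings of \<open>S + T\<close> with its own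
  singular vectors; they split additively, and each part is bounded by a trace norm.\<close>

lemma trace_norm_triangle:
  fixes S T :: "'a::{real_inner, complete_space} \<Rightarrow>\<^sub>L 'a"
  assumes S: "S \<in> trace_class" and T: "T \<in> trace_class"
  shows "S + T \<in> trace_class" "trace_norm (S + T) \<le> trace_norm S + trace_norm T"
proof -
  interpret ST: compact_op "S + T"
    by (rule compact_op.intro) (intro compact_operator_add trace_class_compact S T)
  have "(\<Sum>n<N. approx_number (S + T) n) \<le> trace_norm S + trace_norm T" for N
  proof -
    have "(\<Sum>n<N. approx_number (S + T) n) = (\<Sum>n<N. (S + T) (ST.e n) \<bullet> ST.f n)"
      by (simp only: ST.T_e_inner_f ST.approx_number_eq_s)
    also have "\<dots> = (\<Sum>n<N. S (ST.e n) \<bullet> ST.f n) + (\<Sum>n<N. T (ST.e n) \<bullet> ST.f n)"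
      by (simp add: blinfun.add_left inner_add_left sum.distrib)
    also have "\<dots> \<le> trace_norm S + trace_norm T"
      by (intro add_mono trace_norm_pairing S T ST.sub_orthonormal_e ST.sub_orthonormal_f)
    finally show ?thesis .
  qed
  from trace_classI_bounded[of "S + T", OF this]
  show "S + T \<in> trace_class" "trace_norm (S + T) \<le> trace_norm S + trace_norm T" by auto
qed

lemma trace_class_scaleR:
  fixes T :: "'a::{real_inner, complete_space} \<Rightarrow>\<^sub>L 'a"
  assumes T: "T \<in> trace_class"
  shows "c *\<^sub>R T \<in> trace_class" "trace_norm (c *\<^sub>R T) = \<bar>c\<bar> * trace_norm T"
proof -
  have eq: "approx_number (c *\<^sub>R T) = (\<lambda>n. \<bar>c\<bar> * approx_number T n)"
    by (rule ext) (rule approx_number_scaleR)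
  show *: "c *\<^sub>R T \<in> trace_class" using T unfolding trace_class_iff eq by (rule summable_mult)
  show "trace_norm (c *\<^sub>R T) = \<bar>c\<bar> * trace_norm T"
    unfolding trace_norm_eq[OF *] trace_norm_eq[OF T] eq
    using T by (intro suminf_mult) (simp add: trace_class_iff)
qed

lemma trace_class_minus:
  fixes T :: "'a::{real_inner, complete_space} \<Rightarrow>\<^sub>L 'a"
  assumes "T \<in> trace_class"
  shows "- T \<in> trace_class" "trace_norm (- T) = trace_norm T"
  using trace_class_scaleR[OF assms, of "-1"] by auto

lemma trace_class_diff:
  "S \<in> trace_class \<Longrightarrow> T \<in> trace_class \<Longrightarrow> S - T \<in> trace_class"
  for S T :: "'a::{real_inner, complete_space} \<Rightarrow>\<^sub>L 'a"
  using trace_norm_triangle(1)[OF _ trace_class_minus(1)] by fastforce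

lemma trace_class_0 [simp]:
  "(0 :: 'a::{real_inner, complete_space} \<Rightarrow>\<^sub>L 'a) \<in> trace_class"
  "trace_norm (0 :: 'a::{real_inner, complete_space} \<Rightarrow>\<^sub>L 'a) = 0"
proof -
  have "approx_number (0 :: 'a \<Rightarrow>\<^sub>L 'a) = (\<lambda>n. 0)" by (rule ext, rule approx_number_rank_le[OF zero_rank_le[of 0]]) simp
  then show *: "(0 :: 'a \<Rightarrow>\<^sub>L 'a) \<in> trace_class" "trace_norm (0 :: 'a \<Rightarrow>\<^sub>L 'a) = 0"
    by (simp_all add: trace_class_iff trace_norm_eq)
qed

lemma trace_norm_eq_0: "T \<in> trace_class \<Longrightarrow> trace_norm T = 0 \<longleftrightarrow> T = 0"
  for T :: "'a::{real_inner, complete_space} \<Rightarrow>\<^sub>L 'a"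
  using norm_le_trace_norm[of T] by auto

lemma rank_le_trace_class:
  fixes F :: "'a::{real_inner, complete_space} \<Rightarrow>\<^sub>L 'a"
  assumes F: "F \<in> rank_le m"
  shows "F \<in> trace_class" "trace_norm F \<le> real m * norm F"
proof -
  have "(\<Sum>n<N. approx_number F n) \<le> real m * norm F" for N
  proof -
    have "(\<Sum>n<N. approx_number F n) \<le> (\<Sum>n<m+N. approx_number F n)"
      by (intro sum_mono2) (auto simp: approx_number_nonneg)
    also have "\<dots> = (\<Sum>n<m. approx_number F n)"
      by (intro sum.mono_neutral_right) (auto simp: approx_number_rank_le[OF F])
    also have "\<dots> \<le> (\<Sum>n<m. norm F)" by (intro sum_mono approx_number_le_norm)
    finally show ?thesis by simp
  qed
  from trace_classI_bounded[of F, OF this]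
  show "F \<in> trace_class" "trace_norm F \<le> real m * norm F" by auto
qed

lemma trace_class_adj:
  fixes T :: "'a::{real_inner, complete_space} \<Rightarrow>\<^sub>L 'a"
  assumes T: "T \<in> trace_class"
  shows "adj T \<in> trace_class" "trace_norm (adj T) \<le> trace_norm T"
proof -
  have "(\<Sum>n<N. approx_number (adj T) n) \<le> trace_norm T" for N
    by (rule order_trans[OF _ trace_norm_partial_sum[OF T, of N]]) (intro sum_mono approx_number_adj_le)
  from trace_classI_bounded[of "adj T", OF this]
  show "adj T \<in> trace_class" "trace_norm (adj T) \<le> trace_norm T" by auto
qed

lemma trace_class_pushforward:
  fixes L :: "'a::{real_inner, complete_space} \<Rightarrow>\<^sub>L 'b::{real_inner, complete_space}"
  assumes T: "T \<in> trace_class"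
  shows "L o\<^sub>L T o\<^sub>L adj L \<in> trace_class"
    "trace_norm (L o\<^sub>L T o\<^sub>L adj L) \<le> (norm L)\<^sup>2 * trace_norm T"
proof -
  have "(\<Sum>n<N. approx_number (L o\<^sub>L T o\<^sub>L adj L) n) \<le> (norm L)\<^sup>2 * trace_norm T" for N
  proof -
    have "(\<Sum>n<N. approx_number (L o\<^sub>L T o\<^sub>L adj L) n) \<le> (norm L)\<^sup>2 * (\<Sum>n<N. approx_number T n)"
      unfolding sum_distrib_left by (intro sum_mono approx_number_pushforward)
    also have "\<dots> \<le> (norm L)\<^sup>2 * trace_norm T"
      by (intro mult_left_mono trace_norm_partial_sum T) simp
    finally show ?thesis .
  qed
  from trace_classI_bounded[of "L o\<^sub>L T o\<^sub>L adj L", OF this]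
  show "L o\<^sub>L T o\<^sub>L adj L \<in> trace_class"
    "trace_norm (L o\<^sub>L T o\<^sub>L adj L) \<le> (norm L)\<^sup>2 * trace_norm T" by auto
qed

proposition trace_class_complete:
  fixes X :: "nat \<Rightarrow> 'a::{real_inner, complete_space} \<Rightarrow>\<^sub>L 'a"
  assumes X: "\<And>n. X n \<in> trace_class"
    and Cauchy: "\<And>e. 0 < e \<Longrightarrow> \<exists>n0. \<forall>m\<ge>n0. \<forall>n\<ge>n0. trace_norm (X m - X n) < e"
  shows "\<exists>T\<in>trace_class. (\<lambda>n. trace_norm (X n - T)) \<longlonglongrightarrow> 0"
proof -
  note XX = trace_class_diff[OF X X]
  have "(\<Sum>k<K. approx_number (S + T) k) \<le> (\<Sum>k<K. approx_number S k) + real K * norm T"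
    for K and S T :: "'a \<Rightarrow>\<^sub>L 'a"
    using sum_mono[of "{..<K}" "approx_number (S + T)" "\<lambda>k. approx_number S k + norm T"]
    by (simp add: sum.distrib approx_number_add_norm)
  then obtain T where T: "\<And>e. 0 < e \<Longrightarrow> \<exists>n0. \<forall>n\<ge>n0. \<forall>K. (\<Sum>k<K. approx_number (X n - T) k) \<le> e"
    using Cauchy_limit_functionals[where X = X and p = trace_norm and c = real
        and \<phi> = "\<lambda>K T. \<Sum>k<K. approx_number T k",
        OF Cauchy norm_le_trace_norm[OF XX] trace_norm_partial_sum[OF XX]] by blast
  obtain n where "\<And>K. (\<Sum>k<K. approx_number (X n - T) k) \<le> 1" using T[of 1] by auto
  then have "X n - T \<in> trace_class" by (rule trace_classI_bounded(1))
  then have TI: "T \<in> trace_class" using trace_class_diff[OF X[of n], of "X n - T"] by simp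
  have "(\<lambda>n. trace_norm (X n - T)) \<longlonglongrightarrow> 0"
  proof (rule LIMSEQ_0_le)
    fix e :: real assume "0 < e"
    from T[OF this] show "\<exists>n0. \<forall>n\<ge>n0. trace_norm (X n - T) \<le> e"
      using trace_classI_bounded(2)[of "X _ - T"] by meson
  qed (intro trace_norm_nonneg trace_class_diff X TI)
  then show ?thesis using TI by blast
qed

section \<open>Density of finite rank operators\<close>

text \<open>\<open>D n\<close> and \<open>D (n + k)\<close> differ by \<open>k\<close> tensors, and the latter has norm \<open>s (n + k)\<close>.\<close>

lemma (in compact_op) approx_number_deflation: "approx_number (D n) k \<le> approx_number T (n + k)"
proof -
  have "D (n + k) = D n - (\<Sum>j<k. tensor_op (D (n + j) (e (n + j))) (e (n + j)))"
    by (induction k) (simp_all add: diff_diff_eq)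
  then have "approx_number (D n) k \<le> norm (D (n + k))"
    using approx_number_le[OF rank_leI, of "D n"] by simp
  then show ?thesis by (simp add: approx_number_eq_s)
qed

lemma ex_rank_le_shift:
  fixes T :: "'a::{real_inner, complete_space} \<Rightarrow>\<^sub>L 'a"
  assumes "compact_operator T"
  shows "\<exists>F\<in>rank_le n. \<forall>k. approx_number (T - F) k \<le> approx_number T (n + k)"
proof -
  interpret compact_op T by (rule compact_op.intro) fact
  have "T - (\<Sum>k<n. tensor_op (D k (e k)) (e k)) = D n" by (rule D_eq[symmetric])
  then show ?thesis using approx_number_deflation[of n]
    by (intro bexI[of _ "\<Sum>k<n. tensor_op (D k (e k)) (e k)"] rank_leI) simp
qed

lemma weak_ideal0_rank_le_dense:
  fixes T :: "'a::{real_inner, complete_space} \<Rightarrow>\<^sub>L 'a"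
  assumes T: "T \<in> weak_ideal0" and e: "0 < e"
  obtains n F where "F \<in> rank_le n" "weak_norm (T - F) < e"
proof -
  obtain n where n: "\<And>m. m \<ge> n \<Longrightarrow> real (Suc m) * approx_number T m < e/2"
    using LIMSEQ_D[OF T[unfolded weak_ideal0_iff], of "e/2"] e by (auto simp: abs_mult approx_number_nonneg)
  obtain F where F: "F \<in> rank_le n" and le: "\<And>k. approx_number (T - F) k \<le> approx_number T (n + k)"
    using ex_rank_le_shift[OF weak_ideal0_compact[OF T], of n] by blast
  have "weak_norm (T - F) \<le> e/2"
  proof (rule weak_norm_least)
    show "T - F \<in> weak_ideal0" by (intro weak_ideal0_diff T rank_le_weak_ideal0[OF F])
    fix k
    have "real (Suc k) * approx_number (T - F) k \<le> real (Suc (n + k)) * approx_number T (n + k)"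
      by (intro mult_mono le approx_number_nonneg) auto
    then show "real (Suc k) * approx_number (T - F) k \<le> e/2" using n[of "n + k"] by simp
  qed
  then show ?thesis using that[OF F] e by simp
qed

lemma trace_class_rank_le_dense:
  fixes T :: "'a::{real_inner, complete_space} \<Rightarrow>\<^sub>L 'a"
  assumes T: "T \<in> trace_class" and e: "0 < e"
  obtains n F where "F \<in> rank_le n" "trace_norm (T - F) < e"
proof -
  have sm: "summable (approx_number T)" using T by (simp add: trace_class_iff)
  obtain n where n: "norm (\<Sum>i. approx_number T (i + n)) < e"
    using suminf_exist_split[OF e sm] by blast
  obtain F where F: "F \<in> rank_le n" and le: "\<And>k. approx_number (T - F) k \<le> approx_number T (n + k)"
    using ex_rank_le_shift[OF trace_class_compact[OF T], of n] by blast
  have TF: "T - F \<in> trace_class" by (intro trace_class_diff T rank_le_trace_class(1)[OF F])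
  have "trace_norm (T - F) \<le> (\<Sum>i. approx_number T (i + n))"
    unfolding trace_norm_eq[OF TF] using le TF sm
    by (intro suminf_le) (auto simp: add.commute trace_class_iff summable_iff_shift)
  then show ?thesis using that[OF F] n by simp
qed

section \<open>A power-subadditive renorming\<close>

lemma approx_number_sum_list:
  "approx_number (sum_list Ts) (\<Sum>T\<leftarrow>Ts. k T) \<le> (\<Sum>T\<leftarrow>Ts. approx_number T (k T))"
proof (induction Ts)
  case Nil
  then show ?case by (simp add: approx_number_0)
next
  case (Cons T Ts)
  then show ?case
    using approx_number_add[of T "sum_list Ts" "k T" "\<Sum>T\<leftarrow>Ts. k T"] by simp
qed

lemma sum_list_weak_ideal0:
  "set Ts \<subseteq> weak_ideal0 \<Longrightarrow> sum_list Ts \<in> (weak_ideal0 :: ('a::{real_inner, complete_space} \<Rightarrow>\<^sub>L 'a) set)"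
  by (induction Ts) (auto intro: weak_ideal0_add)

text \<open>The index budget \<open>n\<close> in \<open>a\<^sub>n (\<Sum>T\<^sub>i) \<le> \<Sum> a\<^bsub>k(i)\<^esub> T\<^sub>i\<close>, where \<open>\<Sum> k(i) \<le> n\<close>, is distributed over the
  summands proportionally to \<open>\<parallel>T\<^sub>i\<parallel>\<^sup>1\<^sup>/\<^sup>2\<close>; this makes the constant independent of their number.\<close>

lemma weak_norm_sum_list:
  fixes Ts :: "('a::{real_inner, complete_space} \<Rightarrow>\<^sub>L 'a) list"
  assumes Ts: "set Ts \<subseteq> weak_ideal0"
  shows "weak_norm (sum_list Ts) \<le> 2 * (\<Sum>T\<leftarrow>Ts. sqrt (weak_norm T))\<^sup>2"
proof (rule weak_norm_least[OF sum_list_weak_ideal0[OF Ts]])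
  fix n
  define S where "S = (\<Sum>T\<leftarrow>Ts. sqrt (weak_norm T))"
  define k where "k T = nat \<lfloor>real n * sqrt (weak_norm T) / S\<rfloor>" for T :: "'a \<Rightarrow>\<^sub>L 'a"
  have nn: "0 \<le> sqrt (weak_norm T)" if "T \<in> set Ts" for T using Ts that by (auto intro: weak_norm_nonneg)
  have S0: "0 \<le> S" unfolding S_def using nn by (intro sum_list_nonneg) auto
  have le_S: "sqrt (weak_norm T) \<le> S" if "T \<in> set Ts" for T
    unfolding S_def using that nn by (intro member_le_sum_list) auto
  have k: "real (k T) \<le> real n * sqrt (weak_norm T) / S" if "T \<in> set Ts" for T
    unfolding k_def using nn[OF that] S0 by (intro of_nat_floor) simp
  have "real (\<Sum>T\<leftarrow>Ts. k T) = (\<Sum>T\<leftarrow>Ts. real (k T))"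
    by (induction Ts) auto
  also have "\<dots> \<le> (\<Sum>T\<leftarrow>Ts. real n / S * sqrt (weak_norm T))"
    using k by (intro sum_list_mono) simp
  also have "\<dots> = real n / S * S" unfolding S_def by (rule sum_list_const_mult)
  also have "\<dots> \<le> real n" by simp
  finally have kn: "(\<Sum>T\<leftarrow>Ts. k T) \<le> n" by simp
  have each: "real (Suc n) * approx_number T (k T) \<le> 2 * S * sqrt (weak_norm T)" if T: "T \<in> set Ts" for T
  proof (cases "S = 0")
    case True
    then have "norm T \<le> 0" using le_S[OF T] nn[OF T] norm_le_weak_norm[of T] Ts T by (auto simp: real_sqrt_eq_0_iff)
    then have "approx_number T (k T) \<le> 0" using approx_number_le_norm[of T "k T"] by linarith
    then show ?thesis using True by (simp add: mult_nonneg_nonpos)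
  next
    case False
    define w where "w = sqrt (weak_norm T)"
    have w0: "0 \<le> w" using nn[OF T] by (simp add: w_def)
    have Spos: "0 < S" using S0 False by simp
    have ww: "weak_norm T = w * w" using Ts T by (auto simp: w_def weak_norm_nonneg)
    have "real n * w / S \<le> real (Suc (k T))" unfolding k_def w_def by linarith
    then have "real n * w \<le> S * real (Suc (k T))" using Spos by (simp add: field_simps)
    moreover have "w * 1 \<le> S * real (Suc (k T))"
      using le_S[OF T] w0 S0 by (intro mult_mono) (auto simp: w_def)
    ultimately have nw: "real (Suc n) * w \<le> 2 * S * real (Suc (k T))" by (simp add: algebra_simps)
    have a: "real (Suc (k T)) * approx_number T (k T) \<le> w * w"
      using weak_norm_upper[of T "k T"] Ts T by (auto simp: ww)
    have "real (Suc (k T)) * (real (Suc n) * approx_number T (k T))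
        = real (Suc n) * (real (Suc (k T)) * approx_number T (k T))" by (simp add: mult_ac)
    also have "\<dots> \<le> real (Suc n) * (w * w)" by (intro mult_left_mono a) simp
    also have "\<dots> = (real (Suc n) * w) * w" by (simp add: mult_ac)
    also have "\<dots> \<le> (2 * S * real (Suc (k T))) * w" by (intro mult_right_mono nw w0)
    also have "\<dots> = real (Suc (k T)) * (2 * S * w)" by (simp add: mult_ac)
    finally show ?thesis unfolding w_def[symmetric] by (rule mult_left_le_imp_le) simp
  qed
  have "real (Suc n) * approx_number (sum_list Ts) n
      \<le> real (Suc n) * (\<Sum>T\<leftarrow>Ts. approx_number T (k T))"
    by (intro mult_left_mono order_trans[OF approx_number_antimono[OF kn] approx_number_sum_list]) simp
  also have "\<dots> = (\<Sum>T\<leftarrow>Ts. real (Suc n) * approx_number T (k T))"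
    by (rule sum_list_const_mult[symmetric])
  also have "\<dots> \<le> (\<Sum>T\<leftarrow>Ts. 2 * S * sqrt (weak_norm T))" by (intro sum_list_mono each)
  also have "\<dots> = 2 * S * S" unfolding S_def by (rule sum_list_const_mult)
  finally show "real (Suc n) * approx_number (sum_list Ts) n \<le> 2 * (\<Sum>T\<leftarrow>Ts. sqrt (weak_norm T))\<^sup>2"
    by (simp add: S_def power2_eq_square)
qed

text \<open>The infimum of \<open>\<Sum>\<parallel>T\<^sub>i\<parallel>\<^sup>1\<^sup>/\<^sup>2\<close> over finite decompositions of \<open>T\<close> is the largest subadditive
  minorant of \<open>\<parallel>T\<parallel>\<^sup>1\<^sup>/\<^sup>2\<close>; its square is the new quasi-norm.\<close>

definition decompositions :: "('a::real_inner \<Rightarrow>\<^sub>L 'a) \<Rightarrow> ('a \<Rightarrow>\<^sub>L 'a) list set" where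
  "decompositions T = {Ts. set Ts \<subseteq> weak_ideal0 \<and> sum_list Ts = T}"

definition weak_root_norm :: "('a::real_inner \<Rightarrow>\<^sub>L 'a) \<Rightarrow> real" where
  "weak_root_norm T = (INF Ts\<in>decompositions T. \<Sum>S\<leftarrow>Ts. sqrt (weak_norm S))"

lemma sum_list_sqrt_nonneg:
  fixes T :: "'a::{real_inner, complete_space} \<Rightarrow>\<^sub>L 'a"
  shows "Ts \<in> decompositions T \<Longrightarrow> 0 \<le> (\<Sum>S\<leftarrow>Ts. sqrt (weak_norm S))"
  by (auto simp: decompositions_def subset_iff intro!: sum_list_nonneg weak_norm_nonneg)

lemma weak_root_norm_le:
  fixes T :: "'a::{real_inner, complete_space} \<Rightarrow>\<^sub>L 'a"
  assumes "Ts \<in> decompositions T"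
  shows "weak_root_norm T \<le> (\<Sum>S\<leftarrow>Ts. sqrt (weak_norm S))"
  unfolding weak_root_norm_def
  by (rule cINF_lower[OF _ assms]) (use sum_list_sqrt_nonneg in \<open>auto simp: bdd_below_def\<close>)

lemma weak_root_norm_le_sqrt: "T \<in> weak_ideal0 \<Longrightarrow> weak_root_norm T \<le> sqrt (weak_norm T)"
  for T :: "'a::{real_inner, complete_space} \<Rightarrow>\<^sub>L 'a"
  using weak_root_norm_le[of "[T]" T] by (simp add: decompositions_def)

lemma weak_root_norm_greatest:
  fixes T :: "'a::{real_inner, complete_space} \<Rightarrow>\<^sub>L 'a"
  assumes "T \<in> weak_ideal0" "\<And>Ts. Ts \<in> decompositions T \<Longrightarrow> c \<le> (\<Sum>S\<leftarrow>Ts. sqrt (weak_norm S))"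
  shows "c \<le> weak_root_norm T"
proof -
  have "[T] \<in> decompositions T" using assms(1) by (simp add: decompositions_def)
  then show ?thesis unfolding weak_root_norm_def using assms(2) by (intro cINF_greatest) auto
qed

lemma weak_root_norm_approx:
  fixes T :: "'a::{real_inner, complete_space} \<Rightarrow>\<^sub>L 'a"
  assumes "T \<in> weak_ideal0" "0 < e"
  obtains Ts where "Ts \<in> decompositions T" "(\<Sum>S\<leftarrow>Ts. sqrt (weak_norm S)) < weak_root_norm T + e"
proof -
  have "[T] \<in> decompositions T" using assms(1) by (simp add: decompositions_def)
  then have ne: "decompositions T \<noteq> {}" by blast
  have bdd: "bdd_below ((\<lambda>Ts. \<Sum>S\<leftarrow>Ts. sqrt (weak_norm S)) ` decompositions T)"
    using sum_list_sqrt_nonneg by (auto simp: bdd_below_def)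
  have "(INF Ts\<in>decompositions T. \<Sum>S\<leftarrow>Ts. sqrt (weak_norm S)) < weak_root_norm T + e"
    using assms(2) by (simp add: weak_root_norm_def)
  then show ?thesis using cINF_less_iff[OF ne bdd] that by blast
qed

lemma weak_norm_le_root_norm:
  fixes T :: "'a::{real_inner, complete_space} \<Rightarrow>\<^sub>L 'a"
  assumes T: "T \<in> weak_ideal0"
  shows "weak_norm T \<le> 2 * (weak_root_norm T)\<^sup>2"
proof -
  have "sqrt (weak_norm T / 2) \<le> weak_root_norm T"
  proof (rule weak_root_norm_greatest[OF T])
    fix Ts assume Ts: "Ts \<in> decompositions T"
    then have "weak_norm T / 2 \<le> (\<Sum>S\<leftarrow>Ts. sqrt (weak_norm S))\<^sup>2"
      using weak_norm_sum_list[of Ts] by (auto simp: decompositions_def)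
    then show "sqrt (weak_norm T / 2) \<le> (\<Sum>S\<leftarrow>Ts. sqrt (weak_norm S))"
      by (intro real_le_lsqrt[OF sum_list_sqrt_nonneg[OF Ts]]) 
  qed
  then have "(sqrt (weak_norm T / 2))\<^sup>2 \<le> (weak_root_norm T)\<^sup>2"
    by (intro power_mono) (auto simp: weak_norm_nonneg T)
  then show ?thesis using weak_norm_nonneg[OF T] by simp
qed

lemma weak_root_norm_nonneg: "T \<in> weak_ideal0 \<Longrightarrow> 0 \<le> weak_root_norm T"
  for T :: "'a::{real_inner, complete_space} \<Rightarrow>\<^sub>L 'a"
  by (rule weak_root_norm_greatest) (auto intro: sum_list_sqrt_nonneg)

lemma weak_root_norm_add:
  fixes S T :: "'a::{real_inner, complete_space} \<Rightarrow>\<^sub>L 'a"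
  assumes S: "S \<in> weak_ideal0" and T: "T \<in> weak_ideal0"
  shows "weak_root_norm (S + T) \<le> weak_root_norm S + weak_root_norm T"
proof (rule field_le_epsilon)
  fix e :: real assume "0 < e"
  then have e: "0 < e/2" by simp
  obtain Ss where Ss: "Ss \<in> decompositions S" "(\<Sum>S\<leftarrow>Ss. sqrt (weak_norm S)) < weak_root_norm S + e/2"
    by (rule weak_root_norm_approx[OF S e])
  obtain Ts where Ts: "Ts \<in> decompositions T" "(\<Sum>S\<leftarrow>Ts. sqrt (weak_norm S)) < weak_root_norm T + e/2"
    by (rule weak_root_norm_approx[OF T e])
  have "Ss @ Ts \<in> decompositions (S + T)" using Ss(1) Ts(1) by (auto simp: decompositions_def)
  from weak_root_norm_le[OF this] show "weak_root_norm (S + T) \<le> weak_root_norm S + weak_root_norm T + e"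
    using Ss(2) Ts(2) by simp
qed

lemma weak_root_norm_scaleR:
  fixes T :: "'a::{real_inner, complete_space} \<Rightarrow>\<^sub>L 'a"
  assumes "T \<in> weak_ideal0"
  shows "weak_root_norm (c *\<^sub>R T) = sqrt \<bar>c\<bar> * weak_root_norm T"
proof (rule homogeneous_if_le[where q = "\<lambda>c. sqrt \<bar>c\<bar>" and V = weak_ideal0])
  fix c :: real and T :: "'a \<Rightarrow>\<^sub>L 'a" assume T: "T \<in> weak_ideal0" and c: "c \<noteq> 0"
  have "weak_root_norm (c *\<^sub>R T) / sqrt \<bar>c\<bar> \<le> weak_root_norm T"
  proof (rule weak_root_norm_greatest[OF T])
    fix Ts assume Ts: "Ts \<in> decompositions T"
    have sc: "sum_list (map ((*\<^sub>R) c) Us) = c *\<^sub>R sum_list Us" for Us :: "('a \<Rightarrow>\<^sub>L 'a) list"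
      by (induction Us) (auto simp: scaleR_add_right)
    have "map ((*\<^sub>R) c) Ts \<in> decompositions (c *\<^sub>R T)"
      using Ts by (auto simp: decompositions_def sc intro: weak_ideal0_scaleR)
    from weak_root_norm_le[OF this]
    have "weak_root_norm (c *\<^sub>R T) \<le> (\<Sum>S\<leftarrow>Ts. sqrt (weak_norm (c *\<^sub>R S)))" by (simp add: o_def)
    also have "\<dots> = (\<Sum>S\<leftarrow>Ts. sqrt \<bar>c\<bar> * sqrt (weak_norm S))"
      using Ts by (intro arg_cong[of _ _ sum_list] map_cong)
        (auto simp: decompositions_def weak_norm_scaleR real_sqrt_mult subset_iff)
    also have "\<dots> = sqrt \<bar>c\<bar> * (\<Sum>S\<leftarrow>Ts. sqrt (weak_norm S))" by (rule sum_list_const_mult)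
    finally show "weak_root_norm (c *\<^sub>R T) / sqrt \<bar>c\<bar> \<le> (\<Sum>S\<leftarrow>Ts. sqrt (weak_norm S))"
      using c by (simp add: field_simps)
  qed
  then show "weak_root_norm (c *\<^sub>R T) \<le> sqrt \<bar>c\<bar> * weak_root_norm T" using c by (simp add: field_simps)
next
  show "weak_root_norm (0 :: 'a \<Rightarrow>\<^sub>L 'a) = sqrt \<bar>0\<bar> * weak_root_norm T"
    using weak_root_norm_le_sqrt[of "0 :: 'a \<Rightarrow>\<^sub>L 'a"] weak_root_norm_nonneg[of "0 :: 'a \<Rightarrow>\<^sub>L 'a"] by simp
qed (auto simp: real_sqrt_inverse intro: assms weak_ideal0_scaleR)

lemma subspace_weak_ideal0: "subspace (weak_ideal0 :: ('a::{real_inner, complete_space} \<Rightarrow>\<^sub>L 'a) set)"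
  by (simp add: subspace_def weak_ideal0_add weak_ideal0_scaleR)

proposition power_subadditive_renorming_exists:
  "power_subadditive_renorming (1/2) (\<lambda>T :: 'a::{real_inner, complete_space} \<Rightarrow>\<^sub>L 'a. (weak_root_norm T)\<^sup>2)"
proof -
  let ?N = "\<lambda>T :: 'a \<Rightarrow>\<^sub>L 'a. (weak_root_norm T)\<^sup>2"
  have zero: "?N T = 0 \<longleftrightarrow> T = 0" if T: "T \<in> weak_ideal0" for T
    using weak_norm_le_root_norm[OF T] weak_norm_nonneg[OF T] weak_norm_eq_0[OF T]
      weak_root_norm_scaleR[OF T, of 0] by auto
  have scale: "?N (c *\<^sub>R T) = \<bar>c\<bar> * ?N T" if T: "T \<in> weak_ideal0" for T c
    by (simp add: weak_root_norm_scaleR T power_mult_distrib)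
  have equiv: "1/2 * weak_norm T \<le> ?N T" "?N T \<le> 1 * weak_norm T" if T: "T \<in> weak_ideal0" for T
    using weak_norm_le_root_norm[OF T] weak_norm_nonneg[OF T]
      power_mono[OF weak_root_norm_le_sqrt[OF T] weak_root_norm_nonneg[OF T], of 2] by simp_all
  have quasi: "?N (S + T) \<le> 2 * (?N S + ?N T)"
    and half: "?N (S + T) powr (1/2) \<le> ?N S powr (1/2) + ?N T powr (1/2)"
    if S: "S \<in> weak_ideal0" and T: "T \<in> weak_ideal0" for S T
  proof -
    note add = weak_root_norm_add[OF S T] and nn = weak_root_norm_nonneg[OF S] weak_root_norm_nonneg[OF T]
      and nn' = weak_root_norm_nonneg[OF weak_ideal0_add[OF S T]]
    have "(weak_root_norm (S + T))\<^sup>2 \<le> (weak_root_norm S + weak_root_norm T)\<^sup>2"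
      by (intro power_mono add nn')
    also have "\<dots> \<le> 2 * ((weak_root_norm S)\<^sup>2 + (weak_root_norm T)\<^sup>2)"
      using sum_squares_bound[of "weak_root_norm S" "weak_root_norm T"] by (simp add: power2_sum)
    finally show "?N (S + T) \<le> 2 * (?N S + ?N T)" .
    show "?N (S + T) powr (1/2) \<le> ?N S powr (1/2) + ?N T powr (1/2)"
      using add nn nn' by (simp add: powr_half_sqrt)
  qed
  have "quasi_norm_on weak_ideal0 ?N"
    unfolding quasi_norm_on_def using subspace_weak_ideal0 zero scale quasi
    by (auto intro!: exI[of _ 2])
  moreover have "equivalent_on weak_ideal0 ?N weak_norm"
  proof -
    have "\<exists>C>0. \<forall>v\<in>weak_ideal0. 1/2 * weak_norm v \<le> ?N v \<and> ?N v \<le> C * weak_norm v"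
      using equiv by (intro exI[of _ 1]) simp
    then show ?thesis unfolding equivalent_on_def by (intro exI[of _ "1/2"]) simp
  qed
  ultimately show ?thesis
    unfolding power_subadditive_renorming_def using half by blast
qed

section \<open>Gauges and metrics\<close>

text \<open>Gauge and metric are uniformly equivalent, so they have the same open sets and the same Cauchy
  sequences.\<close>

lemma gauge_metric_topology:
  assumes M: "Metric_space X d"
    and to_d: "\<And>e. 0 < e \<Longrightarrow> \<exists>\<delta>>0. \<forall>g\<in>X. \<forall>h\<in>X. \<rho> (g - h) < \<delta> \<longrightarrow> d g h < e"
    and to_\<rho>: "\<And>e. 0 < e \<Longrightarrow> \<exists>\<delta>>0. \<forall>g\<in>X. \<forall>h\<in>X. d g h < \<delta> \<longrightarrow> \<rho> (g - h) < e"
  shows "Metric_space.mtopology X d = gauge_topology X \<rho>"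
proof -
  interpret Metric_space X d by fact
  show ?thesis
    unfolding topology_eq openin_mtopology openin_gauge_topology
  proof (intro allI iffI conjI ballI impI; elim conjE)
    fix U g assume U: "U \<subseteq> X" "\<forall>x. x \<in> U \<longrightarrow> (\<exists>r>0. mball x r \<subseteq> U)" and g: "g \<in> U"
    then obtain r where r: "r > 0" "mball g r \<subseteq> U" by blast
    obtain \<delta> where \<delta>: "\<delta> > 0" "\<forall>g\<in>X. \<forall>h\<in>X. \<rho> (g - h) < \<delta> \<longrightarrow> d g h < r" using to_d[OF r(1)] by blast
    show "\<exists>e>0. \<forall>h\<in>X. \<rho> (h - g) < e \<longrightarrow> h \<in> U"
    proof (intro exI[of _ \<delta>] conjI ballI impI \<delta>(1))
      fix h assume h: "h \<in> X" "\<rho> (h - g) < \<delta>"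
      then have "d h g < r" using \<delta>(2) U(1) g by blast
      then show "h \<in> U" using r(2) U(1) g h(1) by (auto simp: mball_def commute)
    qed
  next
    fix U g assume U: "U \<subseteq> X" "\<forall>g\<in>U. \<exists>e>0. \<forall>h\<in>X. \<rho> (h - g) < e \<longrightarrow> h \<in> U" and g: "g \<in> U"
    then obtain e where e: "e > 0" "\<forall>h\<in>X. \<rho> (h - g) < e \<longrightarrow> h \<in> U" by blast
    obtain \<delta> where \<delta>: "\<delta> > 0" "\<forall>g\<in>X. \<forall>h\<in>X. d g h < \<delta> \<longrightarrow> \<rho> (g - h) < e" using to_\<rho>[OF e(1)] by blast
    show "\<exists>r>0. mball g r \<subseteq> U"
    proof (intro exI[of _ \<delta>] conjI subsetI \<delta>(1))
      fix h assume "h \<in> mball g \<delta>"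
      then have h: "h \<in> X" "d h g < \<delta>" by (auto simp: mball_def commute)
      then have "\<rho> (h - g) < e" using \<delta>(2) U(1) g by blast
      then show "h \<in> U" using e(2) h(1) by blast
    qed
  qed auto
qed

lemma gauge_metric_complete:
  assumes M: "Metric_space X d"
    and to_d: "\<And>e. 0 < e \<Longrightarrow> \<exists>\<delta>>0. \<forall>g\<in>X. \<forall>h\<in>X. \<rho> (g - h) < \<delta> \<longrightarrow> d g h < e"
    and to_\<rho>: "\<And>e. 0 < e \<Longrightarrow> \<exists>\<delta>>0. \<forall>g\<in>X. \<forall>h\<in>X. d g h < \<delta> \<longrightarrow> \<rho> (g - h) < e"
    and complete: "gauge_complete X \<rho>"
  shows "Metric_space.mcomplete X d"
proof -
  interpret Metric_space X d by fact
  show ?thesis unfolding mcomplete_def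
  proof (intro allI impI)
    fix \<sigma> assume "MCauchy \<sigma>"
    then have \<sigma>: "range \<sigma> \<subseteq> X"
      and C: "\<And>e. e > 0 \<Longrightarrow> \<exists>N. \<forall>n n'. N \<le> n \<longrightarrow> N \<le> n' \<longrightarrow> d (\<sigma> n) (\<sigma> n') < e"
      by (auto simp: MCauchy_def)
    have in_X: "\<sigma> n \<in> X" for n using \<sigma> by blast
    have "\<exists>n0. \<forall>m\<ge>n0. \<forall>n\<ge>n0. \<rho> (\<sigma> m - \<sigma> n) < e" if e: "0 < e" for e
    proof -
      obtain \<delta> where "\<delta> > 0" "\<forall>g\<in>X. \<forall>h\<in>X. d g h < \<delta> \<longrightarrow> \<rho> (g - h) < e" using to_\<rho>[OF e] by blast
      then show ?thesis using C[of \<delta>] in_X by blast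
    qed
    then obtain l where l: "l \<in> X" "(\<lambda>n. \<rho> (\<sigma> n - l)) \<longlonglongrightarrow> 0"
      using complete \<sigma> unfolding gauge_complete_def by blast
    have "limitin mtopology \<sigma> l sequentially"
      unfolding limitin_metric
    proof (intro conjI allI impI l(1))
      fix e :: real assume "0 < e"
      then obtain \<delta> where \<delta>: "\<delta> > 0" "\<forall>g\<in>X. \<forall>h\<in>X. \<rho> (g - h) < \<delta> \<longrightarrow> d g h < e" using to_d by blast
      from order_tendstoD(2)[OF l(2) \<delta>(1)] show "\<forall>\<^sub>F n in sequentially. \<sigma> n \<in> X \<and> d (\<sigma> n) l < e"
        by eventually_elim (use \<delta>(2) in_X l(1) in blast)
    qed
    then show "\<exists>x. limitin mtopology \<sigma> x sequentially" by blast
  qed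
qed

lemma continuous_map_gauge:
  assumes "f \<in> X \<rightarrow> Y"
    and "\<And>g e. g \<in> X \<Longrightarrow> 0 < e \<Longrightarrow> \<exists>\<delta>>0. \<forall>h\<in>X. \<rho> (h - g) < \<delta> \<longrightarrow> \<rho>' (f h - f g) < e"
  shows "continuous_map (gauge_topology X \<rho>) (gauge_topology Y \<rho>') f"
  unfolding continuous_map_def topspace_gauge_topology
proof (intro conjI allI impI assms(1))
  fix U assume "openin (gauge_topology Y \<rho>') U"
  then have U: "\<And>g. g \<in> U \<Longrightarrow> \<exists>e>0. \<forall>h\<in>Y. \<rho>' (h - g) < e \<longrightarrow> h \<in> U" by (auto simp: openin_gauge_topology)
  show "openin (gauge_topology X \<rho>) {x \<in> X. f x \<in> U}"
    unfolding openin_gauge_topology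
  proof (intro conjI ballI)
    fix g assume "g \<in> {x \<in> X. f x \<in> U}"
    then have g: "g \<in> X" "f g \<in> U" by auto
    obtain e where e: "e > 0" "\<forall>h\<in>Y. \<rho>' (h - f g) < e \<longrightarrow> h \<in> U" using U[OF g(2)] by blast
    obtain \<delta> where \<delta>: "\<delta> > 0" "\<forall>h\<in>X. \<rho> (h - g) < \<delta> \<longrightarrow> \<rho>' (f h - f g) < e" using assms(2)[OF g(1) e(1)] by blast
    show "\<exists>e>0. \<forall>h\<in>X. \<rho> (h - g) < e \<longrightarrow> h \<in> {x \<in> X. f x \<in> U}"
      using \<delta> e(2) assms(1) by (intro exI[of _ \<delta>]) blast
  qed auto
qed

section \<open>The critical gauge\<close>

lemma subspace_skew: "subspace (skew :: ('a::real_inner \<Rightarrow>\<^sub>L 'a) set)"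
  by (auto simp: subspace_def skew_def blinfun.add_left blinfun.scaleR_left inner_add_left inner_add_right)

lemma subspace_selfadj: "subspace (selfadj :: ('a::real_inner \<Rightarrow>\<^sub>L 'a) set)"
  by (auto simp: subspace_def selfadj_def blinfun.add_left blinfun.scaleR_left inner_add_left inner_add_right)

lemma subspace_trace_class: "subspace (trace_class :: ('a::{real_inner, complete_space} \<Rightarrow>\<^sub>L 'a) set)"
  by (simp add: subspace_def trace_norm_triangle trace_class_scaleR)

lemma blinfun_apply_tendsto:
  assumes "(\<lambda>n. norm (X n - T)) \<longlonglongrightarrow> 0"
  shows "(\<lambda>n. blinfun_apply (X n) v) \<longlonglongrightarrow> T v"
proof -
  have "X \<longlonglongrightarrow> T" by (rule LIM_zero_cancel[OF tendsto_norm_zero_cancel[OF assms]])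
  then show ?thesis by (intro blinfun.tendsto tendsto_const)
qed

lemma skew_closed:
  assumes X: "\<And>n. X n \<in> skew" and lim: "(\<lambda>n. norm (X n - T)) \<longlonglongrightarrow> 0"
  shows "T \<in> skew"
  unfolding skew_def mem_Collect_eq
proof (intro allI)
  fix v w
  have "(\<lambda>n. X n v \<bullet> w) \<longlonglongrightarrow> T v \<bullet> w" "(\<lambda>n. - (v \<bullet> X n w)) \<longlonglongrightarrow> - (v \<bullet> T w)"
    by (intro tendsto_intros blinfun_apply_tendsto lim)+
  moreover have "X n v \<bullet> w = - (v \<bullet> X n w)" for n using X by (simp add: skew_def)
  ultimately show "T v \<bullet> w = - (v \<bullet> T w)" using LIMSEQ_unique by fastforce
qed

lemma selfadj_closed:
  assumes X: "\<And>n. X n \<in> selfadj" and lim: "(\<lambda>n. norm (X n - T)) \<longlonglongrightarrow> 0"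
  shows "T \<in> selfadj"
  unfolding selfadj_def mem_Collect_eq
proof (intro allI)
  fix v w
  have "(\<lambda>n. X n v \<bullet> w) \<longlonglongrightarrow> T v \<bullet> w" "(\<lambda>n. v \<bullet> X n w) \<longlonglongrightarrow> v \<bullet> T w"
    by (intro tendsto_intros blinfun_apply_tendsto lim)+
  moreover have "X n v \<bullet> w = v \<bullet> X n w" for n using X by (simp add: selfadj_def)
  ultimately show "T v \<bullet> w = v \<bullet> T w" using LIMSEQ_unique by fastforce
qed

lemma G_crit_iff: "(x, A, Q) \<in> G_crit \<longleftrightarrow> A \<in> weak_ideal0 \<and> A \<in> skew \<and> Q \<in> trace_class \<and> Q \<in> selfadj"
  by (auto simp: G_crit_def)

lemma G_critE:
  assumes "g \<in> G_crit"
  obtains x A Q where "g = (x, A, Q)" "A \<in> weak_ideal0" "Q \<in> trace_class"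
  using assms by (cases g) (auto simp: G_crit_iff)

lemma crit_gauge_diff:
  "crit_gauge ((x, A, Q) - (y, B, R)) = norm (x - y) + weak_norm (A - B) + trace_norm (Q - R)"
  by simp

lemma crit_gauge_basic:
  fixes g h :: "'a::{real_inner, complete_space} triple"
  assumes gh: "g \<in> G_crit" "h \<in> G_crit"
  shows "0 \<le> crit_gauge (g - h) \<and> (crit_gauge (g - h) = 0 \<longleftrightarrow> g = h) \<and> crit_gauge (g - h) = crit_gauge (h - g)"
proof -
  obtain x A Q where g: "g = (x, A, Q)" "A \<in> weak_ideal0" "Q \<in> trace_class" using gh(1) by (rule G_critE)
  obtain y B R where h: "h = (y, B, R)" "B \<in> weak_ideal0" "R \<in> trace_class" using gh(2) by (rule G_critE)
  note W = weak_ideal0_diff[OF g(2) h(2)] and T = trace_class_diff[OF g(3) h(3)]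
  have "weak_norm (A - B) = weak_norm (B - A)" "trace_norm (Q - R) = trace_norm (R - Q)"
    using weak_norm_minus[OF W] trace_class_minus(2)[OF T] by simp_all
  then show ?thesis
    using weak_norm_nonneg[OF W] trace_norm_nonneg[OF T] weak_norm_eq_0[OF W] trace_norm_eq_0[OF T]
    unfolding g h crit_gauge_diff by (auto simp: norm_minus_commute add_nonneg_eq_0_iff)
qed

lemma crit_gauge_triangle:
  fixes g h k :: "'a::{real_inner, complete_space} triple"
  assumes gh: "g \<in> G_crit" "h \<in> G_crit" "k \<in> G_crit"
  shows "crit_gauge (g - k) \<le> 2 * (crit_gauge (g - h) + crit_gauge (h - k))"
proof -
  obtain x A Q where g: "g = (x, A, Q)" "A \<in> weak_ideal0" "Q \<in> trace_class" using gh(1) by (rule G_critE)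
  obtain y B R where h: "h = (y, B, R)" "B \<in> weak_ideal0" "R \<in> trace_class" using gh(2) by (rule G_critE)
  obtain z C P where k: "k = (z, C, P)" "C \<in> weak_ideal0" "P \<in> trace_class" using gh(3) by (rule G_critE)
  have "norm (x - z) \<le> norm (x - y) + norm (y - z)"
    using norm_triangle_ineq[of "x - y" "y - z"] by simp
  moreover have "weak_norm (A - C) \<le> 2 * (weak_norm (A - B) + weak_norm (B - C))"
    using weak_norm_add[OF weak_ideal0_diff[OF g(2) h(2)] weak_ideal0_diff[OF h(2) k(2)]] by simp
  moreover have "trace_norm (Q - P) \<le> trace_norm (Q - R) + trace_norm (R - P)"
    using trace_norm_triangle(2)[OF trace_class_diff[OF g(3) h(3)] trace_class_diff[OF h(3) k(3)]] by simp
  moreover have "0 \<le> norm (x - y)" "0 \<le> norm (y - z)" "0 \<le> trace_norm (Q - R)" "0 \<le> trace_norm (R - P)"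
    by (auto intro!: trace_norm_nonneg trace_class_diff g h k)
  moreover have "a + b + c \<le> 2 * (a1 + b1 + c1 + (a2 + b2 + c2))"
    if "a \<le> a1 + a2" "b \<le> 2 * (b1 + b2)" "c \<le> c1 + c2" "0 \<le> a1" "0 \<le> a2" "0 \<le> c1" "0 \<le> c2"
    for a b c a1 b1 c1 a2 b2 c2 :: real using that by argo
  ultimately show ?thesis unfolding g(1) h(1) k(1) crit_gauge_diff by blast
qed

lemma quasi_gauge_crit: "quasi_gauge_on G_crit (crit_gauge :: 'a::{real_inner, complete_space} triple \<Rightarrow> real)"
  unfolding quasi_gauge_on_def by (intro conjI exI[of _ 2] ballI) (simp_all only: crit_gauge_basic crit_gauge_triangle)

lemma gauge_complete_crit: "gauge_complete G_crit (crit_gauge :: 'a::{real_inner, complete_space} triple \<Rightarrow> real)"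
  unfolding gauge_complete_def
proof (intro allI impI; elim conjE)
  fix \<sigma> :: "nat \<Rightarrow> 'a triple"
  assume \<sigma>: "range \<sigma> \<subseteq> G_crit" and C: "\<forall>e>0. \<exists>n0. \<forall>m\<ge>n0. \<forall>n\<ge>n0. crit_gauge (\<sigma> m - \<sigma> n) < e"
  define x where "x n = fst (\<sigma> n)" for n
  define A where "A n = fst (snd (\<sigma> n))" for n
  define Q where "Q n = snd (snd (\<sigma> n))" for n
  have s: "\<sigma> n = (x n, A n, Q n)" for n by (simp add: x_def A_def Q_def)
  have "\<sigma> n \<in> G_crit" for n using \<sigma> by blast
  then have A: "\<And>n. A n \<in> weak_ideal0" "\<And>n. A n \<in> skew" and Q: "\<And>n. Q n \<in> trace_class" "\<And>n. Q n \<in> selfadj"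
    by (auto simp: s G_crit_iff)
  have parts: "norm (x m - x n) \<le> crit_gauge (\<sigma> m - \<sigma> n)" "weak_norm (A m - A n) \<le> crit_gauge (\<sigma> m - \<sigma> n)"
    "trace_norm (Q m - Q n) \<le> crit_gauge (\<sigma> m - \<sigma> n)" for m n
    unfolding s crit_gauge_diff
    using weak_norm_nonneg[OF weak_ideal0_diff[OF A(1)[of m] A(1)[of n]]]
      trace_norm_nonneg[OF trace_class_diff[OF Q(1)[of m] Q(1)[of n]]] norm_ge_zero[of "x m - x n"]
    by linarith+
  have "Cauchy x"
    by (rule CauchyI) (meson C parts(1) le_less_trans)
  then obtain x' where x': "x \<longlonglongrightarrow> x'" using Cauchy_convergent_iff convergent_def by blast
  obtain A' where A': "A' \<in> weak_ideal0" "(\<lambda>n. weak_norm (A n - A')) \<longlonglongrightarrow> 0"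
    using weak_ideal0_complete[of A] A(1) C parts(2) by (meson le_less_trans)
  obtain Q' where Q': "Q' \<in> trace_class" "(\<lambda>n. trace_norm (Q n - Q')) \<longlonglongrightarrow> 0"
    using trace_class_complete[of Q] Q(1) C parts(3) by (meson le_less_trans)
  have "(\<lambda>n. norm (A n - A')) \<longlonglongrightarrow> 0"
    by (rule Lim_null_comparison[OF _ A'(2)]) (simp add: norm_le_weak_norm weak_ideal0_diff A(1) A'(1))
  then have "A' \<in> skew" using A(2) skew_closed by blast
  moreover have "(\<lambda>n. norm (Q n - Q')) \<longlonglongrightarrow> 0"
    by (rule Lim_null_comparison[OF _ Q'(2)]) (simp add: norm_le_trace_norm trace_class_diff Q(1) Q'(1))
  then have "Q' \<in> selfadj" using Q(2) selfadj_closed by blast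
  ultimately have "(x', A', Q') \<in> G_crit" using A'(1) Q'(1) by (simp add: G_crit_iff)
  moreover have "(\<lambda>n. norm (x n - x') + weak_norm (A n - A') + trace_norm (Q n - Q')) \<longlonglongrightarrow> 0 + 0 + 0"
    using x' by (intro tendsto_add A'(2) Q'(2)) (simp add: LIM_zero tendsto_norm_zero)
  then have "(\<lambda>n. crit_gauge (\<sigma> n - (x', A', Q'))) \<longlonglongrightarrow> 0" unfolding s crit_gauge_diff by simp
  ultimately show "\<exists>l\<in>G_crit. (\<lambda>n. crit_gauge (\<sigma> n - l)) \<longlonglongrightarrow> 0" by blast
qed

text \<open>Write \<open>(a + b)\<^sup>\<theta> = a (a + b)\<^sup>\<theta>\<^sup>-\<^sup>1 + b (a + b)\<^sup>\<theta>\<^sup>-\<^sup>1\<close> and use that \<open>t\<^sup>\<theta>\<^sup>-\<^sup>1\<close> is nonincreasing.\<close>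

lemma powr_subadditive:
  fixes a b \<theta> :: real
  assumes "0 \<le> a" "0 \<le> b" "0 < \<theta>" "\<theta> \<le> 1"
  shows "(a + b) powr \<theta> \<le> a powr \<theta> + b powr \<theta>"
proof (cases "a + b = 0")
  case False
  define s where "s = a + b"
  have s: "0 < s" using False assms by (simp add: s_def)
  have le: "t * s powr (\<theta> - 1) \<le> t powr \<theta>" if t: "0 \<le> t" "t \<le> s" for t
  proof (cases "t = 0")
    case False
    then have "0 < t" using t by simp
    then have "s powr (\<theta> - 1) \<le> t powr (\<theta> - 1)" using t assms by (intro powr_mono2') auto
    then have "t * s powr (\<theta> - 1) \<le> t * t powr (\<theta> - 1)" using t by (intro mult_left_mono)
    also have "\<dots> = t powr \<theta>" using \<open>0 < t\<close> by (simp add: powr_mult_base)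
    finally show ?thesis .
  qed simp
  have "(a + b) powr \<theta> = s * s powr (\<theta> - 1)" using s by (simp add: powr_mult_base s_def)
  also have "\<dots> = a * s powr (\<theta> - 1) + b * s powr (\<theta> - 1)" by (simp add: s_def algebra_simps)
  also have "\<dots> \<le> a powr \<theta> + b powr \<theta>" using assms by (intro add_mono le) (auto simp: s_def)
  finally show ?thesis .
qed simp

lemma crit_dist_eq:
  assumes "(x, A, Q) \<in> G_crit" "(y, B, R) \<in> G_crit"
  shows "crit_dist \<theta> N (x, A, Q) (y, B, R) = norm (x - y) powr \<theta> + N (A - B) powr \<theta> + trace_norm (Q - R) powr \<theta>"
  using assms by (simp add: crit_dist_def)

locale renorming =
  fixes \<theta> :: real and N :: "('a::{real_inner, complete_space} \<Rightarrow>\<^sub>L 'a) \<Rightarrow> real"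
  assumes \<theta>: "0 < \<theta>" "\<theta> \<le> 1" and renorming: "power_subadditive_renorming \<theta> N"
begin

lemma N_nonneg: "T \<in> weak_ideal0 \<Longrightarrow> 0 \<le> N T"
  and N_eq_0: "T \<in> weak_ideal0 \<Longrightarrow> N T = 0 \<longleftrightarrow> T = 0"
  and N_scaleR: "T \<in> weak_ideal0 \<Longrightarrow> N (c *\<^sub>R T) = \<bar>c\<bar> * N T"
  and N_powr: "S \<in> weak_ideal0 \<Longrightarrow> T \<in> weak_ideal0 \<Longrightarrow> N (S + T) powr \<theta> \<le> N S powr \<theta> + N T powr \<theta>"
  using renorming unfolding power_subadditive_renorming_def quasi_norm_on_def
  by blast+

lemma N_minus: "T \<in> weak_ideal0 \<Longrightarrow> N (- T) = N T"
  using N_scaleR[of T "-1"] by simp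

lemma Metric_space_crit: "Metric_space G_crit (crit_dist \<theta> N)"
proof
  fix g h :: "'a triple"
  show "0 \<le> crit_dist \<theta> N g h" by (auto simp: crit_dist_def split: prod.splits)
  show "crit_dist \<theta> N g h = crit_dist \<theta> N h g"
  proof (cases "g \<in> G_crit \<and> h \<in> G_crit")
    case True
    obtain x A Q where g: "g = (x, A, Q)" "A \<in> weak_ideal0" "Q \<in> trace_class" using True by (auto elim: G_critE)
    obtain y B R where h: "h = (y, B, R)" "B \<in> weak_ideal0" "R \<in> trace_class" using True by (auto elim: G_critE)
    show ?thesis using True N_minus[OF weak_ideal0_diff[OF g(2) h(2)]]
        trace_class_minus(2)[OF trace_class_diff[OF g(3) h(3)]]
      unfolding g(1) h(1) by (simp add: crit_dist_eq norm_minus_commute)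
  qed (auto simp: crit_dist_def)
next
  fix g h :: "'a triple" assume gh: "g \<in> G_crit" "h \<in> G_crit"
  obtain x A Q where g: "g = (x, A, Q)" "A \<in> weak_ideal0" "Q \<in> trace_class" using gh(1) by (rule G_critE)
  obtain y B R where h: "h = (y, B, R)" "B \<in> weak_ideal0" "R \<in> trace_class" using gh(2) by (rule G_critE)
  show "crit_dist \<theta> N g h = 0 \<longleftrightarrow> g = h"
    using gh N_eq_0[OF weak_ideal0_diff[OF g(2) h(2)]] trace_norm_eq_0[OF trace_class_diff[OF g(3) h(3)]]
    unfolding g(1) h(1) by (simp add: crit_dist_eq add_nonneg_eq_0_iff)
next
  fix g h k :: "'a triple" assume ghk: "g \<in> G_crit" "h \<in> G_crit" "k \<in> G_crit"
  obtain x A Q where g: "g = (x, A, Q)" "A \<in> weak_ideal0" "Q \<in> trace_class" using ghk(1) by (rule G_critE)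
  obtain y B R where h: "h = (y, B, R)" "B \<in> weak_ideal0" "R \<in> trace_class" using ghk(2) by (rule G_critE)
  obtain z C P where k: "k = (z, C, P)" "C \<in> weak_ideal0" "P \<in> trace_class" using ghk(3) by (rule G_critE)
  have "norm (x - z) powr \<theta> \<le> norm (x - y) powr \<theta> + norm (y - z) powr \<theta>"
  proof -
    have "norm (x - z) powr \<theta> \<le> (norm (x - y) + norm (y - z)) powr \<theta>"
      using norm_triangle_ineq[of "x - y" "y - z"] \<theta> by (intro powr_mono2) auto
    also have "\<dots> \<le> norm (x - y) powr \<theta> + norm (y - z) powr \<theta>" by (intro powr_subadditive \<theta>) auto
    finally show ?thesis .
  qed
  moreover have "N (A - C) powr \<theta> \<le> N (A - B) powr \<theta> + N (B - C) powr \<theta>"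
    using N_powr[OF weak_ideal0_diff[OF g(2) h(2)] weak_ideal0_diff[OF h(2) k(2)]] by simp
  moreover have "trace_norm (Q - P) powr \<theta> \<le> trace_norm (Q - R) powr \<theta> + trace_norm (R - P) powr \<theta>"
  proof -
    note QR = trace_class_diff[OF g(3) h(3)] and RP = trace_class_diff[OF h(3) k(3)]
      and QP = trace_class_diff[OF g(3) k(3)]
    have "trace_norm (Q - P) powr \<theta> \<le> (trace_norm (Q - R) + trace_norm (R - P)) powr \<theta>"
      using trace_norm_triangle(2)[OF QR RP] trace_norm_nonneg[OF QP] \<theta> by (intro powr_mono2) auto
    also have "\<dots> \<le> trace_norm (Q - R) powr \<theta> + trace_norm (R - P) powr \<theta>"
      by (intro powr_subadditive \<theta> trace_norm_nonneg QR RP)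
    finally show ?thesis .
  qed
  ultimately show "crit_dist \<theta> N g k \<le> crit_dist \<theta> N g h + crit_dist \<theta> N h k"
    using ghk unfolding g(1) h(1) k(1) by (simp add: crit_dist_eq)
qed

lemma powr_less_powr_iff: "0 \<le> t \<Longrightarrow> 0 \<le> u \<Longrightarrow> t powr \<theta> < u powr \<theta> \<longleftrightarrow> t < u"
  using \<theta>(1) powr_less_mono2[of \<theta> t u] powr_mono2[of \<theta> u t] by linarith

lemma crit_dist_if_gauge:
  assumes e: "0 < e"
  shows "\<exists>\<delta>>0. \<forall>g\<in>G_crit. \<forall>h\<in>G_crit. crit_gauge (g - h) < \<delta> \<longrightarrow> crit_dist \<theta> N g h < e"
proof -
  obtain C where C: "C > 0" "\<And>v. v \<in> weak_ideal0 \<Longrightarrow> N v \<le> C * weak_norm v"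
    using renorming unfolding power_subadditive_renorming_def equivalent_on_def by blast
  define u where "u = (e/3) powr (1/\<theta>)"
  have u: "0 < u" "u powr \<theta> = e/3" using e \<theta> by (simp_all add: u_def powr_powr)
  show ?thesis
  proof (intro exI[of _ "min u (u / C)"] conjI ballI impI)
    show "0 < min u (u / C)" using u C by simp
    fix g h :: "'a triple" assume gh: "g \<in> G_crit" "h \<in> G_crit" and lt: "crit_gauge (g - h) < min u (u / C)"
    obtain x A Q where g: "g = (x, A, Q)" "A \<in> weak_ideal0" "Q \<in> trace_class" using gh(1) by (rule G_critE)
    obtain y B R where h: "h = (y, B, R)" "B \<in> weak_ideal0" "R \<in> trace_class" using gh(2) by (rule G_critE)
    note W = weak_ideal0_diff[OF g(2) h(2)] and T = trace_class_diff[OF g(3) h(3)]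
    have "norm (x - y) < u" "weak_norm (A - B) < u / C" "trace_norm (Q - R) < u"
      using lt weak_norm_nonneg[OF W] trace_norm_nonneg[OF T] norm_ge_zero[of "x - y"]
      unfolding g h crit_gauge_diff by linarith+
    moreover from this(2) have "N (A - B) < u" using C(1) C(2)[OF W] by (simp add: field_simps)
    ultimately have "norm (x - y) powr \<theta> < e/3" "N (A - B) powr \<theta> < e/3" "trace_norm (Q - R) powr \<theta> < e/3"
      using u(1) N_nonneg[OF W] trace_norm_nonneg[OF T] by (simp_all add: powr_less_powr_iff flip: u(2))
    then show "crit_dist \<theta> N g h < e" using gh unfolding g h by (simp add: crit_dist_eq)
  qed
qed

lemma gauge_if_crit_dist:
  assumes e: "0 < e"
  shows "\<exists>\<delta>>0. \<forall>g\<in>G_crit. \<forall>h\<in>G_crit. crit_dist \<theta> N g h < \<delta> \<longrightarrow> crit_gauge (g - h) < e"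
proof -
  obtain c where c: "c > 0" "\<And>v. v \<in> weak_ideal0 \<Longrightarrow> c * weak_norm v \<le> N v"
    using renorming unfolding power_subadditive_renorming_def equivalent_on_def by blast
  define u where "u = min (e/3) (c * (e/3))"
  have u: "0 < u" using e c by (simp add: u_def)
  show ?thesis
  proof (intro exI[of _ "u powr \<theta>"] conjI ballI impI)
    show "0 < u powr \<theta>" using u by simp
    fix g h :: "'a triple" assume gh: "g \<in> G_crit" "h \<in> G_crit" and lt: "crit_dist \<theta> N g h < u powr \<theta>"
    obtain x A Q where g: "g = (x, A, Q)" "A \<in> weak_ideal0" "Q \<in> trace_class" using gh(1) by (rule G_critE)
    obtain y B R where h: "h = (y, B, R)" "B \<in> weak_ideal0" "R \<in> trace_class" using gh(2) by (rule G_critE)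
    note W = weak_ideal0_diff[OF g(2) h(2)] and T = trace_class_diff[OF g(3) h(3)]
    have "norm (x - y) powr \<theta> + N (A - B) powr \<theta> + trace_norm (Q - R) powr \<theta> < u powr \<theta>"
      using lt gh unfolding g h by (simp add: crit_dist_eq)
    then have "norm (x - y) powr \<theta> < u powr \<theta>" "N (A - B) powr \<theta> < u powr \<theta>" "trace_norm (Q - R) powr \<theta> < u powr \<theta>"
      using powr_ge_zero[of "norm (x - y)" \<theta>] powr_ge_zero[of "N (A - B)" \<theta>] powr_ge_zero[of "trace_norm (Q - R)" \<theta>]
      by linarith+
    then have *: "norm (x - y) < u" "N (A - B) < u" "trace_norm (Q - R) < u"
      using u N_nonneg[OF W] trace_norm_nonneg[OF T] by (simp_all add: powr_less_powr_iff)
    then have "c * weak_norm (A - B) < c * (e/3)" using c(2)[OF W] by (simp add: u_def)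
    then have "weak_norm (A - B) < e/3" using c(1) by simp
    then show "crit_gauge (g - h) < e" using * unfolding g h crit_gauge_diff u_def by linarith
  qed
qed

lemma mtopology_crit: "Metric_space.mtopology G_crit (crit_dist \<theta> N) = crit_topology"
  unfolding crit_topology_def
  by (rule gauge_metric_topology[OF Metric_space_crit crit_dist_if_gauge gauge_if_crit_dist])

lemma mcomplete_crit: "Metric_space.mcomplete G_crit (crit_dist \<theta> N)"
  by (rule gauge_metric_complete[OF Metric_space_crit crit_dist_if_gauge gauge_if_crit_dist gauge_complete_crit])

end

lemma renorming_half: "renorming (1/2) (\<lambda>T :: 'a::{real_inner, complete_space} \<Rightarrow>\<^sub>L 'a. (weak_root_norm T)\<^sup>2)"
  by standard (auto intro: power_subadditive_renorming_exists)

lemma topspace_crit [simp]: "topspace crit_topology = G_crit"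
  by (simp add: crit_topology_def)

text \<open>A gauge satisfying only a quasi-triangle inequality may have balls that are not open; a
  metric ball provides an open set inside.\<close>

lemma crit_ball_neighbourhood:
  fixes g :: "'a::{real_inner, complete_space} triple"
  assumes g: "g \<in> G_crit" and e: "0 < e"
  obtains U where "openin crit_topology U" "g \<in> U" "\<And>h. h \<in> U \<Longrightarrow> crit_gauge (h - g) < e"
proof -
  interpret r: renorming "1/2" "\<lambda>T :: 'a \<Rightarrow>\<^sub>L 'a. (weak_root_norm T)\<^sup>2" by (rule renorming_half)
  interpret Metric_space G_crit "crit_dist (1/2) (\<lambda>T :: 'a \<Rightarrow>\<^sub>L 'a. (weak_root_norm T)\<^sup>2)" by (rule r.Metric_space_crit)
  obtain \<delta> where \<delta>: "0 < \<delta>" "\<And>g h. g \<in> G_crit \<Longrightarrow> h \<in> G_crit \<Longrightarrow>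
      crit_dist (1/2) (\<lambda>T :: 'a \<Rightarrow>\<^sub>L 'a. (weak_root_norm T)\<^sup>2) g h < \<delta> \<Longrightarrow> crit_gauge (g - h) < e"
    using r.gauge_if_crit_dist[OF e] by blast
  show ?thesis
  proof (rule that[of "mball g \<delta>"])
    show "openin crit_topology (mball g \<delta>)" using openin_mball by (simp add: r.mtopology_crit)
    show "g \<in> mball g \<delta>" using g \<delta>(1) by simp
    fix h assume "h \<in> mball g \<delta>"
    then show "crit_gauge (h - g) < e" using \<delta>(2)[of h g] by (simp add: commute)
  qed
qed

section \<open>Wedges and density of finite rank triples\<close>

definition sym_op :: "'a::real_inner \<Rightarrow> 'a \<Rightarrow> 'a \<Rightarrow>\<^sub>L 'a" where
  "sym_op x y = tensor_op x y + tensor_op y x"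

lemma wedge_op_apply [simp]: "wedge_op x y w = (w \<bullet> y) *\<^sub>R x - (w \<bullet> x) *\<^sub>R y"
  by (simp add: wedge_op_def blinfun.diff_left)

lemma wedge_op_self [simp]: "wedge_op x x = 0"
  by (simp add: wedge_op_def)

lemma wedge_op_skew: "wedge_op x y \<in> skew"
  by (simp add: skew_def inner_diff_left inner_diff_right inner_commute)

lemma sym_op_selfadj: "sym_op x y \<in> selfadj"
  by (simp add: sym_op_def selfadj_def blinfun.add_left inner_add_left inner_add_right inner_commute)

lemma tensor_op_rank_le: "tensor_op x y \<in> rank_le 1"
  using rank_leI[of "\<lambda>_. x" "\<lambda>_. y" 1] by simp

lemma sym_op_rank_le: "sym_op x y \<in> rank_le 2"
  using rank_le_add[OF tensor_op_rank_le tensor_op_rank_le, of x y y x] by (simp add: sym_op_def numeral_2_eq_2)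

lemma wedge_op_rank_le: "wedge_op x y \<in> rank_le 2"
  using rank_le_add[OF tensor_op_rank_le tensor_op_rank_le, of x y "- y" x]
  by (simp add: wedge_op_def numeral_2_eq_2 tensor_op.minus_left)

lemma norm_wedge_op: "norm (wedge_op x y) \<le> 2 * norm x * norm y"
  using norm_triangle_ineq4[of "tensor_op x y" "tensor_op y x"] norm_tensor_op[of x y] norm_tensor_op[of y x]
  by (simp add: wedge_op_def mult.commute[of "norm y"])

lemma norm_sym_op: "norm (sym_op x y) \<le> 2 * norm x * norm y"
  using norm_triangle_ineq[of "tensor_op x y" "tensor_op y x"] norm_tensor_op[of x y] norm_tensor_op[of y x]
  by (simp add: sym_op_def mult.commute[of "norm y"])

interpretation wedge_op: bounded_bilinear wedge_op
  by standard (auto simp: wedge_op_def tensor_op.add_left tensor_op.add_right tensor_op.scaleR_left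
      tensor_op.scaleR_right scaleR_diff_right intro!: exI[of _ 2] order_trans[OF norm_wedge_op[unfolded wedge_op_def]])

interpretation sym_op: bounded_bilinear sym_op
  by standard (auto simp: sym_op_def tensor_op.add_left tensor_op.add_right tensor_op.scaleR_left
      tensor_op.scaleR_right scaleR_add_right intro!: exI[of _ 2] order_trans[OF norm_sym_op[unfolded sym_op_def]])

lemma wedge_op_weak_ideal0: "wedge_op x y \<in> (weak_ideal0 :: ('a::{real_inner, complete_space} \<Rightarrow>\<^sub>L 'a) set)"
  by (rule rank_le_weak_ideal0[OF wedge_op_rank_le])

lemma weak_norm_wedge_op: "weak_norm (wedge_op x y) \<le> 4 * norm x * norm y"
  for x y :: "'a::{real_inner, complete_space}"
  using rank_le_weak_norm[OF wedge_op_rank_le, of x y] norm_wedge_op[of x y] by simp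

lemma trace_norm_sym_op: "trace_norm (sym_op x y) \<le> 4 * norm x * norm y"
  for x y :: "'a::{real_inner, complete_space}"
  using rank_le_trace_class(2)[OF sym_op_rank_le, of x y] norm_sym_op[of x y] by simp

lemma sum_tensor_rank_le: "finite I \<Longrightarrow> (\<Sum>i\<in>I. tensor_op (f i) (g i)) \<in> rank_le (card I)"
proof (induction I rule: finite_induct)
  case (insert i I)
  then show ?case using rank_le_add[OF tensor_op_rank_le insert.IH, of "f i" "g i"] by simp
qed simp

text \<open>Induction on the number of summands: the old ones and the new one are each approximated up to
  \<open>e/4\<close>, which absorbs the constant \<open>2\<close> of the quasi-norm.\<close>

lemma bilinear_sum_approx:
  fixes b :: "'a::real_normed_vector \<Rightarrow> 'a \<Rightarrow> 'v::real_normed_vector"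
  assumes b: "bounded_bilinear b" and V: "subspace V" and bV: "\<And>u v. b u v \<in> V"
    and quasi: "\<And>s t. s \<in> V \<Longrightarrow> t \<in> V \<Longrightarrow> p (s + t) \<le> 2 * (p s + p t)"
    and bound: "\<And>u v. p (b u v) \<le> 4 * norm u * norm v"
    and dense: "\<And>u e. 0 < e \<Longrightarrow> \<exists>c\<in>C. norm (u - c) < e"
    and e: "0 < e"
  shows "\<exists>cs\<in>lists (C \<times> C). p ((\<Sum>i<n::nat. b (u i) (v i)) - (\<Sum>(c, d)\<leftarrow>cs. b c d)) < e"
  using e
proof (induction n arbitrary: e)
  case 0
  have "p 0 \<le> 0" using bound[of 0 0] by (simp add: bounded_bilinear.zero_left[OF b])
  then show ?case using 0 by (intro bexI[of _ "[]"]) auto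
next
  case (Suc n)
  have sumV: "(\<Sum>(c, d)\<leftarrow>cs. b c d) \<in> V" for cs
    by (induction cs) (auto intro: subspace_0[OF V] subspace_add[OF V] bV)
  have sumV': "(\<Sum>i<n. b (u i) (v i)) \<in> V" by (intro subspace_sum[OF V] bV)
  obtain cs where cs: "cs \<in> lists (C \<times> C)"
    "p ((\<Sum>i<n. b (u i) (v i)) - (\<Sum>(c, d)\<leftarrow>cs. b c d)) < e/4" using Suc.IH[of "e/4"] Suc.prems by auto
  define K where "K = norm (u n) + norm (v n) + 1"
  have K: "K > 0" by (simp add: K_def add_nonneg_pos)
  define \<delta> where "\<delta> = min 1 (e / (64 * K))"
  have \<delta>: "0 < \<delta>" "\<delta> \<le> 1" "\<delta> * K \<le> e/64" using Suc.prems K by (auto simp: \<delta>_def min_def field_simps)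
  obtain c where c: "c \<in> C" "norm (u n - c) < \<delta>" using dense[OF \<delta>(1)] by blast
  obtain d where d: "d \<in> C" "norm (v n - d) < \<delta>" using dense[OF \<delta>(1)] by blast
  have "norm c \<le> norm (u n) + norm (u n - c)" by norm
  then have nc: "norm c \<le> K" using c(2) \<delta>(2) norm_ge_zero[of "v n"] unfolding K_def by linarith
  have "p (b (u n) (v n) - b c d) = p (b (u n - c) (v n) + b c (v n - d))" 
    by (simp add: bounded_bilinear.diff_left[OF b] bounded_bilinear.diff_right[OF b])
  also have "\<dots> \<le> 2 * (p (b (u n - c) (v n)) + p (b c (v n - d)))" by (rule quasi[OF bV bV])
  also have "\<dots> \<le> 2 * (4 * norm (u n - c) * norm (v n) + 4 * norm c * norm (v n - d))"
    by (intro mult_left_mono add_mono bound) auto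
  also have "\<dots> \<le> 2 * (4 * \<delta> * K + 4 * K * \<delta>)"
    using c d nc \<delta>(1) K by (intro mult_left_mono add_mono mult_mono) (auto simp: K_def)
  also have "\<dots> = 16 * (\<delta> * K)" by (simp add: algebra_simps)
  also have "\<dots> \<le> e/4" using \<delta>(3) by simp
  finally have step: "p (b (u n) (v n) - b c d) \<le> e/4" .
  have "p ((\<Sum>i<Suc n. b (u i) (v i)) - (\<Sum>(c, d)\<leftarrow>(c, d) # cs. b c d))
      = p (((\<Sum>i<n. b (u i) (v i)) - (\<Sum>(c, d)\<leftarrow>cs. b c d)) + (b (u n) (v n) - b c d))"
    by (simp add: algebra_simps)
  also have "\<dots> \<le> 2 * (p ((\<Sum>i<n. b (u i) (v i)) - (\<Sum>(c, d)\<leftarrow>cs. b c d)) + p (b (u n) (v n) - b c d))"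
    by (intro quasi subspace_diff[OF V] sumV sumV' bV)
  also have "\<dots> < e" using step cs(2) by argo
  finally show ?case using cs(1) c(1) d(1) by (intro bexI[of _ "(c, d) # cs"]) auto
qed

text \<open>If \<open>F\<close> is close to the skew operator \<open>A\<close>, then so is \<open>(F - F\<^sup>*) / 2\<close>, because the adjoint does
  not increase the weak norm; applied to \<open>F = \<Sum> u\<^sub>i \<otimes> v\<^sub>i\<close> this gives a sum of wedges.\<close>

lemma skew_approx_wedges:
  fixes A :: "'a::{real_inner, complete_space} \<Rightarrow>\<^sub>L 'a"
  assumes A: "A \<in> weak_ideal0" "A \<in> skew" and e: "0 < e"
  obtains n and u v :: "nat \<Rightarrow> 'a" where "weak_norm (A - (\<Sum>i<n. wedge_op (u i) (v i))) < e"
proof -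
  obtain n F where F: "F \<in> rank_le n" and lt: "weak_norm (A - F) < e/2"
    by (rule weak_ideal0_rank_le_dense[OF A(1), of "e/2"]) (use e in auto)
  obtain u v where uv: "F = (\<Sum>i<n. tensor_op (u i) (v i))" using F by (rule rank_leE)
  have AF: "A - F \<in> weak_ideal0" by (intro weak_ideal0_diff A(1) rank_le_weak_ideal0[OF F])
  have "(1/2) *\<^sub>R (F - adj F) = (\<Sum>i<n. wedge_op ((1/2) *\<^sub>R u i) (v i))"
    by (simp add: uv adj_sum adj_tensor_op wedge_op_def tensor_op.scaleR_left tensor_op.scaleR_right
        sum_subtractf scaleR_sum_right scaleR_diff_right)
  then have "A - (\<Sum>i<n. wedge_op ((1/2) *\<^sub>R u i) (v i)) = (1/2) *\<^sub>R ((A - F) - adj (A - F))"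
    by (simp add: adj_minus adj_skew[OF A(2)] algebra_simps flip: scaleR_add_left) 
  also have "weak_norm \<dots> = 1/2 * weak_norm ((A - F) + - adj (A - F))"
    by (subst weak_norm_scaleR) (auto intro!: weak_ideal0_diff weak_ideal0_adj AF)
  also have "\<dots> \<le> 1/2 * (2 * (weak_norm (A - F) + weak_norm (- adj (A - F))))"
    by (intro mult_left_mono weak_norm_add weak_ideal0_minus weak_ideal0_adj AF) simp
  also have "\<dots> \<le> 2 * weak_norm (A - F)"
    using weak_ideal0_adj[OF AF] by (simp add: weak_norm_minus)
  also have "\<dots> < e" using lt by simp
  finally show ?thesis by (rule that)
qed

lemma selfadj_approx_syms:
  fixes Q :: "'a::{real_inner, complete_space} \<Rightarrow>\<^sub>L 'a"
  assumes Q: "Q \<in> trace_class" "Q \<in> selfadj" and e: "0 < e"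
  obtains n and u v :: "nat \<Rightarrow> 'a" where "trace_norm (Q - (\<Sum>i<n. sym_op (u i) (v i))) < e"
proof -
  obtain n F where F: "F \<in> rank_le n" and lt: "trace_norm (Q - F) < e"
    by (rule trace_class_rank_le_dense[OF Q(1) e])
  obtain u v where uv: "F = (\<Sum>i<n. tensor_op (u i) (v i))" using F by (rule rank_leE)
  have QF: "Q - F \<in> trace_class" by (intro trace_class_diff Q(1) rank_le_trace_class(1)[OF F])
  have "(1/2) *\<^sub>R (F + adj F) = (\<Sum>i<n. sym_op ((1/2) *\<^sub>R u i) (v i))"
    by (simp add: uv adj_sum adj_tensor_op sym_op_def tensor_op.scaleR_left tensor_op.scaleR_right
        sum.distrib scaleR_sum_right scaleR_add_right)
  then have "Q - (\<Sum>i<n. sym_op ((1/2) *\<^sub>R u i) (v i)) = (1/2) *\<^sub>R ((Q - F) + adj (Q - F))"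
    by (simp add: adj_minus adj_selfadj[OF Q(2)] algebra_simps flip: scaleR_add_left)
  also have "trace_norm \<dots> = 1/2 * trace_norm ((Q - F) + adj (Q - F))"
    by (subst trace_class_scaleR) (auto intro!: trace_norm_triangle trace_class_adj QF)
  also have "\<dots> \<le> 1/2 * (trace_norm (Q - F) + trace_norm (adj (Q - F)))"
    by (intro mult_left_mono trace_norm_triangle trace_class_adj QF) simp
  also have "\<dots> < e" using trace_class_adj(2)[OF QF] lt by simp
  finally show ?thesis by (rule that)
qed

text \<open>For countable dense \<open>C\<close> this is the countable dense subset of the critical group.\<close>

definition finite_triples :: "'a::real_inner set \<Rightarrow> 'a triple set" where
  "finite_triples C = (\<lambda>(x, us, vs). (x, \<Sum>(u, v)\<leftarrow>us. wedge_op u v, \<Sum>(u, v)\<leftarrow>vs. sym_op u v))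
     ` (C \<times> lists (C \<times> C) \<times> lists (C \<times> C))"

lemma countable_finite_triples: "countable C \<Longrightarrow> countable (finite_triples C)"
  unfolding finite_triples_def by (intro countable_image countable_SIGMA countable_lists) auto

lemma subspace_operators_on:
  assumes "subspace E" shows "subspace (operators_on E)"
  using assms by (auto simp: subspace_def operators_on_def blinfun.add_left blinfun.scaleR_left)

lemma operators_on_mono: "E \<subseteq> E' \<Longrightarrow> operators_on E \<subseteq> operators_on E'"
  unfolding operators_on_def by blast

lemma wedge_op_operators_on: "subspace E \<Longrightarrow> u \<in> E \<Longrightarrow> v \<in> E \<Longrightarrow> wedge_op u v \<in> operators_on E"
  by (auto simp: operators_on_def subspace_diff subspace_scale)

lemma sym_op_operators_on: "subspace E \<Longrightarrow> u \<in> E \<Longrightarrow> v \<in> E \<Longrightarrow> sym_op u v \<in> operators_on E"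
  by (auto simp: operators_on_def sym_op_def blinfun.add_left subspace_add subspace_scale)

lemma G_fin_iff:
  "(x, A, Q) \<in> G_fin \<longleftrightarrow> (\<exists>B. finite B \<and> x \<in> span B \<and> A \<in> operators_on (span B) \<and> A \<in> skew
     \<and> Q \<in> operators_on (span B) \<and> Q \<in> selfadj)"
  by (auto simp: G_fin_def G_fin_on_def)

lemma subspace_sum_list: "subspace V \<Longrightarrow> (\<And>x. x \<in> set xs \<Longrightarrow> f x \<in> V) \<Longrightarrow> (\<Sum>x\<leftarrow>xs. f x) \<in> V"
  by (induction xs) (auto intro: subspace_add subspace_0)

lemma finite_triples_subset_G_fin: "finite_triples C \<subseteq> G_fin"
proof
  fix g assume "g \<in> finite_triples C"
  then obtain x us vs where g: "g = (x, \<Sum>(u, v)\<leftarrow>us. wedge_op u v, \<Sum>(u, v)\<leftarrow>vs. sym_op u v)"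
    by (auto simp: finite_triples_def)
  define B where "B = insert x (fst ` set us \<union> snd ` set us \<union> fst ` set vs \<union> snd ` set vs)"
  have B: "finite B" by (simp add: B_def)
  note sub = subspace_span[of B]
  have mem: "x \<in> span B" "\<And>u v. (u, v) \<in> set us \<Longrightarrow> u \<in> span B \<and> v \<in> span B"
    "\<And>u v. (u, v) \<in> set vs \<Longrightarrow> u \<in> span B \<and> v \<in> span B"
    by (force simp: B_def intro: span_base)+
  have "(\<Sum>(u, v)\<leftarrow>us. wedge_op u v) \<in> operators_on (span B)"
    by (rule subspace_sum_list[OF subspace_operators_on[OF sub]]) (use mem in \<open>auto intro: wedge_op_operators_on[OF sub]\<close>)
  moreover have "(\<Sum>(u, v)\<leftarrow>us. wedge_op u v) \<in> skew"
    by (rule subspace_sum_list[OF subspace_skew]) (auto intro: wedge_op_skew)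
  moreover have "(\<Sum>(u, v)\<leftarrow>vs. sym_op u v) \<in> operators_on (span B)"
    by (rule subspace_sum_list[OF subspace_operators_on[OF sub]]) (use mem in \<open>auto intro: sym_op_operators_on[OF sub]\<close>)
  moreover have "(\<Sum>(u, v)\<leftarrow>vs. sym_op u v) \<in> selfadj"
    by (rule subspace_sum_list[OF subspace_selfadj]) (auto intro: sym_op_selfadj)
  ultimately show "g \<in> G_fin" using B mem(1) unfolding g G_fin_iff by blast
qed

text \<open>Expand \<open>T w\<close> in an orthogonal basis of the finite-dimensional range; its coefficients are inner
  products of \<open>w\<close> with the vectors \<open>T\<^sup>* c\<close>.\<close>

lemma operators_on_rank_le:
  fixes T :: "'a::{real_inner, complete_space} \<Rightarrow>\<^sub>L 'a"
  assumes "finite B" "T \<in> operators_on (span B)"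
  shows "\<exists>n. T \<in> rank_le n"
proof -
  obtain C where C: "finite C" "span C = span B" "pairwise orthogonal C"
    using basis_orthogonal[OF assms(1)] by blast
  have "T w = (\<Sum>c\<in>C. tensor_op c ((1 / (c \<bullet> c)) *\<^sub>R adj T c)) w" for w
  proof -
    define r where "r = T w - (\<Sum>c\<in>C. (c \<bullet> T w / (c \<bullet> c)) *\<^sub>R c)"
    have "T w \<in> span C" using assms(2) C(2) by (auto simp: operators_on_def)
    then have r: "r \<in> span C" unfolding r_def by (intro span_diff span_sum span_scale) (auto intro: span_base)
    have "orthogonal r c" if "c \<in> C" for c
    proof -
      have "(\<Sum>b\<in>C. (b \<bullet> T w / (b \<bullet> b)) *\<^sub>R b) \<bullet> c
          = (\<Sum>b\<in>C. if b = c then c \<bullet> T w else 0)"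
        unfolding inner_sum_left using C(3) that
        by (intro sum.cong) (auto simp: pairwise_def orthogonal_def)
      then show ?thesis using C(1) that by (simp add: orthogonal_def r_def inner_diff_left inner_commute[of "T w" c])
    qed
    then have "orthogonal r r" by (rule orthogonal_to_span[OF r])
    then have "r = 0" by (simp add: orthogonal_def)
    then have "T w = (\<Sum>c\<in>C. (c \<bullet> T w / (c \<bullet> c)) *\<^sub>R c)" by (simp add: r_def)
    also have "\<dots> = (\<Sum>c\<in>C. tensor_op c ((1 / (c \<bullet> c)) *\<^sub>R adj T c)) w"
      by (simp add: blinfun.sum_left adj_inner inner_commute)
    finally show ?thesis .
  qed
  then have "T = (\<Sum>c\<in>C. tensor_op c ((1 / (c \<bullet> c)) *\<^sub>R adj T c))" by (rule blinfun_eqI)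
  moreover have "(\<Sum>c\<in>C. tensor_op c ((1 / (c \<bullet> c)) *\<^sub>R adj T c)) \<in> rank_le (card C)"
    by (rule sum_tensor_rank_le[OF C(1)])
  ultimately have "T \<in> rank_le (card C)" by (rule ssubst)
  then show ?thesis ..
qed

lemma G_fin_subset_G_crit: "G_fin \<subseteq> (G_crit :: 'a::{real_inner, complete_space} triple set)"
proof
  fix g :: "'a triple" assume g: "g \<in> G_fin"
  obtain x A Q where eq: "g = (x, A, Q)" by (cases g)
  obtain B where B: "finite B" "A \<in> operators_on (span B)" "A \<in> skew" "Q \<in> operators_on (span B)" "Q \<in> selfadj"
    using g unfolding eq G_fin_iff by blast
  obtain m n where "A \<in> rank_le m" "Q \<in> rank_le n" using operators_on_rank_le B by meson
  then show "g \<in> G_crit" unfolding eq G_crit_iff using B rank_le_weak_ideal0 rank_le_trace_class(1) by blast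
qed

lemma finite_triples_dense:
  fixes g :: "'a::{real_inner, complete_space} triple"
  assumes dense: "\<And>(u::'a) e. 0 < e \<Longrightarrow> \<exists>c\<in>C. norm (u - c) < e"
    and g: "g \<in> G_crit" and e: "0 < e"
  shows "\<exists>h\<in>finite_triples C. crit_gauge (h - g) < e"
proof -
  obtain x A Q where eq: "g = (x, A, Q)" by (cases g)
  have A: "A \<in> weak_ideal0" "A \<in> skew" and Q: "Q \<in> trace_class" "Q \<in> selfadj" using g by (auto simp: eq G_crit_iff)
  have e': "0 < e/12" "0 < e/6" "0 < e/3" using e by auto
  obtain y where y: "y \<in> C" "norm (x - y) < e/3" using dense[OF e'(3)] by blast
  obtain n :: nat and u v where 1: "weak_norm (A - (\<Sum>i<n. wedge_op (u i) (v i))) < e/12"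
    by (rule skew_approx_wedges[OF A e'(1)])
  obtain us where us: "us \<in> lists (C \<times> C)"
    and 2: "weak_norm ((\<Sum>i<n. wedge_op (u i) (v i)) - (\<Sum>(c, d)\<leftarrow>us. wedge_op c d)) < e/12"
    using bilinear_sum_approx[where b = wedge_op and p = weak_norm and V = weak_ideal0 and C = C,
        OF wedge_op.bounded_bilinear_axioms subspace_weak_ideal0 wedge_op_weak_ideal0 weak_norm_add
          weak_norm_wedge_op dense e'(1)] by blast
  obtain m :: nat and a b where 3: "trace_norm (Q - (\<Sum>i<m. sym_op (a i) (b i))) < e/6"
    by (rule selfadj_approx_syms[OF Q e'(2)])
  have trace_quasi: "trace_norm (S + T) \<le> 2 * (trace_norm S + trace_norm T)"
    if "S \<in> trace_class" "T \<in> trace_class" for S T :: "'a \<Rightarrow>\<^sub>L 'a"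
    using trace_norm_triangle(2)[OF that] trace_norm_nonneg[OF that(1)] trace_norm_nonneg[OF that(2)] by argo
  obtain vs where vs: "vs \<in> lists (C \<times> C)"
    and 4: "trace_norm ((\<Sum>i<m. sym_op (a i) (b i)) - (\<Sum>(c, d)\<leftarrow>vs. sym_op c d)) < e/6"
    using bilinear_sum_approx[where b = sym_op and p = trace_norm and V = trace_class and C = C,
        OF sym_op.bounded_bilinear_axioms subspace_trace_class rank_le_trace_class(1)[OF sym_op_rank_le]
          trace_quasi trace_norm_sym_op dense e'(2)] by blast
  define W where "W = (\<Sum>(c, d)\<leftarrow>us. wedge_op c d)"
  define P where "P = (\<Sum>(c, d)\<leftarrow>vs. sym_op c d)"
  define W' where "W' = (\<Sum>i<n. wedge_op (u i) (v i))"
  define P' where "P' = (\<Sum>i<m. sym_op (a i) (b i))"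
  have h: "(y, W, P) \<in> finite_triples C" using y us vs 
    unfolding finite_triples_def W_def P_def by (intro image_eqI[of _ _ "(y, us, vs)"]) auto
  have WP: "W \<in> weak_ideal0" "P \<in> trace_class" 

  proof -
    have "(y, W, P) \<in> G_crit" using h finite_triples_subset_G_fin G_fin_subset_G_crit by blast
    then show "W \<in> weak_ideal0" "P \<in> trace_class" by (simp_all add: G_crit_iff)
  qed
  have W': "W' \<in> weak_ideal0" unfolding W'_def by (intro subspace_sum[OF subspace_weak_ideal0] wedge_op_weak_ideal0)
  have P': "P' \<in> trace_class" unfolding P'_def
    by (intro subspace_sum[OF subspace_trace_class] rank_le_trace_class(1)[OF sym_op_rank_le])
  have "weak_norm (A - W) \<le> 2 * (weak_norm (A - W') + weak_norm (W' - W))"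
    using weak_norm_add[OF weak_ideal0_diff[OF A(1) W'] weak_ideal0_diff[OF W' WP(1)]] by simp
  moreover have "weak_norm (W - A) = weak_norm (A - W)"
    using weak_norm_minus[OF weak_ideal0_diff[OF A(1) WP(1)]] by simp
  ultimately have w: "weak_norm (W - A) < e/3" using 1 2 by (simp add: W_def W'_def)
  have "trace_norm (Q - P) \<le> trace_norm (Q - P') + trace_norm (P' - P)"
    using trace_norm_triangle(2)[OF trace_class_diff[OF Q(1) P'] trace_class_diff[OF P' WP(2)]] by simp
  moreover have "trace_norm (P - Q) = trace_norm (Q - P)"
    using trace_class_minus(2)[OF trace_class_diff[OF Q(1) WP(2)]] by simp
  ultimately have "trace_norm (P - Q) < e/3" using 3 4 by (simp add: P_def P'_def)
  then have "crit_gauge ((y, W, P) - g) < e"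
    using w y(2) unfolding eq crit_gauge_diff by (simp add: norm_minus_commute)
  then show ?thesis using h by blast
qed

proposition is_completion_crit: "is_completion G_fin G_crit (crit_gauge :: 'a::{real_inner, complete_space} triple \<Rightarrow> real)"
proof -
  have "\<exists>h\<in>G_fin. crit_gauge (h - g) < e" if "g \<in> G_crit" "0 < e" for g :: "'a triple" and e
    using finite_triples_dense[of UNIV g e] that finite_triples_subset_G_fin[of UNIV]
    by (metis UNIV_I cancel_comm_monoid_add_class.diff_cancel norm_zero subsetD)
  then show ?thesis
    unfolding is_completion_def using G_fin_subset_G_crit quasi_gauge_crit gauge_complete_crit by blast
qed

proposition separable_crit: "separable_space (crit_topology :: 'a::{real_inner, polish_space} triple topology)"
proof -
  obtain C :: "'a set" where C: "countable C" "\<And>X. open X \<Longrightarrow> X \<noteq> {} \<Longrightarrow> \<exists>d\<in>C. d \<in> X"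
    using countable_dense_exists by blast
  have dense: "\<exists>c\<in>C. norm (u - c) < e" if "0 < e" for u :: 'a and e
    using C(2)[of "ball u e"] that by (auto simp: dist_norm)
  have sub: "finite_triples C \<subseteq> G_crit" using finite_triples_subset_G_fin G_fin_subset_G_crit by blast
  have "crit_topology closure_of finite_triples C = G_crit"
  proof (intro equalityI subsetI)
    fix g assume "g \<in> crit_topology closure_of finite_triples C"
    then show "g \<in> G_crit" by (simp add: in_closure_of)
  next
    fix g :: "'a triple" assume g: "g \<in> G_crit"
    have hit: "\<exists>h\<in>finite_triples C. h \<in> U" if U: "openin crit_topology U" "g \<in> U" for U
    proof -
      obtain e where e: "e > 0" "\<forall>h\<in>G_crit. crit_gauge (h - g) < e \<longrightarrow> h \<in> U"
        using U unfolding crit_topology_def openin_gauge_topology by blast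
      then show ?thesis using finite_triples_dense[OF dense g e(1)] sub by blast
    qed
    show "g \<in> crit_topology closure_of finite_triples C"
      using g hit unfolding in_closure_of topspace_crit by blast
  qed
  then show ?thesis
    unfolding separable_space_def using countable_finite_triples[OF C(1)] sub by (intro exI[of _ "finite_triples C"]) simp
qed

section \<open>The topological group\<close>

lemma crit_group_simps [simp]:
  "carrier crit_group = G_crit" "mult crit_group = crit_mult" "one crit_group = (0, 0, 0)"
  by (simp_all add: crit_group_def)

lemma crit_one_in: "(0, 0, 0) \<in> (G_crit :: 'a::{real_inner, complete_space} triple set)"
  by (simp add: G_crit_iff subspace_0[OF subspace_skew] subspace_0[OF subspace_selfadj])

lemma crit_mult_in:
  fixes g h :: "'a::{real_inner, complete_space} triple"
  assumes "g \<in> G_crit" "h \<in> G_crit"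
  shows "crit_mult g h \<in> G_crit"
proof -
  obtain x A Q y B R where "g = (x, A, Q)" "h = (y, B, R)" by (metis prod_cases3)
  then show ?thesis using assms
    by (simp add: G_crit_iff weak_ideal0_add weak_ideal0_scaleR wedge_op_weak_ideal0 trace_norm_triangle
        subspace_add[OF subspace_skew] subspace_scale[OF subspace_skew] wedge_op_skew
        subspace_add[OF subspace_selfadj])
qed

lemma crit_uminus_in:
  "(x, A, Q) \<in> G_crit \<Longrightarrow> (- x, - A, - Q) \<in> G_crit"
  for x :: "'a::{real_inner, complete_space}"
  by (simp add: G_crit_iff weak_ideal0_minus trace_class_minus subspace_neg[OF subspace_skew]
      subspace_neg[OF subspace_selfadj])

lemma group_crit: "group (crit_group :: 'a::{real_inner, complete_space} triple monoid)"
proof (rule groupI; unfold crit_group_simps)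
  fix g h k :: "'a triple"
  obtain x A Q y B R z C P where g: "g = (x, A, Q)" and hk: "h = (y, B, R)" "k = (z, C, P)" by (metis prod_cases3)
  show "crit_mult (crit_mult g h) k = crit_mult g (crit_mult h k)"
    by (simp add: g hk wedge_op.add_left wedge_op.add_right scaleR_add_right)
  show "crit_mult (0, 0, 0) g = g" by (simp add: g wedge_op.zero_left)
  assume "g \<in> G_crit"
  then show "\<exists>h\<in>G_crit. crit_mult h g = (0, 0, 0)"
    by (intro bexI[of _ "(- x, - A, - Q)"]) (auto simp: g wedge_op.minus_left crit_uminus_in)
qed (auto simp: crit_mult_in crit_one_in)

lemma inv_crit:
  assumes "(x, A, Q) \<in> (G_crit :: 'a::{real_inner, complete_space} triple set)"
  shows "inv\<^bsub>crit_group\<^esub> (x, A, Q) = (- x, - A, - Q)"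
  by (rule group.inv_equality[OF group_crit]) (use assms in \<open>auto simp: wedge_op.minus_left crit_uminus_in\<close>)

lemma subgroup_G_fin: "subgroup G_fin (crit_group :: 'a::{real_inner, complete_space} triple monoid)"
proof (rule subgroup.intro)
  show "G_fin \<subseteq> carrier (crit_group :: 'a triple monoid)" by (simp add: G_fin_subset_G_crit)
  show "\<one>\<^bsub>crit_group\<^esub> \<in> (G_fin :: 'a triple set)"
    unfolding crit_group_simps G_fin_iff by (intro exI[of _ "{}"])
      (auto intro: subspace_0 subspace_operators_on subspace_skew subspace_selfadj subspace_single_0)
next
  fix g h :: "'a triple" assume gh: "g \<in> G_fin" "h \<in> G_fin"
  obtain x A Q y B R where g: "g = (x, A, Q)" and h: "h = (y, B, R)" by (metis prod_cases3)
  obtain E where E: "finite E" "x \<in> span E" "A \<in> operators_on (span E)" "A \<in> skew"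
      "Q \<in> operators_on (span E)" "Q \<in> selfadj"
    using gh(1) unfolding g G_fin_iff by blast
  obtain F where F: "finite F" "y \<in> span F" "B \<in> operators_on (span F)" "B \<in> skew"
      "R \<in> operators_on (span F)" "R \<in> selfadj"
    using gh(2) unfolding h G_fin_iff by blast
  have EF: "span E \<subseteq> span (E \<union> F)" "span F \<subseteq> span (E \<union> F)" by (rule span_mono, blast)+
  note sub = subspace_operators_on[OF subspace_span[of "E \<union> F"]]
  have "x \<in> span (E \<union> F)" "y \<in> span (E \<union> F)" "A \<in> operators_on (span (E \<union> F))" "B \<in> operators_on (span (E \<union> F))"
      "Q \<in> operators_on (span (E \<union> F))" "R \<in> operators_on (span (E \<union> F))"
    using E F EF operators_on_mono[OF EF(1)] operators_on_mono[OF EF(2)] by auto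
  then show "g \<otimes>\<^bsub>crit_group\<^esub> h \<in> G_fin"
    unfolding g h crit_group_simps crit_mult.simps G_fin_iff using E F
    by (intro exI[of _ "E \<union> F"] conjI)
      (auto intro!: span_add subspace_add[OF sub] subspace_scale[OF sub] wedge_op_operators_on
        subspace_add[OF subspace_skew] subspace_scale[OF subspace_skew] wedge_op_skew
        subspace_add[OF subspace_selfadj])
next
  fix g :: "'a triple" assume g0: "g \<in> G_fin"
  obtain x A Q where g: "g = (x, A, Q)" by (metis prod_cases3)
  obtain E where E: "finite E" "x \<in> span E" "A \<in> operators_on (span E)" "A \<in> skew"
      "Q \<in> operators_on (span E)" "Q \<in> selfadj"
    using g0 unfolding g G_fin_iff by blast
  have "(- x, - A, - Q) \<in> G_fin"
    unfolding G_fin_iff using E by (intro exI[of _ E])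
      (auto intro: span_neg subspace_neg[OF subspace_operators_on[OF subspace_span]]
        subspace_neg[OF subspace_skew] subspace_neg[OF subspace_selfadj])
  then show "inv\<^bsub>crit_group\<^esub> g \<in> G_fin"
    using inv_crit[of x A Q] g0 G_fin_subset_G_crit unfolding g by auto
qed

lemma weak_norm_wedge_op_diff:
  fixes x y :: "'a::{real_inner, complete_space}"
  shows "weak_norm (wedge_op x' y' - wedge_op x y) \<le> 8 * (norm (x' - x) * norm y' + norm x * norm (y' - y))"
proof -
  have "wedge_op x' y' - wedge_op x y = wedge_op (x' - x) y' + wedge_op x (y' - y)"
    by (simp add: wedge_op.diff_left wedge_op.diff_right)
  then have "weak_norm (wedge_op x' y' - wedge_op x y)
      \<le> 2 * (weak_norm (wedge_op (x' - x) y') + weak_norm (wedge_op x (y' - y)))"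
    using weak_norm_add[OF wedge_op_weak_ideal0 wedge_op_weak_ideal0] by metis
  also have "\<dots> \<le> 2 * (4 * norm (x' - x) * norm y' + 4 * norm x * norm (y' - y))"
    by (intro mult_left_mono add_mono weak_norm_wedge_op) simp
  finally show ?thesis by (simp add: algebra_simps)
qed

lemma crit_gauge_parts:
  fixes x :: "'a::{real_inner, complete_space}"
  assumes "(x, A, Q) \<in> G_crit" "(y, B, R) \<in> G_crit"
  shows "norm (x - y) \<le> crit_gauge ((x, A, Q) - (y, B, R))"
    "weak_norm (A - B) \<le> crit_gauge ((x, A, Q) - (y, B, R))"
    "trace_norm (Q - R) \<le> crit_gauge ((x, A, Q) - (y, B, R))"
  using assms weak_norm_nonneg[of "A - B"] trace_norm_nonneg[of "Q - R"] norm_ge_zero[of "x - y"]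
  by (auto simp: G_crit_iff weak_ideal0_diff trace_class_diff)

text \<open>With \<open>w = x' \<and> y' - x \<and> y\<close>, two uses of the quasi-triangle inequality bound the middle
  coordinate by \<open>2 (\<delta> + 2 (\<delta> + \<parallel>w\<parallel> / 2))\<close>, where \<open>\<parallel>w\<parallel> \<le> 8 \<delta> (\<parallel>x\<parallel> + \<parallel>y\<parallel> + 1)\<close>; the two other coordinates
  contribute \<open>2 \<delta>\<close> each.\<close>

lemma crit_mult_close:
  fixes x y :: "'a::{real_inner, complete_space}"
  assumes G: "(x, A, Q) \<in> G_crit" "(y, B, R) \<in> G_crit" "(x', A', Q') \<in> G_crit" "(y', B', R') \<in> G_crit"
    and d: "crit_gauge ((x', A', Q') - (x, A, Q)) < \<delta>" "crit_gauge ((y', B', R') - (y, B, R)) < \<delta>" "\<delta> \<le> 1"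
  shows "crit_gauge (crit_mult (x', A', Q') (y', B', R') - crit_mult (x, A, Q) (y, B, R))
    \<le> \<delta> * (26 + 16 * (norm x + norm y))"
proof -
  have I: "A \<in> weak_ideal0" "B \<in> weak_ideal0" "A' \<in> weak_ideal0" "B' \<in> weak_ideal0"
    "Q \<in> trace_class" "R \<in> trace_class" "Q' \<in> trace_class" "R' \<in> trace_class"
    using G by (auto simp: G_crit_iff)
  have x: "norm (x' - x) \<le> \<delta>" "weak_norm (A' - A) \<le> \<delta>" "trace_norm (Q' - Q) \<le> \<delta>"
    using crit_gauge_parts[OF G(3) G(1)] d(1) by linarith+
  have y: "norm (y' - y) \<le> \<delta>" "weak_norm (B' - B) \<le> \<delta>" "trace_norm (R' - R) \<le> \<delta>"
    using crit_gauge_parts[OF G(4) G(2)] d(2) by linarith+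
  have \<delta>: "0 \<le> \<delta>" using x(1) norm_ge_zero order_trans by blast
  have ny': "norm y' \<le> norm y + 1" using norm_triangle_ineq2[of y' y] y(1) d(3) by linarith
  define w where "w = wedge_op x' y' - wedge_op x y"
  have wI: "w \<in> weak_ideal0" unfolding w_def by (intro weak_ideal0_diff wedge_op_weak_ideal0)
  have "weak_norm w \<le> 8 * (norm (x' - x) * norm y' + norm x * norm (y' - y))"
    unfolding w_def by (rule weak_norm_wedge_op_diff)
  also have "\<dots> \<le> 8 * (\<delta> * (norm y + 1) + norm x * \<delta>)"
    using x(1) y(1) ny' \<delta> by (intro mult_left_mono add_mono mult_mono) auto
  finally have w: "weak_norm w \<le> 8 * (\<delta> * (norm x + norm y + 1))" by (simp add: algebra_simps)
  have n: "norm (x' + y' - (x + y)) \<le> 2 * \<delta>"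
    using norm_triangle_ineq[of "x' - x" "y' - y"] x(1) y(1) by (simp add: algebra_simps)
  have t: "trace_norm (Q' + R' - (Q + R)) \<le> 2 * \<delta>"
    using trace_norm_triangle(2)[OF trace_class_diff[OF I(7) I(5)] trace_class_diff[OF I(8) I(6)]] x(3) y(3)
    by (simp add: algebra_simps)
  have half: "weak_norm ((1/2) *\<^sub>R w) = 1/2 * weak_norm w" by (simp add: weak_norm_scaleR wI)
  have "weak_norm ((A' - A) + ((B' - B) + (1/2) *\<^sub>R w))
      \<le> 2 * (weak_norm (A' - A) + weak_norm ((B' - B) + (1/2) *\<^sub>R w))"
    by (intro weak_norm_add weak_ideal0_add weak_ideal0_diff weak_ideal0_scaleR I wI)
  also have "\<dots> \<le> 2 * (\<delta> + 2 * (\<delta> + 1/2 * weak_norm w))"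
    using weak_norm_add[OF weak_ideal0_diff[OF I(4) I(2)] weak_ideal0_scaleR[OF wI, of "1/2"]] x(2) y(2) half
    by argo
  also have "(A' - A) + ((B' - B) + (1/2) *\<^sub>R w)
      = A' + B' + (1/2) *\<^sub>R wedge_op x' y' - (A + B + (1/2) *\<^sub>R wedge_op x y)"
    by (simp add: w_def algebra_simps)
  finally have a: "weak_norm (A' + B' + (1/2) *\<^sub>R wedge_op x' y' - (A + B + (1/2) *\<^sub>R wedge_op x y))
      \<le> 2 * (\<delta> + 2 * (\<delta> + 1/2 * (8 * (\<delta> * (norm x + norm y + 1)))))"
    using w by argo
  have "\<delta> * (26 + 16 * (norm x + norm y)) = 2 * \<delta> + 2 * (\<delta> + 2 * (\<delta> + 1/2 * (8 * (\<delta> * (norm x + norm y + 1))))) + 2 * \<delta>"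
    by (simp add: algebra_simps)
  then show ?thesis unfolding crit_mult.simps crit_gauge_diff using n t a by argo
qed

lemma crit_topology_nbhd:
  assumes "openin crit_topology U" "g \<in> U"
  obtains e where "0 < e" "\<And>h. h \<in> G_crit \<Longrightarrow> crit_gauge (h - g) < e \<Longrightarrow> h \<in> U"
  using assms unfolding crit_topology_def openin_gauge_topology by blast

lemma continuous_crit_mult:
  "continuous_map (prod_topology crit_topology crit_topology) crit_topology
     (\<lambda>(g, h). crit_mult g (h :: 'a::{real_inner, complete_space} triple))"
  unfolding continuous_map_def
proof (intro conjI allI impI)
  show "(\<lambda>(g, h). crit_mult g (h :: 'a triple))
      \<in> topspace (prod_topology crit_topology crit_topology) \<rightarrow> topspace crit_topology"
    by (auto intro: crit_mult_in simp del: crit_mult.simps)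
next
  fix U :: "'a triple set" assume U: "openin crit_topology U"
  let ?S = "{p \<in> topspace (prod_topology crit_topology crit_topology). (case p of (g, h) \<Rightarrow> crit_mult g h) \<in> U}"
  show "openin (prod_topology crit_topology crit_topology) ?S"
    unfolding openin_prod_topology_alt
  proof (intro allI impI)
    fix g h :: "'a triple" assume "(g, h) \<in> ?S"
    then have gh: "g \<in> G_crit" "h \<in> G_crit" "crit_mult g h \<in> U" by auto
    obtain e where e: "0 < e" "\<And>k. k \<in> G_crit \<Longrightarrow> crit_gauge (k - crit_mult g h) < e \<Longrightarrow> k \<in> U"
      using crit_topology_nbhd[OF U gh(3)] by blast
    obtain x A Q y B R where g: "g = (x, A, Q)" and h: "h = (y, B, R)" by (metis prod_cases3)
    define K where "K = 26 + 16 * (norm x + norm y)"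
    have K: "0 < K" by (simp add: K_def add_pos_nonneg)
    define \<delta> where "\<delta> = min 1 (e / (2 * K))"
    have \<delta>: "0 < \<delta>" "\<delta> \<le> 1" using e(1) K by (auto simp: \<delta>_def)
    have "\<delta> * K \<le> e / (2 * K) * K" using K by (intro mult_right_mono) (auto simp: \<delta>_def)
    then have \<delta>K: "\<delta> * K < e" using e(1) K by simp
    obtain V where V: "openin crit_topology V" "g \<in> V" "\<And>k. k \<in> V \<Longrightarrow> crit_gauge (k - g) < \<delta>"
      using crit_ball_neighbourhood[OF gh(1) \<delta>(1)] by blast
    obtain W where W: "openin crit_topology W" "h \<in> W" "\<And>k. k \<in> W \<Longrightarrow> crit_gauge (k - h) < \<delta>"
      using crit_ball_neighbourhood[OF gh(2) \<delta>(1)] by blast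
    have sub: "V \<subseteq> G_crit" "W \<subseteq> G_crit" using V(1) W(1) openin_subset by fastforce+
    have "crit_mult g' h' \<in> U" if "g' \<in> V" "h' \<in> W" for g' h'
    proof (rule e(2))
      have G: "g' \<in> G_crit" "h' \<in> G_crit" using that sub by auto
      then show "crit_mult g' h' \<in> G_crit" by (rule crit_mult_in)
      obtain x' A' Q' y' B' R' where g': "g' = (x', A', Q')" and h': "h' = (y', B', R')" by (metis prod_cases3)
      have "crit_gauge (crit_mult g' h' - crit_mult g h) \<le> \<delta> * K"
        unfolding K_def g h g' h'
        by (rule crit_mult_close) (use gh G V(3)[OF that(1)] W(3)[OF that(2)] \<delta>(2) in \<open>simp_all add: g h g' h'\<close>)
      then show "crit_gauge (crit_mult g' h' - crit_mult g h) < e" using \<delta>K by linarith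
    qed
    then show "\<exists>V W. openin crit_topology V \<and> openin crit_topology W \<and> g \<in> V \<and> h \<in> W \<and> V \<times> W \<subseteq> ?S"
      using V W sub by (intro exI[of _ V] exI[of _ W]) auto
  qed
qed

lemma continuous_map_crit_coordinatewise:
  fixes f :: "'a::{real_inner, complete_space} \<Rightarrow> 'b::{real_inner, complete_space}"
  assumes F: "\<And>x A Q. F (x, A, Q) = (f x, \<Phi> A, \<Psi> Q)" and F_in: "\<And>g. g \<in> G_crit \<Longrightarrow> F g \<in> G_crit"
    and diff: "\<And>x y. f y - f x = f (y - x)" "\<And>A B. \<Phi> B - \<Phi> A = \<Phi> (B - A)" "\<And>Q R. \<Psi> R - \<Psi> Q = \<Psi> (R - Q)"
    and bound: "\<And>x. norm (f x) \<le> c * norm x"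
      "\<And>A. A \<in> weak_ideal0 \<Longrightarrow> weak_norm (\<Phi> A) \<le> c * weak_norm A"
      "\<And>Q. Q \<in> trace_class \<Longrightarrow> trace_norm (\<Psi> Q) \<le> c * trace_norm Q"
    and c: "0 \<le> c"
  shows "continuous_map crit_topology crit_topology F"
  unfolding crit_topology_def
proof (rule continuous_map_gauge)
  show "F \<in> G_crit \<rightarrow> G_crit" using F_in by blast
  fix g :: "'a triple" and e :: real assume g: "g \<in> G_crit" and e: "0 < e"
  show "\<exists>\<delta>>0. \<forall>h\<in>G_crit. crit_gauge (h - g) < \<delta> \<longrightarrow> crit_gauge (F h - F g) < e"
  proof (intro exI[of _ "e / (c + 1)"] conjI ballI impI)
    show "0 < e / (c + 1)" using e c by simp
    fix h :: "'a triple" assume h: "h \<in> G_crit" and lt: "crit_gauge (h - g) < e / (c + 1)"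
    obtain x A Q where x: "g = (x, A, Q)" "A \<in> weak_ideal0" "Q \<in> trace_class" using g by (rule G_critE)
    obtain y B R where y: "h = (y, B, R)" "B \<in> weak_ideal0" "R \<in> trace_class" using h by (rule G_critE)
    have "crit_gauge (F h - F g) \<le> c * crit_gauge (h - g)"
      unfolding x(1) y(1) F crit_gauge_diff diff distrib_left
      by (intro add_mono bound weak_ideal0_diff trace_class_diff x y)
    also have "\<dots> \<le> (c + 1) * crit_gauge (h - g)"
      using crit_gauge_basic[OF h g] by (simp add: algebra_simps)
    also have "\<dots> < e" using lt c by (simp add: field_simps)
    finally show "crit_gauge (F h - F g) < e" .
  qed
qed

lemma pushforward_in:
  fixes L :: "'a::{real_inner, complete_space} \<Rightarrow>\<^sub>L 'b::{real_inner, complete_space}"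
  assumes g: "g \<in> G_crit" shows "pushforward L g \<in> G_crit"
proof -
  obtain x A Q where eq: "g = (x, A, Q)" by (metis prod_cases3)
  have left: "(L o\<^sub>L T o\<^sub>L adj L) v \<bullet> w = T (adj L v) \<bullet> adj L w"
    and right: "v \<bullet> (L o\<^sub>L T o\<^sub>L adj L) w = adj L v \<bullet> T (adj L w)" for T v w
    using adj_inner[of "T (adj L v)" L w] adj_inner'[of L v "T (adj L w)"] by simp_all
  have A: "A \<in> weak_ideal0" "A \<in> skew" and Q: "Q \<in> trace_class" "Q \<in> selfadj"
    using g by (auto simp: eq G_crit_iff)
  have "L o\<^sub>L A o\<^sub>L adj L \<in> skew" using A(2) unfolding skew_def mem_Collect_eq left right by blast
  moreover have "L o\<^sub>L Q o\<^sub>L adj L \<in> selfadj" using Q(2) unfolding selfadj_def mem_Collect_eq left right by blast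
  ultimately show ?thesis
    by (simp add: eq G_crit_iff weak_ideal0_pushforward(1)[OF A(1)] trace_class_pushforward(1)[OF Q(1)])
qed

lemma pushforward_wedge_op:
  fixes L :: "'a::{real_inner, complete_space} \<Rightarrow>\<^sub>L 'b::{real_inner, complete_space}"
  shows "L o\<^sub>L wedge_op x y o\<^sub>L adj L = wedge_op (L x) (L y)"
  by (simp add: wedge_op_def blinfun_compose.diff_left blinfun_compose.diff_right pushforward_tensor_op)

lemma pushforward_hom:
  fixes L :: "'a::{real_inner, complete_space} \<Rightarrow>\<^sub>L 'b::{real_inner, complete_space}"
  shows "pushforward L \<in> hom crit_group crit_group"
proof (rule homI; unfold crit_group_simps)
  fix g h :: "'a triple"
  obtain x A Q y B R where gh: "g = (x, A, Q)" "h = (y, B, R)" by (metis prod_cases3)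
  have add: "L o\<^sub>L (S + T) o\<^sub>L adj L = (L o\<^sub>L S o\<^sub>L adj L) + (L o\<^sub>L T o\<^sub>L adj L)" for S T
    by (rule blinfun_eqI) (simp add: blinfun.add_left blinfun.add_right)
  have scale: "L o\<^sub>L (c *\<^sub>R T) o\<^sub>L adj L = c *\<^sub>R (L o\<^sub>L T o\<^sub>L adj L)" for c T
    by (rule blinfun_eqI) (simp add: blinfun.scaleR_left blinfun.scaleR_right)
  show "pushforward L (crit_mult g h) = crit_mult (pushforward L g) (pushforward L h)"
    by (simp add: gh add scale pushforward_wedge_op blinfun.add_right)
qed (rule pushforward_in)

lemma pushforward_continuous:
  fixes L :: "'a::{real_inner, complete_space} \<Rightarrow>\<^sub>L 'b::{real_inner, complete_space}"
  shows "continuous_map crit_topology crit_topology (pushforward L)"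
proof (rule continuous_map_crit_coordinatewise[where f = "blinfun_apply L" and \<Phi> = "\<lambda>T. L o\<^sub>L T o\<^sub>L adj L"
      and \<Psi> = "\<lambda>T. L o\<^sub>L T o\<^sub>L adj L" and F = "pushforward L", OF pushforward.simps pushforward_in])
  let ?c = "norm L + (norm L)\<^sup>2"
  fix x and A Q :: "'a \<Rightarrow>\<^sub>L 'a"
  show "norm (L x) \<le> ?c * norm x"
    by (rule order_trans[OF norm_blinfun]) (intro mult_right_mono, auto)
  show "weak_norm (L o\<^sub>L A o\<^sub>L adj L) \<le> ?c * weak_norm A" if A: "A \<in> weak_ideal0"
    by (rule order_trans[OF weak_ideal0_pushforward(2)[OF A]]) (intro mult_right_mono weak_norm_nonneg A, simp)
  show "trace_norm (L o\<^sub>L Q o\<^sub>L adj L) \<le> ?c * trace_norm Q" if Q: "Q \<in> trace_class"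
    by (rule order_trans[OF trace_class_pushforward(2)[OF Q]]) (intro mult_right_mono trace_norm_nonneg Q, simp)
qed (simp_all add: blinfun_compose.diff_left blinfun_compose.diff_right blinfun.diff_right)

lemma dilation_continuous:
  "continuous_map crit_topology (crit_topology :: 'a::{real_inner, complete_space} triple topology) (dilation a)"
proof (rule continuous_map_crit_coordinatewise[where f = "\<lambda>x. a *\<^sub>R x" and \<Phi> = "\<lambda>T. a\<^sup>2 *\<^sub>R T"
      and \<Psi> = "\<lambda>T. a\<^sup>2 *\<^sub>R T" and F = "dilation a" and c = "\<bar>a\<bar> + a\<^sup>2", OF dilation.simps])
  fix g :: "'a triple" assume "g \<in> G_crit"
  then show "dilation a g \<in> G_crit"
    by (cases g) (simp add: G_crit_iff weak_ideal0_scaleR trace_class_scaleR subspace_scale[OF subspace_skew]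
        subspace_scale[OF subspace_selfadj])
qed (simp_all add: scaleR_diff_right weak_norm_scaleR trace_class_scaleR weak_norm_nonneg trace_norm_nonneg
    mult_right_mono)

lemma continuous_crit_inv:
  "continuous_map crit_topology crit_topology (\<lambda>g. inv\<^bsub>crit_group\<^esub> (g :: 'a::{real_inner, complete_space} triple))"
proof (rule continuous_map_eq)
  show "continuous_map crit_topology crit_topology (\<lambda>(x :: 'a, A, Q). (- x, - A, - Q))"
    by (rule continuous_map_crit_coordinatewise[where c = 1 and f = uminus and \<Phi> = uminus and \<Psi> = uminus])
      (auto simp: crit_uminus_in weak_norm_minus trace_class_minus)
qed (auto simp: inv_crit)

proposition topological_group_crit:
  "topological_group (crit_group :: 'a::{real_inner, complete_space} triple monoid) crit_topology"
  unfolding topological_group_def using group_crit continuous_crit_mult continuous_crit_inv by simp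

text \<open>Left-closeness \<open>g\<^sup>-\<^sup>1 h \<approx> 1\<close> has middle coordinate \<open>B - A - (x \<and> (y - x))/2\<close>. A Cauchy filter
  contains a set on which \<open>x\<close> stays bounded, and there the wedge term is small as well, so the
  filter is Cauchy for the gauge.\<close>

lemma crit_left_close:
  fixes x y :: "'a::{real_inner, complete_space}"
  assumes G: "(x, A, Q) \<in> G_crit" "(y, B, R) \<in> G_crit" and x: "norm x \<le> M"
    and d: "crit_gauge (inv\<^bsub>crit_group\<^esub> (x, A, Q) \<otimes>\<^bsub>crit_group\<^esub> (y, B, R)) < \<delta>"
  shows "norm (y - x) < \<delta>" "crit_gauge ((y, B, R) - (x, A, Q)) \<le> \<delta> * (4 + 4 * M)"
proof -
  have I: "A \<in> weak_ideal0" "B \<in> weak_ideal0" "Q \<in> trace_class" "R \<in> trace_class"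
    using G by (auto simp: G_crit_iff)
  have M: "0 \<le> M" using x norm_ge_zero[of x] by linarith
  define w where "w = wedge_op x (y - x)"
  have wI: "w \<in> weak_ideal0" "B - A - (1/2) *\<^sub>R w \<in> weak_ideal0"
    unfolding w_def by (intro weak_ideal0_diff weak_ideal0_scaleR wedge_op_weak_ideal0 I)+
  have "crit_gauge (inv\<^bsub>crit_group\<^esub> (x, A, Q) \<otimes>\<^bsub>crit_group\<^esub> (y, B, R))
      = norm (y - x) + weak_norm (B - A - (1/2) *\<^sub>R w) + trace_norm (R - Q)"
    by (simp add: inv_crit[OF G(1)] w_def wedge_op.diff_right wedge_op.minus_left)
  then have lt: "norm (y - x) < \<delta>" "weak_norm (B - A - (1/2) *\<^sub>R w) < \<delta>" "trace_norm (R - Q) < \<delta>"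
    using d norm_ge_zero[of "y - x"] weak_norm_nonneg[OF wI(2)] trace_norm_nonneg[OF trace_class_diff[OF I(4) I(3)]]
    by linarith+
  show "norm (y - x) < \<delta>" by fact
  have "weak_norm w \<le> 4 * norm x * norm (y - x)" unfolding w_def by (rule weak_norm_wedge_op)
  also have "\<dots> \<le> 4 * M * \<delta>"
    using x lt(1) M by (intro mult_mono) auto
  finally have w: "weak_norm w \<le> 4 * M * \<delta>" .
  have "weak_norm (B - A) \<le> 2 * (weak_norm (B - A - (1/2) *\<^sub>R w) + weak_norm ((1/2) *\<^sub>R w))"
    using weak_norm_add[OF wI(2) weak_ideal0_scaleR[OF wI(1), of "1/2"]] by simp
  also have "\<dots> \<le> 2 * (\<delta> + 1/2 * (4 * M * \<delta>))"
    using lt(2) w by (intro mult_left_mono add_mono) (simp_all add: weak_norm_scaleR wI)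
  finally have "weak_norm (B - A) \<le> 2 * \<delta> + 4 * M * \<delta>" by (simp add: algebra_simps)
  then have "norm (y - x) + weak_norm (B - A) + trace_norm (R - Q) \<le> \<delta> + (2 * \<delta> + 4 * M * \<delta>) + \<delta>"
    using lt by (intro add_mono) auto
  then show "crit_gauge ((y, B, R) - (x, A, Q)) \<le> \<delta> * (4 + 4 * M)"
    unfolding crit_gauge_diff by (simp add: algebra_simps)
qed

proposition complete_group_crit:
  "complete_group (crit_group :: 'a::{real_inner, complete_space} triple monoid) crit_topology"
  unfolding complete_group_def crit_group_simps
proof (intro allI impI; elim conjE)
  fix F :: "'a triple filter"
  assume F: "F \<noteq> bot" "F \<le> principal G_crit"
    and C: "\<forall>U. openin crit_topology U \<and> (0, 0, 0) \<in> U \<longrightarrow>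
           (\<exists>S\<subseteq>G_crit. eventually (\<lambda>g. g \<in> S) F \<and>
              (\<forall>g\<in>S. \<forall>h\<in>S. crit_mult (inv\<^bsub>crit_group\<^esub> g) h \<in> U \<and> crit_mult h (inv\<^bsub>crit_group\<^esub> g) \<in> U))"
  have small: "\<exists>S\<subseteq>G_crit. eventually (\<lambda>g. g \<in> S) F
      \<and> (\<forall>g\<in>S. \<forall>h\<in>S. crit_gauge (inv\<^bsub>crit_group\<^esub> g \<otimes>\<^bsub>crit_group\<^esub> h) < \<delta>)" if \<delta>: "0 < \<delta>" for \<delta>
  proof -
    obtain U where U: "openin crit_topology U" "((0, 0, 0) :: 'a triple) \<in> U" "\<And>h. h \<in> U \<Longrightarrow> crit_gauge (h - (0, 0, 0)) < \<delta>"
      using crit_ball_neighbourhood[where g = "(0, 0, 0) :: 'a triple" and e = \<delta>] crit_one_in \<delta> by blast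
    have "h - (0, 0, 0) = h" for h :: "'a triple" by (cases h) simp
    then have "\<And>h. h \<in> U \<Longrightarrow> crit_gauge h < \<delta>" using U(3) by simp
    then show ?thesis using C[rule_format, OF conjI[OF U(1,2)]] unfolding crit_group_simps by meson
  qed
  have nonempty: "S \<noteq> {}" if "eventually (\<lambda>g. g \<in> S) F" for S
    using that F(1) by (auto simp: eventually_False)
  obtain S0 where S0: "S0 \<subseteq> G_crit" "eventually (\<lambda>g. g \<in> S0) F"
    "\<And>g h. g \<in> S0 \<Longrightarrow> h \<in> S0 \<Longrightarrow> crit_gauge (inv\<^bsub>crit_group\<^esub> g \<otimes>\<^bsub>crit_group\<^esub> h) < 1"
    using small[of 1] by auto
  obtain x0 A0 Q0 where g0: "(x0, A0, Q0) \<in> S0" using nonempty[OF S0(2)] by (metis ex_in_conv prod_cases3)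
  define M where "M = norm x0 + 1"
  have M: "norm x \<le> M" if "(x, A, Q) \<in> S0" for x A Q
  proof -
    have "norm (x - x0) < 1"
      by (rule crit_left_close(1)[of x0 A0 Q0 x A Q]) (use S0 g0 that in auto)
    then show ?thesis unfolding M_def using norm_triangle_ineq2[of x x0] by linarith
  qed
  have M0: "0 < M" by (simp add: M_def add_nonneg_pos)
  have gauge_small: "\<exists>S\<subseteq>G_crit. eventually (\<lambda>g. g \<in> S) F \<and> (\<forall>g\<in>S. \<forall>h\<in>S. crit_gauge (h - g) < e)"
    if e: "0 < e" for e
  proof -
    define K where "K = 4 + 4 * M"
    have K: "0 < K" using M0 by (simp add: K_def)
    define \<delta> where "\<delta> = e / (2 * K)"
    have \<delta>: "0 < \<delta>" "\<delta> * (4 + 4 * M) < e" using e K by (simp_all add: \<delta>_def flip: K_def)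
    obtain S where S: "S \<subseteq> G_crit" "eventually (\<lambda>g. g \<in> S) F"
      "\<And>g h. g \<in> S \<Longrightarrow> h \<in> S \<Longrightarrow> crit_gauge (inv\<^bsub>crit_group\<^esub> g \<otimes>\<^bsub>crit_group\<^esub> h) < \<delta>"
      using small[OF \<delta>(1)] by auto
    have "crit_gauge (h - g) < e" if "g \<in> S \<inter> S0" "h \<in> S \<inter> S0" for g h
    proof -
      obtain x A Q y B R where g: "g = (x, A, Q)" and h: "h = (y, B, R)" by (metis prod_cases3)
      have "crit_gauge (h - g) \<le> \<delta> * (4 + 4 * M)"
        unfolding g h by (rule crit_left_close(2)) (use that S M in \<open>auto simp: g h\<close>)
      then show ?thesis using \<delta>(2) by linarith
    qed
    moreover have "eventually (\<lambda>g. g \<in> S \<inter> S0) F" using S(2) S0(2) by eventually_elim simp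
    ultimately show ?thesis using S(1) by (intro exI[of _ "S \<inter> S0"]) blast
  qed
  then have "\<exists>S\<subseteq>G_crit. eventually (\<lambda>g. g \<in> S) F \<and> (\<forall>g\<in>S. \<forall>h\<in>S. crit_gauge (h - g) < 1 / real (Suc n))" for n
    by simp
  then obtain S where S: "\<And>n. S n \<subseteq> G_crit" "\<And>n. eventually (\<lambda>g. g \<in> S n) F"
    "\<And>n g h. g \<in> S n \<Longrightarrow> h \<in> S n \<Longrightarrow> crit_gauge (h - g) < 1 / real (Suc n)" by metis
  have "eventually (\<lambda>g. g \<in> (\<Inter>i\<le>n. S i)) F" for n
    using eventually_ball_finite[of "{..n}" "\<lambda>g i. g \<in> S i" F] S(2) by simp
  then have "\<exists>g. g \<in> (\<Inter>i\<le>n. S i)" for n using nonempty by blast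
  then obtain \<sigma> where \<sigma>: "\<And>n. \<sigma> n \<in> (\<Inter>i\<le>n. S i)" by metis
  have \<sigma>S: "\<sigma> m \<in> S n" if "n \<le> m" for m n using \<sigma>[of m] that by auto
  have rng: "range \<sigma> \<subseteq> G_crit" using \<sigma>S[of 0] S(1) by blast
  have small_n: "\<exists>n. 1 / real (Suc n) < e" if "0 < e" for e :: real
    using reals_Archimedean[OF that] by (simp add: inverse_eq_divide)
  have "\<exists>n0. \<forall>m\<ge>n0. \<forall>n\<ge>n0. crit_gauge (\<sigma> m - \<sigma> n) < e" if "0 < e" for e
    using small_n[OF that] S(3) \<sigma>S by (meson order_less_trans)
  then obtain l where l: "l \<in> G_crit" "(\<lambda>n. crit_gauge (\<sigma> n - l)) \<longlonglongrightarrow> 0"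
    using gauge_complete_crit rng unfolding gauge_complete_def by blast
  have "limitin crit_topology (\<lambda>g. g) l F"
    unfolding limitin_def
  proof (intro conjI allI impI)
    show "l \<in> topspace crit_topology" using l by simp
    fix U assume "openin crit_topology U \<and> l \<in> U"
    then obtain e where e: "0 < e" "\<And>h. h \<in> G_crit \<Longrightarrow> crit_gauge (h - l) < e \<Longrightarrow> h \<in> U"
      using crit_topology_nbhd by metis
    define u where "u = e / 4"
    have u: "0 < u" using e(1) by (simp add: u_def)
    obtain n where n: "1 / real (Suc n) < u" using small_n[OF u(1)] by blast
    have "\<forall>\<^sub>F m in sequentially. crit_gauge (\<sigma> m - l) < u" by (rule order_tendstoD(2)[OF l(2) u(1)])
    then obtain N where "\<And>m. m \<ge> N \<Longrightarrow> crit_gauge (\<sigma> m - l) < u" by (auto simp: eventually_sequentially)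
    then obtain m where m: "n \<le> m" "crit_gauge (\<sigma> m - l) < u" using max.cobounded1 max.cobounded2 by blast
    show "\<forall>\<^sub>F g in F. g \<in> U"
      using S(2)[of n]
    proof eventually_elim
      fix g assume g: "g \<in> S n"
      have G: "g \<in> G_crit" "\<sigma> m \<in> G_crit" using g S(1) rng by blast+
      have gm: "crit_gauge (g - \<sigma> m) < u" using S(3)[OF \<sigma>S[OF m(1)] g] n by linarith
      have "crit_gauge (g - l) < e"
        using crit_gauge_triangle[OF G l(1)] gm m(2) by (simp add: u_def)
      then show "g \<in> U" by (rule e(2)[OF G(1)])
    qed
  qed
  then show "\<exists>l. limitin crit_topology (\<lambda>g. g) l F" by blast
qed

text \<open>A strictly negative value \<open>Q v \<bullet> v\<close> stays negative under perturbations of \<open>Q\<close> that are small in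
  operator norm, hence under small ones in trace norm.\<close>

lemma closedin_G_crit_pos: "closedin crit_topology (G_crit_pos :: 'a::{real_inner, complete_space} triple set)"
  unfolding closedin_def topspace_crit
proof
  show "G_crit_pos \<subseteq> (G_crit :: 'a triple set)" by (auto simp: G_crit_pos_def)
  show "openin crit_topology (G_crit - G_crit_pos :: 'a triple set)"
    unfolding crit_topology_def openin_gauge_topology
  proof (intro conjI ballI)
    fix g :: "'a triple" assume g: "g \<in> G_crit - G_crit_pos"
    obtain x A Q where eq: "g = (x, A, Q)" by (metis prod_cases3)
    obtain v where v: "Q v \<bullet> v < 0" using g by (auto simp: eq G_crit_pos_def psd_def G_crit_iff not_le)
    then have v0: "0 < norm v" by auto
    show "\<exists>e>0. \<forall>h\<in>G_crit. crit_gauge (h - g) < e \<longrightarrow> h \<in> G_crit - G_crit_pos"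
    proof (intro exI[of _ "- (Q v \<bullet> v) / (norm v)\<^sup>2"] conjI ballI impI)
      show "0 < - (Q v \<bullet> v) / (norm v)\<^sup>2" using v v0 by (simp add: divide_neg_pos)
      fix h :: "'a triple" assume h: "h \<in> G_crit" and lt: "crit_gauge (h - g) < - (Q v \<bullet> v) / (norm v)\<^sup>2"
      obtain y B R where h': "h = (y, B, R)" by (metis prod_cases3)
      have RQ: "R - Q \<in> trace_class" using g h by (auto simp: eq h' G_crit_iff trace_class_diff)
      have "norm (R - Q) < - (Q v \<bullet> v) / (norm v)\<^sup>2"
        using norm_le_trace_norm[OF RQ] crit_gauge_parts(3)[of y B R x A Q] lt g h unfolding eq h' by auto
      then have small: "norm (R - Q) * (norm v)\<^sup>2 < - (Q v \<bullet> v)" using v0 by (simp add: field_simps)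
      have "R v \<bullet> v - Q v \<bullet> v = (R - Q) v \<bullet> v" by (simp add: blinfun.diff_left inner_diff_left)
      also have "\<dots> \<le> norm ((R - Q) v) * norm v" by (rule norm_cauchy_schwarz)
      also have "\<dots> \<le> norm (R - Q) * norm v * norm v" by (intro mult_right_mono norm_blinfun) simp
      also have "\<dots> = norm (R - Q) * (norm v)\<^sup>2" by (simp add: power2_eq_square)
      finally have "R v \<bullet> v < 0" using small by linarith
      then show "h \<in> G_crit - G_crit_pos" using h by (auto simp: h' G_crit_pos_def psd_def not_le)
    qed
  qed auto
qed

lemma submonoid_G_crit_pos: "submonoid G_crit_pos (crit_group :: 'a::{real_inner, complete_space} triple monoid)"
proof (rule submonoid.intro; unfold crit_group_simps)
  show "G_crit_pos \<subseteq> (G_crit :: 'a triple set)" by (auto simp: G_crit_pos_def)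
  show "(0, 0, 0) \<in> (G_crit_pos :: 'a triple set)"
    using crit_one_in by (auto simp: G_crit_pos_def psd_def G_crit_iff)
  fix g h :: "'a triple" assume gh: "g \<in> G_crit_pos" "h \<in> G_crit_pos"
  obtain x A Q y B R where eq: "g = (x, A, Q)" "h = (y, B, R)" by (metis prod_cases3)
  have "crit_mult g h \<in> G_crit" using gh by (intro crit_mult_in) (auto simp: G_crit_pos_def)
  then show "crit_mult g h \<in> G_crit_pos" using gh
    by (auto simp: eq G_crit_pos_def psd_def G_crit_iff blinfun.add_left inner_add_left)
qed

proposition polish_crit: "polish_topology (crit_topology :: 'a::{real_inner, polish_space} triple topology)"
proof -
  interpret r: renorming "1/2" "\<lambda>T :: 'a \<Rightarrow>\<^sub>L 'a. (weak_root_norm T)\<^sup>2" by (rule renorming_half)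
  show ?thesis
    unfolding polish_topology_def completely_metrizable_space_def
    using separable_crit r.Metric_space_crit r.mtopology_crit r.mcomplete_crit by metis
qed

theorem theorem6p7:
  shows "is_completion G_fin G_crit (crit_gauge :: 'a::{real_inner, polish_space} triple \<Rightarrow> real)
    \<and> subgroup G_fin (crit_group :: 'a triple monoid)
    \<and> topological_group (crit_group :: 'a triple monoid) crit_topology
    \<and> (\<forall>(x :: 'a, A, Q) \<in> G_crit. inv\<^bsub>crit_group\<^esub> (x, A, Q) = (- x, - A, - Q))
    \<and> separable_space (crit_topology :: 'a triple topology)
    \<and> complete_group (crit_group :: 'a triple monoid) crit_topology
    \<and> (\<exists>\<theta> (N :: ('a \<Rightarrow>\<^sub>L 'a) \<Rightarrow> real). 0 < \<theta> \<and> \<theta> \<le> 1 \<and> power_subadditive_renorming \<theta> N)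
    \<and> (\<forall>\<theta> (N :: ('a \<Rightarrow>\<^sub>L 'a) \<Rightarrow> real).
          0 < \<theta> \<and> \<theta> \<le> 1 \<and> power_subadditive_renorming \<theta> N \<longrightarrow>
          Metric_space G_crit (crit_dist \<theta> N) \<and>
          Metric_space.mtopology G_crit (crit_dist \<theta> N) = crit_topology \<and>
          Metric_space.mcomplete G_crit (crit_dist \<theta> N))
    \<and> polish_topology (crit_topology :: 'a triple topology)
    \<and> closedin (crit_topology :: 'a triple topology) G_crit_pos
    \<and> submonoid G_crit_pos (crit_group :: 'a triple monoid)
    \<and> (\<forall>L :: 'a \<Rightarrow>\<^sub>L 'b::{real_inner, polish_space}.
          pushforward L \<in> hom crit_group crit_group \<and>
          continuous_map crit_topology crit_topology (pushforward L))
    \<and> (\<forall>a. continuous_map crit_topology (crit_topology :: 'a triple topology) (dilation a))"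
proof (intro conjI)
  show "\<forall>(x :: 'a, A, Q) \<in> G_crit. inv\<^bsub>crit_group\<^esub> (x, A, Q) = (- x, - A, - Q)"
    using inv_crit by blast
  show "\<exists>\<theta> (N :: ('a \<Rightarrow>\<^sub>L 'a) \<Rightarrow> real). 0 < \<theta> \<and> \<theta> \<le> 1 \<and> power_subadditive_renorming \<theta> N"
    using renorming_half[where 'a = 'a] unfolding renorming_def by blast
  show "\<forall>\<theta> (N :: ('a \<Rightarrow>\<^sub>L 'a) \<Rightarrow> real).
          0 < \<theta> \<and> \<theta> \<le> 1 \<and> power_subadditive_renorming \<theta> N \<longrightarrow>
          Metric_space G_crit (crit_dist \<theta> N) \<and>
          Metric_space.mtopology G_crit (crit_dist \<theta> N) = crit_topology \<and>
          Metric_space.mcomplete G_crit (crit_dist \<theta> N)"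
    using renorming.Metric_space_crit renorming.mtopology_crit renorming.mcomplete_crit
    unfolding renorming_def by blast
qed (simp_all add: is_completion_crit subgroup_G_fin topological_group_crit separable_crit complete_group_crit
    polish_crit closedin_G_crit_pos submonoid_G_crit_pos pushforward_hom pushforward_continuous dilation_continuous)

end
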